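(* Let $D$, $\Delta$, $m=m(n)$ and $\chi$ be as described in the context, and let $\mathcal{F}$ be a multigraph family with generating function $F(z,w,(\delta_0,\delta_1,\ldots))$. The number of $(n,m,D)$-multigraphs in which one $\mathcal{F}$-subgraph is distinguished (i.e. the number of pairs $(G,S)$ where $G$ is an $(n,m,D)$-multigraph and $S$ is a sub-multigraph of $G$ isomorphic to a member of $\mathcal{F}$) is $$ n!\,2^m m!\,[z^n w^m]\sum_{j\ge 0}(2j)!\,[x^{2j}]\; F\big(z,w,(\Delta(x),\Delta'(x),\Delta''(x),\ldots)\big)\,e^{z\Delta(x)}\,\frac{w^j}{2^j j!}.$$ Moreover, if the functions $$(z,w,x)\mapsto\frac{F\left(\frac{nz}{\Delta(x\chi)},\frac{w(x\chi)^2}{2m},(\Delta(x\chi),\Delta'(x\chi),\ldots)\right)}{F\left(\frac{n}{\Delta(\chi)},\frac{\chi^2}{2m},(\Delta(\chi),\Delta'(\chi),\ldots)\right)}$$ converge, as $n\to\infty$, uniformly on any compact set to an analytic function, then, as $n\to\infty$, this number is asymptotically equivalent to $$\mathrm{MG}_{n,m,D}\; F\left(\frac{n}{\Delta(\chi)},\frac{\chi^2}{2m},(\Delta(\chi),\Delta'(\chi),\ldots)\right),$$ where $\mathrm{MG}_{n,m,D}$ denotes the total number of $(n,m,D)$-multigraphs.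
   Context: A multigraph $G=(V(G),E(G))$ has a finite set of labeled vertices and a finite set of labeled oriented edges; each edge is an oriented pair of vertices, and loops and multiple edges are allowed. An $(n,m)$-multigraph has $n$ vertices labeled $1,\dots,n$ and $m$ edges labeled $1,\dots,m$. The degree of a vertex is the number of half-edges at it (a loop contributes $2$). A sub-multigraph of $G$ consists of a subset of the vertices and a subset of the edges (keeping labels and orientations) whose endpoints lie in the chosen vertex subset. Two multigraphs are isomorphic if there are bijections between their vertex sets and between their edge sets that preserve incidence; edge orientations and labels are disregarded. An $\mathcal{F}$-subgraph of $G$ is a sub-multigraph of $G$ isomorphic to some member of the family $\mathcal{F}$. For a multigraph family $\mathcal{F}$, let $\mathcal{F}_{n,m,(d_0,d_1,\ldots)}$ be the number of $(n,m)$-multigraphs with $d_j$ vertices of degree $j$ for all $j\ge 0$ that are isomorphic to some member of $\mathcal{F}$. The generating function of $\mathcal{F}$ is $$F(z,w,(\delta_0,\delta_1,\ldots))=\sum_{n,m,d_0,d_1,\ldots}\mathcal{F}_{n,m,(d_0,d_1,\ldots)}\Big(\prod_{s\ge 0}\delta_s^{d_s}\Big)\frac{w^m}{2^m m!}\frac{z^n}{n!}.$$ $D$ is a set of nonnegative integers containing at least two elements, with $\gcd(d-\min(D)\mid d\in D)=1$ ($\max(D)=+\infty$ if $D$ is infinite). An $(n,m,D)$-multigraph is an $(n,m)$-multigraph all of whose vertices have degree in $D$. It is assumed that $m=m(n)$ goes to infinity with $n$ in such a way that $2m/n$ has a limit in the open interval $]\min(D),\max(D)[$. Put $\Delta(x)=\sum_{d\in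 D}\frac{x^d}{d!}$, and let $\chi=\chi_{m/n}$ be the unique positive solution of $\frac{\chi\Delta'(\chi)}{\Delta(\chi)}=\frac{2m}{n}$. $[z^n w^m]$ and $[x^{2j}]$ denote coefficient extraction. *)

theory Defs
  imports
    "HOL-Analysis.Analysis"
    "HOL-Computational_Algebra.Computational_Algebra"
    "HOL-Library.Landau_Symbols"
    "Graph_Theory.Graph_Theory"
begin

text \<open>
  Multigraphs are the finite digraphs (loops and parallel arcs allowed) of \<^locale>\<open>fin_digraph\<close>.
  A loop contributes one to the in-degree and one to the out-degree of its vertex.
\<close>

definition mg_degree :: "('a, 'b) pre_digraph \<Rightarrow> 'a \<Rightarrow> nat" where
  "mg_degree G v = in_degree G v + out_degree G v"

text \<open>
  The functions \<^const>\<open>tail\<close> and \<^const>\<open>head\<close> are total; requiring them to be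
  \<^const>\<open>undefined\<close> outside the arc set makes each multigraph be counted exactly once.
\<close>

definition nm_multigraph :: "nat \<Rightarrow> nat \<Rightarrow> (nat, nat) pre_digraph \<Rightarrow> bool" where
  "nm_multigraph n m G \<longleftrightarrow>
     fin_digraph G \<and> verts G = {1..n} \<and> arcs G = {1..m} \<and>
     tail G \<in> extensional {1..m} \<and> head G \<in> extensional {1..m}"

definition nmD_multigraph :: "nat \<Rightarrow> nat \<Rightarrow> nat set \<Rightarrow> (nat, nat) pre_digraph \<Rightarrow> bool" where
  "nmD_multigraph n m D G \<longleftrightarrow> nm_multigraph n m G \<and> (\<forall>v\<in>verts G. mg_degree G v \<in> D)"

text \<open>
  Isomorphism ignores labels and orientations: the library's digraph isomorphism preserves
  orientations and hence is too fine here.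
\<close>

definition multigraph_iso :: "('a, 'b) pre_digraph \<Rightarrow> ('c, 'd) pre_digraph \<Rightarrow> bool" where
  "multigraph_iso G H \<longleftrightarrow>
     (\<exists>f g. bij_betw f (verts G) (verts H) \<and> bij_betw g (arcs G) (arcs H) \<and>
            (\<forall>e\<in>arcs G. {tail H (g e), head H (g e)} = f ` {tail G e, head G e}))"

text \<open>
  In \<^const>\<open>subgraph\<close> both graphs have the same total functions \<^const>\<open>tail\<close> and \<^const>\<open>head\<close>, so a
  sub-multigraph of a given multigraph is determined by its vertex set and its arc set.
\<close>

definition distinguished ::
  "(nat, nat) pre_digraph set \<Rightarrow> nat \<Rightarrow> nat \<Rightarrow> nat set
     \<Rightarrow> ((nat, nat) pre_digraph \<times> (nat, nat) pre_digraph) set" where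
  "distinguished Fam n m D =
     {(G, S). nmD_multigraph n m D G \<and> subgraph S G \<and> (\<exists>H\<in>Fam. multigraph_iso S H)}"

definition MG :: "nat \<Rightarrow> nat \<Rightarrow> nat set \<Rightarrow> nat" where
  "MG n m D = card {G. nmD_multigraph n m D G}"

definition family_count ::
  "(nat, nat) pre_digraph set \<Rightarrow> nat \<Rightarrow> nat \<Rightarrow> (nat \<Rightarrow> nat) \<Rightarrow> nat" where
  "family_count Fam n m d =
     card {G. nm_multigraph n m G \<and> (\<forall>j. card {v \<in> verts G. mg_degree G v = j} = d j) \<and>
              (\<exists>H\<in>Fam. multigraph_iso G H)}"

text \<open>
  For given \<open>n\<close> and \<open>m\<close> only finitely many degree profiles \<open>d\<close> have a nonzero count, and each of
  these has finite support. The sum over \<open>d\<close> is thus a polynomial in the variables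
  \<open>\<delta> 0, \<delta> 1, \<dots>\<close>; it is used with power series and with numbers substituted for them.
\<close>

definition family_poly ::
  "(nat, nat) pre_digraph set \<Rightarrow> nat \<Rightarrow> nat \<Rightarrow> (nat \<Rightarrow> 'a) \<Rightarrow> 'a::comm_semiring_1" where
  "family_poly Fam n m \<delta> =
     (\<Sum>d | family_count Fam n m d \<noteq> 0.
        of_nat (family_count Fam n m d) * (\<Prod>s | d s \<noteq> 0. \<delta> s ^ d s))"

text \<open>
  Formal power series in the three variables are nested: \<open>w\<close> is the outermost variable, then \<open>z\<close>,
  and \<open>x\<close> is the innermost one.
\<close>

definition family_fps ::
  "(nat, nat) pre_digraph set \<Rightarrow> (nat \<Rightarrow> real fps) \<Rightarrow> real fps fps fps" where
  "family_fps Fam \<delta> =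
     Abs_fps (\<lambda>m. Abs_fps (\<lambda>n.
       fps_const (1 / (2 ^ m * fact m * fact n)) * family_poly Fam n m \<delta>))"

text \<open>The series of \<open>exp (z * A(x))\<close> (\<^const>\<open>fps_exp\<close> needs a field of coefficients).\<close>

definition exp_z_fps :: "real fps \<Rightarrow> real fps fps fps" where
  "exp_z_fps A = fps_const (Abs_fps (\<lambda>k. fps_const (1 / fact k) * A ^ k))"

definition coeff_x :: "nat \<Rightarrow> real fps fps fps \<Rightarrow> real fps fps" where
  "coeff_x k A = Abs_fps (\<lambda>m. Abs_fps (\<lambda>n. fps_nth (fps_nth (fps_nth A m) n) k))"

text \<open>\<open>F(z, w, \<delta>)\<close> at numbers is the sum over all pairs \<open>(n, m)\<close>, where it converges.\<close>

definition family_term ::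
  "(nat, nat) pre_digraph set \<Rightarrow> 'a \<Rightarrow> 'a \<Rightarrow> (nat \<Rightarrow> 'a) \<Rightarrow> nat \<times> nat
     \<Rightarrow> 'a::{banach, real_normed_field}" where
  "family_term Fam z w \<delta> =
     (\<lambda>(n, m). family_poly Fam n m \<delta> * (w ^ m / (2 ^ m * fact m)) * (z ^ n / fact n))"

definition family_gf ::
  "(nat, nat) pre_digraph set \<Rightarrow> 'a \<Rightarrow> 'a \<Rightarrow> (nat \<Rightarrow> 'a) \<Rightarrow> 'a::{banach, real_normed_field}" where
  "family_gf Fam z w \<delta> = (\<Sum>\<^sub>\<infinity>p. family_term Fam z w \<delta> p)"

definition Delta_fps :: "nat set \<Rightarrow> 'a::field_char_0 fps" where
  "Delta_fps D = Abs_fps (\<lambda>d. if d \<in> D then 1 / fact d else 0)"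

definition Delta_derivs_fps :: "nat set \<Rightarrow> nat \<Rightarrow> 'a::field_char_0 fps" where
  "Delta_derivs_fps D s = (fps_deriv ^^ s) (Delta_fps D)"

text \<open>\<open>Delta_derivs D x\<close> is the sequence \<open>\<Delta>(x), \<Delta>'(x), \<Delta>''(x), \<dots>\<close>; the series is entire.\<close>

definition Delta_derivs :: "nat set \<Rightarrow> 'a \<Rightarrow> nat \<Rightarrow> 'a::{banach, real_normed_field}" where
  "Delta_derivs D x s = eval_fps (Delta_derivs_fps D s) x"

abbreviation Delta :: "nat set \<Rightarrow> 'a \<Rightarrow> 'a::{banach, real_normed_field}" where
  "Delta D x \<equiv> Delta_derivs D x 0"

text \<open>\<open>chi D r\<close> is the saddle point \<open>\<chi>\<close>, where \<open>r\<close> stands for \<open>m/n\<close>.\<close>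

definition chi :: "nat set \<Rightarrow> real \<Rightarrow> real" where
  "chi D r = (THE t. t > 0 \<and> t * Delta_derivs D t 1 / Delta D t = 2 * r)"

definition F_at_chi :: "(nat, nat) pre_digraph set \<Rightarrow> nat set \<Rightarrow> nat \<Rightarrow> nat \<Rightarrow> real" where
  "F_at_chi Fam D n m =
     (let t = chi D (real m / real n)
      in family_gf Fam (real n / Delta D t) (t\<^sup>2 / (2 * real m)) (Delta_derivs D t))"

definition scaled_term ::
  "(nat, nat) pre_digraph set \<Rightarrow> nat set \<Rightarrow> nat \<Rightarrow> nat \<Rightarrow> complex \<times> complex \<times> complex
     \<Rightarrow> nat \<times> nat \<Rightarrow> complex" where
  "scaled_term Fam D n m = (\<lambda>(z, w, x).
     let y = x * complex_of_real (chi D (real m / real n))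
     in family_term Fam (of_nat n * z / Delta D y) (w * y\<^sup>2 / (2 * of_nat m)) (Delta_derivs D y))"

definition F_ratio ::
  "(nat, nat) pre_digraph set \<Rightarrow> nat set \<Rightarrow> nat \<Rightarrow> nat \<Rightarrow> complex \<times> complex \<times> complex
     \<Rightarrow> complex" where
  "F_ratio Fam D n m p =
     (\<Sum>\<^sub>\<infinity>q. scaled_term Fam D n m p q) / complex_of_real (F_at_chi Fam D n m)"

text \<open>
  \<open>n * z / \<Delta>(x * \<chi>)\<close> has poles at the zeros of the denominator (for most finite \<open>D\<close> there are
  complex ones). As \<open>n\<close> grows, \<open>\<chi>\<close> tends to \<open>chi D (c / 2)\<close>, \<open>c\<close> being the limit of \<open>2 * m / n\<close>.
  Hence on a compact subset of the following open set the denominator has no zero for large \<open>n\<close>.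
\<close>

definition ratio_domain :: "nat set \<Rightarrow> real \<Rightarrow> (complex \<times> complex \<times> complex) set" where
  "ratio_domain D c = {(z, w, x). Delta D (x * complex_of_real (chi D (c / 2))) \<noteq> 0}"

definition analytic3_on ::
  "(complex \<times> complex \<times> complex \<Rightarrow> complex) \<Rightarrow> (complex \<times> complex \<times> complex) set \<Rightarrow> bool" where
  "analytic3_on f S \<longleftrightarrow>
     (\<forall>(z0, w0, x0)\<in>S. \<exists>r>0. \<exists>a :: nat \<times> nat \<times> nat \<Rightarrow> complex. \<forall>z w x.
        dist z z0 < r \<and> dist w w0 < r \<and> dist x x0 < r \<longrightarrow>
        ((\<lambda>(i, j, k). a (i, j, k) * (z - z0) ^ i * (w - w0) ^ j * (x - x0) ^ k)
           has_sum f (z, w, x)) UNIV)"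

definition ratio_converges ::
  "(nat, nat) pre_digraph set \<Rightarrow> nat set \<Rightarrow> (nat \<Rightarrow> nat) \<Rightarrow> real \<Rightarrow> bool" where
  "ratio_converges Fam D m c \<longleftrightarrow>
     (\<exists>f. analytic3_on f (ratio_domain D c) \<and>
        (\<forall>K. compact K \<and> K \<subseteq> ratio_domain D c \<longrightarrow>
           (\<forall>\<^sub>F n in sequentially. \<forall>p\<in>K. scaled_term Fam D n (m n) p summable_on UNIV) \<and>
           uniform_limit K (\<lambda>n. F_ratio Fam D n (m n)) f sequentially))"

end

theory Submission
  imports Defs "HOL-Probability.Distributions" "HOL-Probability.Characteristic_Functions"
    "HOL-Real_Asymp.Real_Asymp"
begin

text \<open>
  Choosing the vertices and edges of a subgraph \<open>S\<close> and then the ends of the remaining \<open>j\<close> edges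
  amounts to a function from \<open>2 j\<close> half-edges to the vertices. A vertex of degree \<open>s\<close> in \<open>S\<close> receives
  \<open>d\<close> of them with \<open>d + s \<in> D\<close>, so its exponential generating function is the derivative of order
  \<open>s\<close> of \<open>\<Delta>\<close>. This gives the exact formula.

  For the asymptotics, write both the number of pairs and \<open>MG\<close> as integrals over the circle of radius
  \<open>\<chi>\<close>. Rescaled by \<open>sqrt n\<close>, the integrand of \<open>MG\<close> is bounded by a Gaussian and its integral stays
  away from 0. The other integrand is the same one times a weighted sum of the terms of the ratio
  of the values of \<open>F\<close>; the weights come from replacing factorials by powers and tend to 1.
  They grow at most exponentially in the size of the subgraph, so boundedness of the ratio at
  points \<open>(R, R, 1)\<close> with large \<open>R\<close> dominates everything, even far from the saddle point, and near
  it the continuity of the limit in \<open>x\<close> at \<open>(1, 1, 1)\<close> applies. Dominated convergence concludes.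
\<close>

section \<open>Exact enumeration\<close>

text \<open>The argument \<open>n * z / \<Delta>(x * \<chi>)\<close> may have poles on the
  integration circle, so the ratio of the values of \<open>F\<close> is evaluated at non-real
  \<open>x\<close> only close to 1. Elsewhere nothing is divided by \<open>\<Delta>(y)\<close>: a
  subgraph with \<open>k\<close> vertices leaves the power \<open>n - k\<close> of
  \<open>\<bar>\<Delta>(y)\<bar> / \<Delta>(t)\<close>. Since this quotient is at most
  \<open>exp (- c * \<theta>^2)\<close> and \<open>\<bar>\<theta>\<bar> \<le> pi\<close>, the
  \<open>k\<close> missing factors cost at most \<open>exp (c * pi^2) ^ k\<close>, again a geometric
  weight. Weights \<open>R ^ (k + l)\<close> are harmless because all terms of \<open>F\<close> at
  positive arguments are nonnegative and the weighted sum is just \<open>F\<close> at rescaled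
  \<open>z\<close> and \<open>w\<close>. The integral for \<open>MG\<close> is never evaluated
  asymptotically. The variance in its Gaussian approximation varies with \<open>n\<close>, and
  neither its convergence nor a positive lower bound for it is established. A positive lower bound
  for the integral is enough, because the difference of the two normalised integrals tends to 0. The
  value of \<open>F\<close> at the saddle point may be 0, in which case both sides of the
  equivalence are eventually compared as 0 with 0.\<close>

lemma sum_Pow_card:
  fixes g :: "nat \<Rightarrow> 'a::semiring_1"
  assumes "finite H"
  shows "(\<Sum>U\<in>Pow H. g (card U)) = (\<Sum>d\<le>card H. of_nat (card H choose d) * g d)"
proof -
  have "(\<Sum>U\<in>Pow H. g (card U)) = (\<Sum>d\<le>card H. \<Sum>U | U \<in> Pow H \<and> card U = d. g (card U))"
    by (rule sum.group[symmetric]) (use assms in \<open>auto intro: card_mono\<close>)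
  also have "\<dots> = (\<Sum>d\<le>card H. of_nat (card H choose d) * g d)"
    by (intro sum.cong refl) (use assms in \<open>auto simp: n_subsets\<close>)
  finally show ?thesis .
qed

text \<open>The product rule for exponential generating functions, by induction on \<open>V\<close>:
  a function into \<open>insert v V\<close> is its fibre \<open>U\<close> over \<open>v\<close>
  together with a function from \<open>H - U\<close> to \<open>V\<close>. Counting the sets
  \<open>U\<close> by size gives binomial coefficients, which turn the sum into a Cauchy
  product.\<close>

lemma card_functions_fibres:
  fixes V :: "'v set" and H :: "'h set" and E :: "'v \<Rightarrow> nat set"
  assumes "finite V" "finite H"
  shows "(of_nat (card {h \<in> H \<rightarrow>\<^sub>E V. \<forall>v\<in>V. card {p\<in>H. h p = v} \<in> E v}) :: 'a::field_char_0)
    = fact (card H) * fps_nth (\<Prod>v\<in>V. Abs_fps (\<lambda>d. if d \<in> E v then 1 / fact d else 0)) (card H)"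
  using assms
proof (induction V arbitrary: H rule: finite_induct)
  case empty
  then show ?case by auto
next
  case (insert v V H)
  let ?F = "\<lambda>V H. {h \<in> H \<rightarrow>\<^sub>E V. \<forall>v\<in>V. card {p\<in>H. h p = v} \<in> E v}"
  let ?P = "\<Prod>v\<in>V. Abs_fps (\<lambda>d. if d \<in> E v then 1 / fact d else (0::'a))"
  let ?S = "SIGMA U:{U\<in>Pow H. card U \<in> E v}. ?F V (H - U)"
  \<comment> \<open>\<open>\<phi>\<close> separates the fibre over \<open>v\<close> from the rest,
    \<open>\<psi>\<close> glues the two parts together again.\<close>
  define \<phi> where "\<phi> h = ({p\<in>H. h p = v}, restrict h (H - {p\<in>H. h p = v}))" for h :: "'h \<Rightarrow> 'v"
  define \<psi> where "\<psi> = (\<lambda>(U::'h set, h) p. if p \<in> U then v else (h p :: 'v))"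
  have fibre: "{p\<in>H - U. h p = w} = {p \<in> H. \<psi> (U, h) p = w}" if "w \<noteq> v" for U h w
    using that by (auto simp: \<psi>_def)
  have "bij_betw \<phi> (?F (insert v V) H) ?S"
  proof (rule bij_betw_byWitness[where f' = \<psi>])
    show "\<forall>h\<in>?F (insert v V) H. \<psi> (\<phi> h) = h"
      by (auto simp: \<phi>_def \<psi>_def fun_eq_iff PiE_def extensional_def)
    show "\<forall>a\<in>?S. \<phi> (\<psi> a) = a"
    proof safe
      fix U h assume *: "U \<subseteq> H" "h \<in> (H - U) \<rightarrow>\<^sub>E V"
      \<comment> \<open>As \<open>v\<close> is not in \<open>V\<close>, the glued function takes the
        value \<open>v\<close> on \<open>U\<close> only, so \<open>U\<close> can be recovered from
        it.\<close>
      then have "h p \<noteq> v" if "p \<in> H" "p \<notin> U" for p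
        using insert.hyps that by (auto simp: PiE_def Pi_def)
      then have U: "{p \<in> H. \<psi> (U, h) p = v} = U"
        using * by (auto simp: \<psi>_def)
      then show "\<phi> (\<psi> (U, h)) = (U, h)"
        using * by (auto simp: \<phi>_def \<psi>_def fun_eq_iff PiE_def extensional_def)
    qed
    show "\<phi> ` ?F (insert v V) H \<subseteq> ?S"
    proof (rule image_subsetI)
      fix h assume "h \<in> ?F (insert v V) H"
      then have h: "h \<in> H \<rightarrow>\<^sub>E insert v V" "\<forall>w\<in>insert v V. card {p \<in> H. h p = w} \<in> E w"
        by auto
      let ?U = "{p \<in> H. h p = v}"
      have "{p \<in> H - ?U. restrict h (H - ?U) p = w} = {p \<in> H. h p = w}" if "w \<in> V" for w
        using insert.hyps that by auto
      moreover have "restrict h (H - ?U) \<in> (H - ?U) \<rightarrow>\<^sub>E V"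
        using h by auto
      ultimately show "\<phi> h \<in> ?S"
        using h(2) by (auto simp: \<phi>_def)
    qed
    show "\<psi> ` ?S \<subseteq> ?F (insert v V) H"
    proof (rule image_subsetI)
      fix a assume "a \<in> ?S"
      then obtain U h where a: "a = (U, h)" and *: "U \<subseteq> H" "card U \<in> E v" "h \<in> (H - U) \<rightarrow>\<^sub>E V"
        "\<forall>w\<in>V. card {p \<in> H - U. h p = w} \<in> E w"
        by auto
      then have "h p \<noteq> v" if "p \<in> H" "p \<notin> U" for p
        using insert.hyps that by (auto simp: PiE_def Pi_def)
      then have U: "{p \<in> H. \<psi> (U, h) p = v} = U"
        using * by (auto simp: \<psi>_def)
      have "\<psi> (U, h) \<in> H \<rightarrow>\<^sub>E insert v V"
        using * by (auto simp: \<psi>_def PiE_def Pi_def extensional_def)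
      moreover have "card {p \<in> H. \<psi> (U, h) p = w} \<in> E w" if "w \<in> insert v V" for w
        using * U fibre[of w U h] that by (cases "w = v") auto
      ultimately show "\<psi> a \<in> ?F (insert v V) H"
        by (simp add: a)
    qed
  qed
  then have "card (?F (insert v V) H) = card ?S"
    by (rule bij_betw_same_card)
  also have "\<dots> = (\<Sum>U\<in>{U\<in>Pow H. card U \<in> E v}. card (?F V (H - U)))"
  proof (intro card_SigmaI ballI)
    show "finite (?F V (H - U))" for U
      by (rule finite_subset[OF _ finite_PiE[of "H - U" "\<lambda>_. V"]]) (use insert in auto)
  qed (use insert.prems in auto)
  finally have "of_nat (card (?F (insert v V) H))
      = (\<Sum>U\<in>{U\<in>Pow H. card U \<in> E v}. of_nat (card (?F V (H - U))) :: 'a)"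
    by simp
  also have "\<dots> = (\<Sum>U\<in>Pow H. if card U \<in> E v then fact (card H - card U) * fps_nth ?P (card H - card U) else 0)"
  proof (rule sum.mono_neutral_cong_left)
    fix U assume "U \<in> {U \<in> Pow H. card U \<in> E v}"
    with insert.prems have "U \<subseteq> H" "finite U" "card U \<in> E v" "finite (H - U)"
      by (auto intro: finite_subset)
    with insert.IH[of "H - U"] show "of_nat (card (?F V (H - U))) =
        (if card U \<in> E v then fact (card H - card U) * fps_nth ?P (card H - card U) else 0)"
      by (simp add: card_Diff_subset)
  qed (use insert.prems in auto)
  also have "\<dots> = (\<Sum>d\<le>card H. of_nat (card H choose d) *
      (if d \<in> E v then fact (card H - d) * fps_nth ?P (card H - d) else 0))"
    using insert.prems by (rule sum_Pow_card)
  also have "\<dots> = (\<Sum>d\<le>card H. fact (card H) * ((if d \<in> E v then 1 / fact d else 0) * fps_nth ?P (card H - d)))"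
    by (intro sum.cong refl) (auto simp: binomial_fact)
  also have "\<dots> = fact (card H) * fps_nth (Abs_fps (\<lambda>d. if d \<in> E v then 1 / fact d else 0) * ?P) (card H)"
    by (simp add: fps_mult_nth sum_distrib_left atLeast0AtMost)
  finally show ?case
    using insert.hyps by simp
qed

lemma Delta_derivs_fps_eq:
  "Delta_derivs_fps D s = Abs_fps (\<lambda>d. if d + s \<in> D then 1 / fact d else (0::'a::field_char_0))"
proof (induction s)
  case 0
  then show ?case by (simp add: Delta_derivs_fps_def Delta_fps_def)
next
  case (Suc s)
  have "Delta_derivs_fps D (Suc s) = fps_deriv (Delta_derivs_fps D s :: 'a fps)"
    by (simp add: Delta_derivs_fps_def)
  then show ?case
    by (auto simp: Suc fps_eq_iff of_nat_Suc[symmetric] simp del: of_nat_Suc)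
qed

section \<open>Multigraphs as functions on half-edges\<close>

text \<open>Arbitrary label sets are allowed because a subgraph and the edges outside it carry
  subsets of the labels \<open>{1..n}\<close> and \<open>{1..m}\<close>.\<close>

definition multigraphs_on :: "'a set \<Rightarrow> 'b set \<Rightarrow> ('a, 'b) pre_digraph set" where
  "multigraphs_on V A = {G. verts G = V \<and> arcs G = A \<and> tail G \<in> A \<rightarrow>\<^sub>E V \<and> head G \<in> A \<rightarrow>\<^sub>E V}"

lemma nm_multigraph_iff: "nm_multigraph n m G \<longleftrightarrow> G \<in> multigraphs_on {1..n} {1..m}"
  by (auto simp: nm_multigraph_def multigraphs_on_def fin_digraph_def wf_digraph_def
      fin_digraph_axioms_def PiE_def Pi_def)

lemma mg_degree_eq:
  "mg_degree G v = card {e \<in> arcs G. tail G e = v} + card {e \<in> arcs G. head G e = v}"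
  by (simp add: mg_degree_def in_degree_def out_degree_def in_arcs_def out_arcs_def)

text \<open>The Boolean marks the tail end (\<open>True\<close>) or the head end of an edge. Degrees
  become fibre sizes, and a loop counts twice since both its half-edges have the same image.\<close>

definition half_edges :: "('a, 'b) pre_digraph \<Rightarrow> 'b \<times> bool \<Rightarrow> 'a" where
  "half_edges G = restrict (\<lambda>(e, b). if b then tail G e else head G e) (arcs G \<times> UNIV)"

lemma card_half_edges:
  assumes "finite (arcs G)"
  shows "card {p \<in> arcs G \<times> UNIV. half_edges G p = v} = mg_degree G v"
proof -
  have "{p \<in> arcs G \<times> UNIV. half_edges G p = v} =
      (\<lambda>e. (e, True)) ` {e \<in> arcs G. tail G e = v} \<union> (\<lambda>e. (e, False)) ` {e \<in> arcs G. head G e = v}"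
    by (auto simp: half_edges_def split: if_splits)
  also have "card \<dots> = mg_degree G v"
    using assms unfolding mg_degree_eq
    by (subst card_Un_disjoint) (auto simp: card_image inj_on_def)
  finally show ?thesis .
qed

lemma bij_half_edges:
  "bij_betw half_edges (multigraphs_on V A) (A \<times> UNIV \<rightarrow>\<^sub>E V)"
proof (rule bij_betw_byWitness[where f' = "\<lambda>h. \<lparr>verts = V, arcs = A,
    tail = restrict (\<lambda>e. h (e, True)) A, head = restrict (\<lambda>e. h (e, False)) A\<rparr>"])
qed (auto simp: half_edges_def multigraphs_on_def fun_eq_iff PiE_def Pi_def extensional_def
      intro!: pre_digraph.equality split: if_splits)

lemma finite_multigraphs_on:
  assumes "finite V" "finite A"
  shows "finite (multigraphs_on V A)"
  using bij_betw_finite[OF bij_half_edges, of V A] finite_PiE[of "A \<times> (UNIV::bool set)" "\<lambda>_. V"] assms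
  by simp

text \<open>Here \<open>s v\<close> is the degree that \<open>v\<close> already has in the subgraph,
  and \<open>R\<close> consists of the remaining edges on the full vertex set. The case
  \<open>s = 0\<close> yields the number of all multigraphs with degrees in
  \<open>D\<close>.\<close>

lemma card_completions:
  fixes s :: "'v \<Rightarrow> nat" and A :: "'e set"
  assumes "finite V" "finite A"
  shows "(of_nat (card {R \<in> multigraphs_on V A. \<forall>v\<in>V. s v + mg_degree R v \<in> D}) :: 'a::field_char_0)
    = fact (2 * card A) * fps_nth (\<Prod>v\<in>V. Delta_derivs_fps D (s v)) (2 * card A)"
proof -
  let ?H = "A \<times> (UNIV::bool set)"
  have "bij_betw half_edges {R \<in> multigraphs_on V A. \<forall>v\<in>V. s v + mg_degree R v \<in> D}
      {h \<in> ?H \<rightarrow>\<^sub>E V. \<forall>v\<in>V. card {p\<in>?H. h p = v} \<in> {d. d + s v \<in> D}}"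
  proof (rule bij_betw_Collect[OF bij_half_edges])
    fix R assume "R \<in> multigraphs_on V A"
    then have R: "arcs R = A" by (simp add: multigraphs_on_def)
    have "card {p\<in>?H. half_edges R p = v} = mg_degree R v" for v
      using card_half_edges[of R v] assms(2) R by simp
    then show "(\<forall>v\<in>V. card {p\<in>?H. half_edges R p = v} \<in> {d. d + s v \<in> D}) =
        (\<forall>v\<in>V. s v + mg_degree R v \<in> D)"
      by (simp add: add.commute)
  qed
  then have "card {R \<in> multigraphs_on V A. \<forall>v\<in>V. s v + mg_degree R v \<in> D} =
     card {h \<in> ?H \<rightarrow>\<^sub>E V. \<forall>v\<in>V. card {p\<in>?H. h p = v} \<in> {d. d + s v \<in> D}}"
    by (rule bij_betw_same_card)
  also have "(of_nat \<dots> :: 'a) = fact (card ?H) * fps_nth (\<Prod>v\<in>V. Abs_fps (\<lambda>d.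
      if d \<in> {d. d + s v \<in> D} then 1 / fact d else 0)) (card ?H)"
    using assms by (intro card_functions_fibres) auto
  also have "card ?H = 2 * card A"
    by (simp add: card_cartesian_product)
  finally show ?thesis
    by (simp add: Delta_derivs_fps_eq)
qed

section \<open>Independence of the choice of labels\<close>

text \<open>Vertices are pushed forward by \<open>f\<close>, but \<open>g\<close> leads from the new
  edge labels back to the old ones, since \<open>tail\<close> and \<open>head\<close> are functions
  of the edge. The facts below assume both bijections with their inverses, so they can be used in
  either direction.\<close>

definition relabel :: "('a \<Rightarrow> 'c) \<Rightarrow> ('d \<Rightarrow> 'b) \<Rightarrow> 'c set \<Rightarrow> 'd set
    \<Rightarrow> ('a, 'b) pre_digraph \<Rightarrow> ('c, 'd) pre_digraph" where
  "relabel f g V A G = \<lparr>verts = V, arcs = A,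
     tail = restrict (\<lambda>e. f (tail G (g e))) A, head = restrict (\<lambda>e. f (head G (g e))) A\<rparr>"

context
  fixes f :: "'a \<Rightarrow> 'c" and f' g g' V V' and A :: "'b set" and A' :: "'d set"
  assumes f: "\<And>v. v \<in> V \<Longrightarrow> f v \<in> V' \<and> f' (f v) = v"
    and f': "\<And>v. v \<in> V' \<Longrightarrow> f' v \<in> V \<and> f (f' v) = v"
    and g: "\<And>e. e \<in> A \<Longrightarrow> g e \<in> A' \<and> g' (g e) = e"
    and g': "\<And>e. e \<in> A' \<Longrightarrow> g' e \<in> A \<and> g (g' e) = e"
begin

lemma relabel_in: "G \<in> multigraphs_on V A \<Longrightarrow> relabel f g' V' A' G \<in> multigraphs_on V' A'"
  using f g' by (auto simp: multigraphs_on_def relabel_def PiE_def Pi_def)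

lemma relabel_inverse:
  "G \<in> multigraphs_on V A \<Longrightarrow> relabel f' g V A (relabel f g' V' A' G) = G"
  using f g by (auto simp: multigraphs_on_def relabel_def PiE_def Pi_def fun_eq_iff extensional_def
      intro!: pre_digraph.equality)

lemma mg_degree_relabel:
  assumes "G \<in> multigraphs_on V A" "v \<in> V"
  shows "mg_degree (relabel f g' V' A' G) (f v) = mg_degree G v"
proof -
  have "card {e \<in> A'. restrict (\<lambda>e. f (h (g' e))) A' e = f v} = card {e \<in> A. h e = v}"
    if h: "h \<in> A \<rightarrow>\<^sub>E V" for h
  proof (rule bij_betw_same_card[of g'], rule bij_betw_byWitness[where f' = g])
    show "g' ` {e \<in> A'. restrict (\<lambda>e. f (h (g' e))) A' e = f v} \<subseteq> {e \<in> A. h e = v}"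
      using h g' f[OF assms(2)] f by (auto simp: PiE_def Pi_def) metis
  qed (use h g g' f in \<open>auto simp: PiE_def Pi_def\<close>)
  then show ?thesis
    using assms(1) by (simp add: mg_degree_eq multigraphs_on_def relabel_def)
qed

lemma multigraph_iso_relabel:
  assumes G: "G \<in> multigraphs_on V A" and "multigraph_iso G H"
  shows "multigraph_iso (relabel f g' V' A' G) H"
proof -
  have G': "verts G = V" "arcs G = A" "\<And>e. e \<in> A \<Longrightarrow> tail G e \<in> V \<and> head G e \<in> V"
    using G by (auto simp: multigraphs_on_def)
  from assms(2) obtain p q where pq: "bij_betw p V (verts H)" "bij_betw q A (arcs H)"
    "\<forall>e\<in>A. {tail H (q e), head H (q e)} = p ` {tail G e, head G e}"
    unfolding multigraph_iso_def G' by blast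
  have "bij_betw f' V' V" "bij_betw g' A' A"
    using f f' g g' by (auto intro!: bij_betw_byWitness[where f' = f] bij_betw_byWitness[where f' = g])
  then have "bij_betw (p \<circ> f') V' (verts H)" "bij_betw (q \<circ> g') A' (arcs H)"
    using pq by (blast intro: bij_betw_trans)+
  moreover have "\<forall>e\<in>A'. {tail H (q (g' e)), head H (q (g' e))}
      = (p \<circ> f') ` {f (tail G (g' e)), f (head G (g' e))}"
    using pq(3) g' G'(3) f by simp
  ultimately show ?thesis
    unfolding multigraph_iso_def
    by (intro exI[of _ "p \<circ> f'"] exI[of _ "q \<circ> g'"]) (simp add: relabel_def)
qed

end

definition family_on :: "(nat, nat) pre_digraph set \<Rightarrow> 'a set \<Rightarrow> 'b set \<Rightarrow> ('a, 'b) pre_digraph set" where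
  "family_on Fam V A = {G \<in> multigraphs_on V A. \<exists>H\<in>Fam. multigraph_iso G H}"

lemma finite_family_on: "finite V \<Longrightarrow> finite A \<Longrightarrow> finite (family_on Fam V A)"
  by (simp add: family_on_def finite_multigraphs_on)

text \<open>Relabelling is a bijection that preserves degrees and isomorphism to members of
  \<open>Fam\<close>. It transports the sum over subgraphs on given label sets \<open>W\<close> and
  \<open>U\<close> to the labels \<open>{1..k}\<close> and \<open>{1..l}\<close> on which
  \<open>family_poly\<close> is defined.\<close>

lemma family_on_weight_cong:
  fixes \<delta> :: "nat \<Rightarrow> 'x::comm_semiring_1"
  assumes "finite V" "finite V'" "finite A" "finite A'" "card V = card V'" "card A = card A'"
  shows "(\<Sum>G\<in>family_on Fam V A. \<Prod>v\<in>V. \<delta> (mg_degree G v)) =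
         (\<Sum>G\<in>family_on Fam V' A'. \<Prod>v\<in>V'. \<delta> (mg_degree G v))"
proof -
  obtain f g where fg: "bij_betw f V V'" "bij_betw g A A'"
    using assms by (metis finite_same_card_bij)
  define f' where "f' = inv_into V f"
  define g' where "g' = inv_into A g"
  have f: "\<And>v. v \<in> V \<Longrightarrow> f v \<in> V' \<and> f' (f v) = v"
    and f': "\<And>v. v \<in> V' \<Longrightarrow> f' v \<in> V \<and> f (f' v) = v"
    and g: "\<And>e. e \<in> A \<Longrightarrow> g e \<in> A' \<and> g' (g e) = e"
    and g': "\<And>e. e \<in> A' \<Longrightarrow> g' e \<in> A \<and> g (g' e) = e"
    using fg unfolding f'_def g'_def
    by (auto simp: bij_betw_def f_inv_into_f inv_into_into)
  show ?thesis
  proof (rule sum.reindex_bij_witness[where i = "relabel f' g V A" and j = "relabel f g' V' A'"])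
    fix G assume "G \<in> family_on Fam V A"
    then have G: "G \<in> multigraphs_on V A" "\<exists>H\<in>Fam. multigraph_iso G H"
      by (auto simp: family_on_def)
    show "relabel f' g V A (relabel f g' V' A' G) = G"
      by (rule relabel_inverse[of V f V' f' A g A' g', OF f f' g g' G(1)])
    show "relabel f g' V' A' G \<in> family_on Fam V' A'"
      using G multigraph_iso_relabel[of V f V' f' A g A' g', OF f f' g g' G(1)]
        relabel_in[of V f V' f' A g A' g', OF f f' g g' G(1)]
      unfolding family_on_def by auto
    show "(\<Prod>v\<in>V'. \<delta> (mg_degree (relabel f g' V' A' G) v)) = (\<Prod>v\<in>V. \<delta> (mg_degree G v))"
    proof (rule prod.reindex_bij_witness[where i = f and j = f'])
      fix v assume v: "v \<in> V'"
      then show "\<delta> (mg_degree G (f' v)) = \<delta> (mg_degree (relabel f g' V' A' G) v)"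
        using mg_degree_relabel[of V f V' f' A g A' g', OF f f' g g' G(1), of "f' v"] f' by auto
    qed (use f f' in auto)
  next
    fix G assume "G \<in> family_on Fam V' A'"
    then have G: "G \<in> multigraphs_on V' A'" "\<exists>H\<in>Fam. multigraph_iso G H"
      by (auto simp: family_on_def)
    show "relabel f g' V' A' (relabel f' g V A G) = G"
      by (rule relabel_inverse[of V' f' V f A' g' A g, OF f' f g' g G(1)])
    show "relabel f' g V A G \<in> family_on Fam V A"
      using G multigraph_iso_relabel[of V' f' V f A' g' A g, OF f' f g' g G(1)]
        relabel_in[of V' f' V f A' g' A g, OF f' f g' g G(1)]
      unfolding family_on_def by auto
  qed
qed

text \<open>Graphs with the same degree profile have the same weight, so grouping them by profile
  gives the defining sum. The form with one product over vertices per graph is the one that fits the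
  product over vertices in the count of completions.\<close>

lemma family_poly_eq:
  fixes \<delta> :: "nat \<Rightarrow> 'x::comm_semiring_1"
  shows "family_poly Fam n m \<delta> =
    (\<Sum>G\<in>family_on Fam {1..n} {1..m}. \<Prod>v\<in>{1..n}. \<delta> (mg_degree G v))"
proof -
  let ?S = "family_on Fam {1..n} {1..m}"
  define pr where "pr G j = card {v \<in> {1..n}. mg_degree G v = j}" for G :: "(nat, nat) pre_digraph" and j
  have fin: "finite ?S" by (simp add: finite_family_on)
  have count: "family_count Fam n m d = card {G \<in> ?S. pr G = d}" for d
    unfolding family_count_def nm_multigraph_iff family_on_def
    by (rule arg_cong[where f = card]) (auto simp: pr_def fun_eq_iff multigraphs_on_def)
  have "(\<Prod>v\<in>{1..n}. \<delta> (mg_degree G v)) = (\<Prod>s | pr G s \<noteq> 0. \<delta> s ^ pr G s)" for G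
  proof -
    have eq: "{s. pr G s \<noteq> 0} = mg_degree G ` {1..n}"
      by (auto simp: pr_def card_eq_0_iff)
    have "(\<Prod>v\<in>{1..n}. \<delta> (mg_degree G v)) =
        (\<Prod>s\<in>mg_degree G ` {1..n}. \<Prod>v | v \<in> {1..n} \<and> mg_degree G v = s. \<delta> (mg_degree G v))"
      by (rule prod.group[symmetric]) auto
    then show ?thesis
      unfolding eq by (simp add: pr_def)
  qed
  then have "(\<Sum>G\<in>?S. \<Prod>v\<in>{1..n}. \<delta> (mg_degree G v)) = (\<Sum>G\<in>?S. \<Prod>s | pr G s \<noteq> 0. \<delta> s ^ pr G s)"
    by simp
  also have "\<dots> = (\<Sum>d\<in>pr ` ?S. \<Sum>G | G \<in> ?S \<and> pr G = d. \<Prod>s | pr G s \<noteq> 0. \<delta> s ^ pr G s)"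
    by (rule sum.group[symmetric]) (use fin in auto)
  also have "\<dots> = (\<Sum>d\<in>pr ` ?S. of_nat (family_count Fam n m d) * (\<Prod>s | d s \<noteq> 0. \<delta> s ^ d s))"
    by (intro sum.cong refl) (simp add: count)
  also have "pr ` ?S = {d. family_count Fam n m d \<noteq> 0}"
    using fin by (auto simp: count card_eq_0_iff)
  finally show ?thesis
    by (simp add: family_poly_def)
qed

section \<open>Pairs of a multigraph and a subgraph\<close>

text \<open>A pair \<open>(G, S)\<close> corresponds to the label sets of \<open>S\<close>, the
  graph \<open>S\<close> itself, and the graph \<open>R\<close> of the edges outside
  \<open>S\<close> on all vertices. For fixed \<open>S\<close> the choices of \<open>R\<close> are
  completions. The sum over \<open>S\<close> depends only on the sizes \<open>k\<close> and
  \<open>l\<close> of the label sets, which can be chosen in \<open>n choose k\<close> and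
  \<open>m choose l\<close> ways.\<close>

lemma card_distinguished:
  "(of_nat (card (distinguished Fam n m D)) :: 'a::field_char_0) =
    (\<Sum>k\<le>n. \<Sum>l\<le>m. of_nat (n choose k) * of_nat (m choose l) * fact (2 * (m - l)) *
      fps_nth (family_poly Fam k l (Delta_derivs_fps D) * Delta_fps D ^ (n - k)) (2 * (m - l)))"
proof -
  define V where "V = {1..n}"
  define A where "A = {1..m}"
  have fin[simp]: "finite V" "finite A" by (simp_all add: V_def A_def)
  define C where "C S = {R \<in> multigraphs_on V (A - arcs S). \<forall>v\<in>V. mg_degree S v + mg_degree R v \<in> D}"
    for S :: "(nat, nat) pre_digraph"
  define B where "B = (SIGMA q:Pow V \<times> Pow A. SIGMA S:family_on Fam (fst q) (snd q). C S)"
  \<comment> \<open>A subgraph shares the total functions \<open>tail\<close> and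
    \<open>head\<close> of \<open>G\<close>, whereas the members of \<open>family_on\<close> have
    them undefined outside their own edges. So \<open>rs\<close> restricts these functions to
    \<open>U\<close>, and \<open>mrg\<close> below pastes the restrictions together.\<close>
  define rs where "rs G U = \<lparr>verts = V, arcs = U, tail = restrict (tail G) U, head = restrict (head G) U\<rparr>"
    for G :: "(nat, nat) pre_digraph" and U
  define \<phi> where "\<phi> = (\<lambda>(G, S :: (nat, nat) pre_digraph). ((verts S, arcs S), (rs G (arcs S))\<lparr>verts := verts S\<rparr>, rs G (A - arcs S)))"
  define mrg where "mrg S R = \<lparr>verts = V, arcs = A, tail = (\<lambda>e. if e \<in> arcs S then tail S e else tail R e),
    head = (\<lambda>e. if e \<in> arcs S then head S e else head R e)\<rparr>" for S R :: "(nat, nat) pre_digraph"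
  define \<psi> where "\<psi> = (\<lambda>(q::nat set \<times> nat set, S, R).
    (mrg S R, (mrg S R)\<lparr>verts := verts S, arcs := arcs S\<rparr>))"
  \<comment> \<open>Isomorphism sees \<open>tail\<close> and \<open>head\<close> on the edge set
    only, so restricting them does not affect membership in the family.\<close>
  have iso_cong: "multigraph_iso S H \<longleftrightarrow> multigraph_iso S' H"
    if "verts S = verts S'" "arcs S = arcs S'" "\<And>e. e \<in> arcs S \<Longrightarrow> tail S e = tail S' e \<and> head S e = head S' e"
    for S S' H :: "(nat, nat) pre_digraph"
    unfolding multigraph_iso_def using that by (auto cong: conj_cong)
  have deg: "mg_degree G v = mg_degree S v + mg_degree R v"
    if "arcs S \<subseteq> arcs G" "finite (arcs G)" "arcs R = arcs G - arcs S"
      "\<And>e. e \<in> arcs S \<Longrightarrow> tail S e = tail G e \<and> head S e = head G e"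
      "\<And>e. e \<in> arcs G - arcs S \<Longrightarrow> tail R e = tail G e \<and> head R e = head G e"
    for G S R :: "(nat, nat) pre_digraph" and v
  proof -
    have "card {e \<in> arcs G. h e = v} = card {e \<in> arcs S. h1 e = v} + card {e \<in> arcs R. h2 e = v}"
      if "\<And>e. e \<in> arcs S \<Longrightarrow> h1 e = h e" "\<And>e. e \<in> arcs G - arcs S \<Longrightarrow> h2 e = h e"
      for h h1 h2 :: "nat \<Rightarrow> nat"
    proof -
      have "{e \<in> arcs G. h e = v} = {e \<in> arcs S. h1 e = v} \<union> {e \<in> arcs R. h2 e = v}"
        using that \<open>arcs S \<subseteq> arcs G\<close> \<open>arcs R = _\<close> by auto
      then show ?thesis
        using \<open>finite (arcs G)\<close> \<open>arcs S \<subseteq> arcs G\<close> \<open>arcs R = _\<close>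
        by (simp add: card_Un_disjoint finite_subset disjoint_iff)
    qed
    from this[of "tail S" "tail G" "tail R"] this[of "head S" "head G" "head R"] that
    show ?thesis by (simp add: mg_degree_eq)
  qed
  have "bij_betw \<phi> (distinguished Fam n m D) B"
  proof (rule bij_betw_byWitness[where f' = \<psi>])
    have dist: "distinguished Fam n m D = {(G, S). G \<in> multigraphs_on V A \<and> (\<forall>v\<in>V. mg_degree G v \<in> D) \<and>
       subgraph S G \<and> (\<exists>H\<in>Fam. multigraph_iso S H)}"
      by (auto simp: distinguished_def nmD_multigraph_def nm_multigraph_iff V_def A_def multigraphs_on_def)
    show "\<forall>a\<in>distinguished Fam n m D. \<psi> (\<phi> a) = a"
      by (auto simp: dist \<psi>_def \<phi>_def rs_def mrg_def multigraphs_on_def subgraph_def compatible_def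
          fun_eq_iff PiE_def extensional_def intro!: pre_digraph.equality)
    show "\<forall>a\<in>B. \<phi> (\<psi> a) = a"
      by (auto simp: B_def C_def family_on_def \<psi>_def \<phi>_def rs_def mrg_def multigraphs_on_def
          fun_eq_iff PiE_def extensional_def intro!: pre_digraph.equality)
    show "\<phi> ` distinguished Fam n m D \<subseteq> B"
    proof (rule image_subsetI)
      fix a assume "a \<in> distinguished Fam n m D"
      then obtain G S H where a: "a = (G, S)" and G: "G \<in> multigraphs_on V A" "\<forall>v\<in>V. mg_degree G v \<in> D"
        and S: "subgraph S G" and H: "H \<in> Fam" "multigraph_iso S H"
        by (auto simp: dist)
      let ?S = "(rs G (arcs S))\<lparr>verts := verts S\<rparr>" and ?R = "rs G (A - arcs S)"
      have sub: "verts S \<subseteq> V" "arcs S \<subseteq> A" "tail S = tail G" "head S = head G" "wf_digraph S"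
        and arcs: "arcs G = A"
        using S G by (auto simp: subgraph_def compatible_def multigraphs_on_def)
      have "multigraph_iso ?S H"
        using H by (subst iso_cong[of _ S]) (auto simp: rs_def sub)
      moreover have "?S \<in> multigraphs_on (verts S) (arcs S)"
        using sub by (auto simp: rs_def multigraphs_on_def wf_digraph_def)
      moreover have "?R \<in> multigraphs_on V (A - arcs ?S)"
        using G by (auto simp: rs_def multigraphs_on_def)
      moreover have "mg_degree ?S v + mg_degree ?R v = mg_degree G v" for v
        by (rule deg[symmetric]) (use sub arcs in \<open>auto simp: rs_def\<close>)
      ultimately have "?S \<in> family_on Fam (verts S) (arcs S)" "?R \<in> C ?S"
        using G(2) H(1) by (auto simp: C_def family_on_def)
      moreover have "\<phi> a = ((verts S, arcs S), ?S, ?R)"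
        by (simp add: a \<phi>_def)
      ultimately show "\<phi> a \<in> B"
        using sub(1,2) by (simp add: B_def)
    qed
    show "\<psi> ` B \<subseteq> distinguished Fam n m D"
    proof (rule image_subsetI)
      fix a assume "a \<in> B"
      then obtain W U S R where a: "a = ((W, U), S, R)" and WU: "W \<subseteq> V" "U \<subseteq> A"
        and SF: "S \<in> family_on Fam W U" and RC: "R \<in> C S"
        unfolding B_def by auto
      from SF obtain H where S: "S \<in> multigraphs_on W U" and H: "H \<in> Fam" "multigraph_iso S H"
        unfolding family_on_def by blast
      from S have [simp]: "arcs S = U"
        by (simp add: multigraphs_on_def)
      from RC have R: "R \<in> multigraphs_on V (A - U)" "\<forall>v\<in>V. mg_degree S v + mg_degree R v \<in> D"
        unfolding C_def by simp_all
      let ?G = "mrg S R" and ?S = "(mrg S R)\<lparr>verts := verts S, arcs := arcs S\<rparr>"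
      have "multigraph_iso ?S H"
        using H by (subst iso_cong[of _ S]) (auto simp: mrg_def)
      moreover have "subgraph ?S ?G"
        using S R WU by (auto simp: mrg_def subgraph_def compatible_def wf_digraph_def multigraphs_on_def)
      moreover have "?G \<in> multigraphs_on V A"
        using S R WU by (auto simp: mrg_def multigraphs_on_def PiE_def Pi_def extensional_def)
      moreover have "mg_degree ?G v = mg_degree S v + mg_degree R v" for v
        by (rule deg) (use S R WU in \<open>auto simp: mrg_def multigraphs_on_def\<close>)
      moreover have "\<psi> a = (?G, ?S)"
        by (simp add: a \<psi>_def)
      ultimately show "\<psi> a \<in> distinguished Fam n m D"
        using R(2) H(1) unfolding dist by auto
    qed
  qed
  then have "card (distinguished Fam n m D) = card B"
    by (rule bij_betw_same_card)
  also have "\<dots> = (\<Sum>q\<in>Pow V \<times> Pow A. \<Sum>S\<in>family_on Fam (fst q) (snd q). card (C S))"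
  proof -
    have finC: "finite (C S)" for S
      unfolding C_def by (rule finite_subset[OF _ finite_multigraphs_on[of V "A - arcs S"]]) auto
    have finF: "finite (family_on Fam W U)" if "W \<subseteq> V" "U \<subseteq> A" for W U
      using that by (intro finite_family_on) (auto intro: finite_subset[of _ V] finite_subset[of _ A])
    have "card (SIGMA S:family_on Fam W U. C S) = (\<Sum>S\<in>family_on Fam W U. card (C S))"
      if "W \<subseteq> V" "U \<subseteq> A" for W U
      using that finC finF by (intro card_SigmaI) auto
    moreover have "card B = (\<Sum>q\<in>Pow V \<times> Pow A. card (SIGMA S:family_on Fam (fst q) (snd q). C S))"
      unfolding B_def using finC finF by (intro card_SigmaI) auto
    ultimately show ?thesis
      by (auto intro!: sum.cong)
  qed
  also have "of_nat \<dots> = (\<Sum>W\<in>Pow V. \<Sum>U\<in>Pow A. \<Sum>S\<in>family_on Fam W U. of_nat (card (C S)) :: 'a)"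
    by (simp add: sum.cartesian_product' case_prod_unfold)
  also have "\<dots> = (\<Sum>W\<in>Pow V. \<Sum>U\<in>Pow A. fact (2 * (m - card U)) *
      fps_nth (family_poly Fam (card W) (card U) (Delta_derivs_fps D) * Delta_fps D ^ (n - card W)) (2 * (m - card U)))"
  proof (intro sum.cong refl)
    fix W U assume "W \<in> Pow V" "U \<in> Pow A"
    then have WU: "W \<subseteq> V" "U \<subseteq> A" and WUf: "finite W" "finite U"
      by (auto intro: finite_subset[of _ V] finite_subset[of _ A])
    have cU: "card (A - U) = m - card U"
      using WU WUf by (simp add: card_Diff_subset A_def)
    have "of_nat (card (C S)) = fact (2 * (m - card U)) * fps_nth
        ((\<Prod>v\<in>W. Delta_derivs_fps D (mg_degree S v)) * Delta_fps D ^ (n - card W) :: 'a fps) (2 * (m - card U))"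
      if S: "S \<in> family_on Fam W U" for S
    proof -
      have arcs: "arcs S = U" and "\<And>e. e \<in> U \<Longrightarrow> tail S e \<in> W \<and> head S e \<in> W"
        using S by (auto simp: family_on_def multigraphs_on_def)
      \<comment> \<open>Vertices outside \<open>W\<close> are isolated from the edges of
        \<open>S\<close> and each contributes \<open>\<Delta>\<close> itself, whence the power
        \<open>n - card W\<close>.\<close>
      then have "mg_degree S v = 0" if "v \<in> V - W" for v
        using that by (auto simp: mg_degree_eq card_eq_0_iff)
      then have "(\<Prod>v\<in>V - W. Delta_derivs_fps D (mg_degree S v)) = (\<Prod>v\<in>V - W. Delta_fps D :: 'a fps)"
        by (intro prod.cong) (auto simp: Delta_derivs_fps_def)
      also have "\<dots> = Delta_fps D ^ (n - card W)"
        using WU WUf by (simp add: card_Diff_subset V_def)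
      finally have "(\<Prod>v\<in>V. Delta_derivs_fps D (mg_degree S v)) =
          (\<Prod>v\<in>W. Delta_derivs_fps D (mg_degree S v)) * (Delta_fps D ^ (n - card W) :: 'a fps)"
        using prod.subset_diff[OF WU(1), of "\<lambda>v. Delta_derivs_fps D (mg_degree S v) :: 'a fps"]
        by (simp add: mult.commute)
      then show ?thesis
        using card_completions[of V "A - U" "mg_degree S" D, where 'a = 'a] by (simp add: C_def arcs cU)
    qed
    then have "(\<Sum>S\<in>family_on Fam W U. of_nat (card (C S))) = fact (2 * (m - card U)) * fps_nth
        ((\<Sum>S\<in>family_on Fam W U. \<Prod>v\<in>W. Delta_derivs_fps D (mg_degree S v)) *
          Delta_fps D ^ (n - card W) :: 'a fps) (2 * (m - card U))"
      by (simp add: sum_distrib_right sum_distrib_left fps_sum_nth)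
    also have "(\<Sum>S\<in>family_on Fam W U. \<Prod>v\<in>W. Delta_derivs_fps D (mg_degree S v)) =
        (family_poly Fam (card W) (card U) (Delta_derivs_fps D) :: 'a fps)"
      unfolding family_poly_eq by (rule family_on_weight_cong) (use WUf in auto)
    finally show "(\<Sum>S\<in>family_on Fam W U. of_nat (card (C S)) :: 'a) = fact (2 * (m - card U)) *
      fps_nth (family_poly Fam (card W) (card U) (Delta_derivs_fps D) * Delta_fps D ^ (n - card W)) (2 * (m - card U))" .
  qed
  also have "\<dots> = (\<Sum>k\<le>n. of_nat (n choose k) * (\<Sum>l\<le>m. of_nat (m choose l) * (fact (2 * (m - l)) *
      fps_nth (family_poly Fam k l (Delta_derivs_fps D) * Delta_fps D ^ (n - k)) (2 * (m - l)))))"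
  proof -
    define h where "h k l = fact (2 * (m - l)) * fps_nth (family_poly Fam k l (Delta_derivs_fps D) *
      (Delta_fps D :: 'a fps) ^ (n - k)) (2 * (m - l))" for k l
    have "(\<Sum>W\<in>Pow V. \<Sum>U\<in>Pow A. h (card W) (card U)) =
        (\<Sum>W\<in>Pow V. \<Sum>l\<le>m. of_nat (m choose l) * h (card W) l)"
      by (intro sum.cong refl, subst sum_Pow_card[OF fin(2)]) (simp add: A_def)
    also have "\<dots> = (\<Sum>k\<le>n. of_nat (n choose k) * (\<Sum>l\<le>m. of_nat (m choose l) * h k l))"
      by (subst sum_Pow_card[OF fin(1), of "\<lambda>k. \<Sum>l\<le>m. of_nat (m choose l) * h k l"]) (simp add: V_def)
    finally show ?thesis
      unfolding h_def .
  qed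
  finally show ?thesis
    by (simp add: sum_distrib_left mult.assoc)
qed

lemma MG_eq: "(of_nat (MG n m D) :: 'a::field_char_0) = fact (2 * m) * fps_nth (Delta_fps D ^ n) (2 * m)"
  using card_completions[of "{1..n}" "{1..m}" "\<lambda>_. 0" D, where 'a = 'a]
  by (simp add: MG_def nmD_multigraph_def nm_multigraph_iff Delta_derivs_fps_def
      multigraphs_on_def conj_commute conj_left_commute cong: conj_cong)

section \<open>Passage to generating functions\<close>

text \<open>The summand \<open>j\<close> starts at degree \<open>j\<close>, so each coefficient of
  the partial sums is eventually constant. This gives convergence in the topology of formal power
  series and makes the infinite sum over \<open>j\<close> a finite one.\<close>

lemma sums_fps_X_power:
  fixes A :: "nat \<Rightarrow> 'a::comm_ring_1 fps"
  shows "(\<lambda>j. fps_X ^ j * A j) sums Abs_fps (\<lambda>N. \<Sum>j\<le>N. fps_nth (A j) (N - j))"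
proof -
  let ?S = "Abs_fps (\<lambda>N. \<Sum>j\<le>N. fps_nth (A j) (N - j))"
  have *: "fps_nth (\<Sum>j<k. fps_X ^ j * A j) N = fps_nth ?S N" if "N < k" for k N
  proof -
    have "fps_nth (\<Sum>j<k. fps_X ^ j * A j) N = (\<Sum>j<k. if j \<le> N then fps_nth (A j) (N - j) else 0)"
      by (auto simp: fps_sum_nth fps_X_power_mult_nth intro!: sum.cong)
    also have "\<dots> = (\<Sum>j\<le>N. fps_nth (A j) (N - j))"
      using that by (intro sum.mono_neutral_cong_right) auto
    finally show ?thesis by simp
  qed
  show ?thesis
    unfolding sums_def tendsto_fps_iff
  proof
    fix N show "\<forall>\<^sub>F k in sequentially. fps_nth (\<Sum>j<k. fps_X ^ j * A j) N = fps_nth ?S N"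
      using * by (intro eventually_sequentiallyI[of "Suc N"]) simp
  qed
qed

text \<open>The exponential is constant in the outermost variable \<open>w\<close>, so the only
  convolution that has to be expanded is the one in \<open>z\<close>; the product in
  \<open>x\<close> stays inside \<open>fps_nth\<close>.\<close>

lemma fps_nth_family_fps_exp:
  "fps_nth (fps_nth (fps_nth (family_fps Fam \<delta> * exp_z_fps A) l) n) i =
    (\<Sum>k\<le>n. 1 / (2 ^ l * fact l * fact k * fact (n - k)) * fps_nth (family_poly Fam k l \<delta> * A ^ (n - k)) i)"
proof -
  have *: "fps_nth (P * (fps_const b * Q)) i = b * fps_nth (P * Q) i" for b :: real and P Q
    by (subst mult.left_commute) simp
  show ?thesis
    by (simp add: family_fps_def exp_z_fps_def fps_mult_right_const_nth
        fps_mult_nth[of _ _ n] fps_sum_nth atLeast0AtMost mult.assoc *)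
qed

text \<open>In the coefficient of \<open>w ^ M\<close>, the index \<open>j\<close> is the number of
  edges outside the subgraph and \<open>l = M - j\<close> the number inside. The factorials and
  powers of 2 then combine to the binomial coefficients of
  \<open>card_distinguished\<close>.\<close>

lemma card_distinguished_gf:
  "real (card (distinguished Fam n M D)) =
    fact n * 2 ^ M * fact M *
    fps_nth (fps_nth
      (\<Sum>j. fps_const (fps_const (fact (2 * j)))
            * coeff_x (2 * j) (family_fps Fam (Delta_derivs_fps D) * exp_z_fps (Delta_fps D))
            * (fps_const (fps_const (1 / (2 ^ j * fact j))) * fps_X ^ j)) M) n"
proof -
  define P where "P k l = family_poly Fam k l (Delta_derivs_fps D) * (Delta_fps D :: real fps) ^ (n - k)" for k l
  define A where "A j = fps_const (fps_const (fact (2 * j) / (2 ^ j * fact j)))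
    * coeff_x (2 * j) (family_fps Fam (Delta_derivs_fps D) * exp_z_fps (Delta_fps D))" for j
  have A: "fps_const (fps_const (fact (2 * j)))
      * coeff_x (2 * j) (family_fps Fam (Delta_derivs_fps D) * exp_z_fps (Delta_fps D))
      * (fps_const (fps_const (1 / (2 ^ j * fact j))) * fps_X ^ j) = fps_X ^ j * A j" for j
  proof -
    have "fps_const (fps_const (fact (2 * j) / (2 ^ j * fact j))) =
        fps_const (fps_const (fact (2 * j))) * fps_const (fps_const (1 / (2 ^ j * fact j :: real)))"
      by simp
    then show ?thesis
      unfolding A_def by (simp only: mult_ac)
  qed
  have nth: "fps_nth (fps_nth (A j) l) n = fact (2 * j) / (2 ^ j * fact j) *
      (\<Sum>k\<le>n. 1 / (2 ^ l * fact l * fact k * fact (n - k)) * fps_nth (P k l) (2 * j))" for j l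
    by (simp add: A_def coeff_x_def fps_nth_family_fps_exp P_def)
  have "fact n * 2 ^ M * fact M * fps_nth (fps_nth (\<Sum>j. fps_X ^ j * A j) M) n =
      fact n * 2 ^ M * fact M * (\<Sum>j\<le>M. fps_nth (fps_nth (A j) (M - j)) n)"
    by (simp add: sums_unique[OF sums_fps_X_power, symmetric] fps_sum_nth)
  also have "\<dots> = (\<Sum>j\<le>M. \<Sum>k\<le>n. fact n * 2 ^ M * fact M * (fact (2 * j) / (2 ^ j * fact j) *
      (1 / (2 ^ (M - j) * fact (M - j) * fact k * fact (n - k)) * fps_nth (P k (M - j)) (2 * j))))"
    by (simp only: nth sum_distrib_left)
  also have "\<dots> = (\<Sum>j\<le>M. \<Sum>k\<le>n. real (n choose k) * real (M choose (M - j)) * fact (2 * j) *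
      fps_nth (P k (M - j)) (2 * j))"
  proof (intro sum.cong refl)
    fix j k assume "j \<in> {..M}" "k \<in> {..n}"
    then have jk: "j \<le> M" "k \<le> n" by auto
    have "(2::real) ^ M = 2 ^ j * 2 ^ (M - j)"
      using jk by (simp flip: power_add)
    then show "fact n * 2 ^ M * fact M * (fact (2 * j) / (2 ^ j * fact j) *
      (1 / (2 ^ (M - j) * fact (M - j) * fact k * fact (n - k)) * fps_nth (P k (M - j)) (2 * j))) =
      real (n choose k) * real (M choose (M - j)) * fact (2 * j) * fps_nth (P k (M - j)) (2 * j)"
      using jk by (simp add: binomial_fact field_simps)
  qed
  also have "\<dots> = (\<Sum>l\<le>M. \<Sum>k\<le>n. real (n choose k) * real (M choose l) * fact (2 * (M - l)) *
      fps_nth (P k l) (2 * (M - l)))"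
    by (rule sum.reindex_bij_witness[where i = "\<lambda>l. M - l" and j = "\<lambda>l. M - l"]) auto
  also have "\<dots> = real (card (distinguished Fam n M D))"
    by (subst sum.swap) (simp add: card_distinguished[where 'a = real] P_def)
  finally show ?thesis
    by (simp only: A)
qed

section \<open>Saddle point analysis\<close>

subsection \<open>Entire power series\<close>

text \<open>All coefficients lie between 0 and \<open>1 / fact d\<close>, whatever \<open>D\<close>
  and \<open>s\<close> are, so the exponential series dominates.\<close>

lemma summable_Delta_derivs:
  fixes x :: "'a::{banach, real_normed_field}"
  shows "summable (\<lambda>d. norm (fps_nth (Delta_derivs_fps D s) d * x ^ d))"
proof (rule summable_comparison_test')
  show "summable (\<lambda>d. inverse (fact d) * norm x ^ d)"
    by (rule summable_exp)
  show "norm (norm (fps_nth (Delta_derivs_fps D s) d * x ^ d)) \<le> inverse (fact d) * norm x ^ d" for d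
    by (simp add: Delta_derivs_fps_eq norm_mult norm_divide norm_power divide_simps)
qed

lemma fps_conv_radius_Delta_derivs [simp]:
  "fps_conv_radius (Delta_derivs_fps D s :: 'a::{banach, real_normed_field} fps) = \<infinity>"
  unfolding fps_conv_radius_def
  by (rule conv_radius_inftyI'') (rule summable_norm_cancel[OF summable_Delta_derivs])

lemma fps_conv_radius_Delta [simp]:
  "fps_conv_radius (Delta_fps D :: 'a::{banach, real_normed_field} fps) = \<infinity>"
  using fps_conv_radius_Delta_derivs[of D 0] by (simp add: Delta_derivs_fps_def)

lemma eval_Delta_fps: "eval_fps (Delta_fps D) x = Delta D x"
  by (simp add: Delta_derivs_def Delta_derivs_fps_def)

lemma Delta_derivs_sums:
  fixes x :: "'a::{banach, real_normed_field}"
  shows "(\<lambda>d. fps_nth (Delta_derivs_fps D s) d * x ^ d) sums Delta_derivs D x s"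
  unfolding Delta_derivs_def eval_fps_def
  by (intro summable_sums summable_norm_cancel[OF summable_Delta_derivs])

lemma fps_conv_radius_mult_infinity:
  assumes "fps_conv_radius f = \<infinity>" "fps_conv_radius g = \<infinity>"
  shows "fps_conv_radius (f * g) = \<infinity>"
  using fps_conv_radius_mult[of f g] assms by simp

lemma fps_conv_radius_power_infinity:
  fixes f :: "'a::{banach, real_normed_field} fps"
  assumes "fps_conv_radius f = \<infinity>"
  shows "fps_conv_radius (f ^ n) = \<infinity>"
  using fps_conv_radius_power[of f n] assms by simp

lemma eval_fps_sum_infinity:
  fixes f :: "'i \<Rightarrow> 'a::{banach, real_normed_field} fps"
  assumes "\<And>i. i \<in> I \<Longrightarrow> fps_conv_radius (f i) = \<infinity>"
  shows "fps_conv_radius (\<Sum>i\<in>I. f i) = \<infinity> \<and> eval_fps (\<Sum>i\<in>I. f i) x = (\<Sum>i\<in>I. eval_fps (f i) x)"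
  using assms
proof (induction I rule: infinite_finite_induct)
  case (insert i I)
  then show ?case
    using fps_conv_radius_add[of "f i" "\<Sum>i\<in>I. f i"] by (simp add: eval_fps_add)
qed auto

lemma eval_fps_prod_infinity:
  fixes f :: "'i \<Rightarrow> 'a::{banach, real_normed_field} fps"
  assumes "\<And>i. i \<in> I \<Longrightarrow> fps_conv_radius (f i) = \<infinity>"
  shows "fps_conv_radius (\<Prod>i\<in>I. f i) = \<infinity> \<and> eval_fps (\<Prod>i\<in>I. f i) x = (\<Prod>i\<in>I. eval_fps (f i) x)"
  using assms
proof (induction I rule: infinite_finite_induct)
  case (insert i I)
  then show ?case
    by (simp add: eval_fps_mult fps_conv_radius_mult_infinity)
qed auto

lemma eval_family_poly:
  fixes x :: "'a::{banach, real_normed_field}"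
  shows "fps_conv_radius (family_poly Fam k l (Delta_derivs_fps D :: nat \<Rightarrow> 'a fps)) = \<infinity> \<and>
    eval_fps (family_poly Fam k l (Delta_derivs_fps D)) x = family_poly Fam k l (Delta_derivs D x)"
proof -
  have "fps_conv_radius (\<Prod>v\<in>{1..k}. Delta_derivs_fps D (mg_degree G v) :: 'a fps) = \<infinity> \<and>
      eval_fps (\<Prod>v\<in>{1..k}. Delta_derivs_fps D (mg_degree G v)) x = (\<Prod>v\<in>{1..k}. Delta_derivs D x (mg_degree G v))"
    for G :: "(nat, nat) pre_digraph"
    using eval_fps_prod_infinity[of "{1..k}" "\<lambda>v. Delta_derivs_fps D (mg_degree G v) :: 'a fps" x]
    by (simp add: Delta_derivs_def)
  then show ?thesis
    using eval_fps_sum_infinity[of "family_on Fam {1..k} {1..l}"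
        "\<lambda>G. \<Prod>v\<in>{1..k}. Delta_derivs_fps D (mg_degree G v) :: 'a fps" x]
    by (simp add: family_poly_eq)
qed

lemma norm_family_poly_le:
  fixes \<delta> :: "nat \<Rightarrow> 'a::real_normed_field"
  assumes "\<And>s. norm (\<delta> s) \<le> \<delta>' s"
  shows "norm (family_poly Fam k l \<delta>) \<le> family_poly Fam k l \<delta>'"
  unfolding family_poly_eq
  by (intro order_trans[OF norm_sum] sum_mono order_trans[OF norm_prod_le] prod_mono)
     (use assms in auto)

lemma family_poly_nonneg:
  fixes \<delta> :: "nat \<Rightarrow> real"
  assumes "\<And>s. \<delta> s \<ge> 0"
  shows "family_poly Fam k l \<delta> \<ge> 0"
  unfolding family_poly_eq by (intro sum_nonneg prod_nonneg) (use assms in auto)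

lemma family_poly_of_real:
  "family_poly Fam k l (\<lambda>s. complex_of_real (\<delta> s)) = of_real (family_poly Fam k l \<delta>)"
  by (simp add: family_poly_eq)

lemma Delta_derivs_of_real:
  "Delta_derivs D (complex_of_real x) s = of_real (Delta_derivs D x s)"
proof -
  have "(\<lambda>d. complex_of_real (fps_nth (Delta_derivs_fps D s) d * x ^ d)) sums of_real (Delta_derivs D x s)"
    by (subst sums_of_real_iff) (rule Delta_derivs_sums)
  moreover have "complex_of_real (fps_nth (Delta_derivs_fps D s) d) = fps_nth (Delta_derivs_fps D s) d" for d
    by (simp add: Delta_derivs_fps_eq)
  ultimately show ?thesis
    using Delta_derivs_sums[of D s "complex_of_real x"] by (simp add: sums_iff)
qed

lemma Delta_derivs_nonneg: "x \<ge> 0 \<Longrightarrow> Delta_derivs D x s \<ge> (0::real)"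
  using suminf_nonneg[OF sums_summable[OF Delta_derivs_sums[of D s x]]] sums_unique[OF Delta_derivs_sums[of D s x]]
  by (simp add: Delta_derivs_fps_eq)

lemma norm_Delta_derivs_le:
  fixes z :: complex
  shows "norm (Delta_derivs D z s) \<le> Delta_derivs D (norm z) s"
proof -
  have *: "norm (fps_nth (Delta_derivs_fps D s) d * z ^ d) = fps_nth (Delta_derivs_fps D s) d * norm z ^ d" for d
    by (simp add: Delta_derivs_fps_eq norm_mult norm_power norm_divide)
  have "norm (\<Sum>d. fps_nth (Delta_derivs_fps D s) d * z ^ d) \<le> (\<Sum>d. norm (fps_nth (Delta_derivs_fps D s) d * z ^ d))"
    by (rule summable_norm) (rule summable_Delta_derivs)
  then show ?thesis
    unfolding * using sums_unique[OF Delta_derivs_sums[of D s z]] sums_unique[OF Delta_derivs_sums[of D s "norm z"]]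
    by simp
qed

lemma Delta_ge_term:
  fixes t :: real
  assumes "d \<in> D" "t \<ge> 0"
  shows "t ^ d / fact d \<le> Delta D t"
proof -
  have "(\<Sum>i\<in>{d}. fps_nth (Delta_derivs_fps D 0) i * t ^ i) \<le> (\<Sum>i. fps_nth (Delta_derivs_fps D 0) i * t ^ i)"
    by (rule sum_le_suminf[OF sums_summable[OF Delta_derivs_sums]])
      (use assms in \<open>auto simp: Delta_derivs_fps_eq\<close>)
  then show ?thesis
    using sums_unique[OF Delta_derivs_sums[of D 0 t]] assms by (simp add: Delta_derivs_fps_eq)
qed

lemma Delta_pos:
  fixes t :: real
  assumes "D \<noteq> {}" "t > 0"
  shows "Delta D t > 0"
proof -
  obtain d where "d \<in> D" using assms by auto
  then show ?thesis
    using Delta_ge_term[of d D t] assms by (smt (verit) divide_pos_pos fact_gt_zero zero_less_power)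
qed

lemma Delta_le_exp:
  fixes t :: real
  assumes "t \<ge> 0"
  shows "Delta D t \<le> exp t"
proof -
  have "(\<lambda>d. inverse (fact d) * t ^ d) sums exp t"
    using exp_converges[of t] by (simp add: divide_inverse mult.commute)
  then show ?thesis
    by (rule sums_le[OF _ Delta_derivs_sums, rotated])
      (use assms in \<open>auto simp: Delta_derivs_fps_eq divide_simps\<close>)
qed

lemma continuous_on_Delta_derivs [continuous_intros]:
  fixes f :: "'b::topological_space \<Rightarrow> 'a::{banach, real_normed_field}"
  assumes "continuous_on S f"
  shows "continuous_on S (\<lambda>x. Delta_derivs D (f x) s)"
  unfolding Delta_derivs_def
  by (rule continuous_on_compose2[OF continuous_on_eval_fps[of "Delta_derivs_fps D s"] assms]) auto

subsection \<open>Coefficient extraction on a circle\<close>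

lemma integral_cis_mult_int:
  "(\<integral>\<theta>. indicator {-pi..pi} \<theta> *\<^sub>R cis (of_int k * \<theta>) \<partial>lborel) = (if k = 0 then 2 * pi else 0)"
proof (cases "k = 0")
  case True
  then show ?thesis by (simp add: scaleR_conv_of_real)
next
  case False
  have "(\<integral>\<theta>. indicator {-pi..pi} \<theta> *\<^sub>R cis (of_int k * \<theta>) \<partial>lborel) =
      cis (of_int k * pi) / (\<i> * of_int k) - cis (of_int k * - pi) / (\<i> * of_int k)"
  proof (rule integral_FTC_atLeastAtMost)
    show "((\<lambda>\<theta>. cis (of_int k * \<theta>) / (\<i> * of_int k)) has_vector_derivative cis (of_int k * x))
        (at x within {-pi..pi})" for x :: real
    proof -
      have "((\<lambda>\<theta>. exp (\<i> * of_int k * \<theta>) / (\<i> * of_int k)) has_field_derivative exp (\<i> * of_int k * x))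
          (at (complex_of_real x))"
        using False by (auto intro!: derivative_eq_intros)
      then have "((\<lambda>\<theta>. exp (\<i> * of_int k * of_real \<theta>) / (\<i> * of_int k)) has_vector_derivative exp (\<i> * of_int k * x))
          (at x within {-pi..pi})"
        by (rule has_vector_derivative_real_field)
      then show ?thesis
        by (simp add: cis_conv_exp mult_ac)
    qed
  qed (auto intro!: continuous_intros)
  also have "cis (of_int k * pi) = cis (of_int k * - pi)"
    using sin_int_times_real[of k pi] by (simp add: complex_eq_iff sin_times_pi_eq_0)
  finally show ?thesis using False by simp
qed

text \<open>Cauchy's coefficient formula by termwise integration and orthogonality of the
  characters. It is stated as a Lebesgue integral over the angle because this angle is rescaled
  later and dominated convergence is applied.\<close>

lemma fps_nth_circle_integral:
  fixes f :: "complex fps" and t :: real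
  assumes "fps_conv_radius f = \<infinity>" "t \<ge> 0"
  shows "(\<integral>\<theta>. indicator {-pi..pi} \<theta> *\<^sub>R (eval_fps f (of_real t * cis \<theta>) * cis (- (real N * \<theta>))) \<partial>lborel)
     = 2 * pi * fps_nth f N * of_real t ^ N"
proof -
  define g where "g j \<theta> = indicator {-pi..pi} \<theta> *\<^sub>R (fps_nth f j * of_real t ^ j * cis (of_int (int j - int N) * \<theta>))"
    for j and \<theta> :: real
  have int: "integrable lborel (g j)" for j
    unfolding g_def by (rule borel_integrable_atLeastAtMost'[unfolded set_integrable_def]) (auto intro!: continuous_intros)
  have norm_g: "norm (g j \<theta>) = indicator {-pi..pi} \<theta> * norm (fps_nth f j * of_real t ^ j)" for j \<theta>
    by (simp add: g_def norm_mult indicator_def)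
  have sm: "summable (\<lambda>j. norm (fps_nth f j * of_real t ^ j))"
    using abs_summable_in_conv_radius[of "of_real t" "fps_nth f"] assms by (simp add: fps_conv_radius_def)
  have "(\<integral>\<theta>. (\<Sum>j. g j \<theta>) \<partial>lborel) = (\<Sum>j. \<integral>\<theta>. g j \<theta> \<partial>lborel)"
  proof (rule integral_suminf[OF int])
    show "AE \<theta> in lborel. summable (\<lambda>j. norm (g j \<theta>))"
      unfolding norm_g using sm by (intro AE_I2 summable_mult)
    show "summable (\<lambda>j. \<integral>\<theta>. norm (g j \<theta>) \<partial>lborel)"
      unfolding norm_g using summable_mult[OF sm, of "2 * pi"] by simp
  qed
  also have "(\<lambda>\<theta>. \<Sum>j. g j \<theta>) = (\<lambda>\<theta>. indicator {-pi..pi} \<theta> *\<^sub>R (eval_fps f (of_real t * cis \<theta>) * cis (- (real N * \<theta>))))"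
  proof
    fix \<theta> :: real
    have s: "summable (\<lambda>j. fps_nth f j * (of_real t * cis \<theta>) ^ j)"
      using assms(1) by (intro summable_in_conv_radius) (simp add: fps_conv_radius_def)
    have "g j \<theta> = (fps_nth f j * (of_real t * cis \<theta>) ^ j) * (indicator {-pi..pi} \<theta> *\<^sub>R cis (- (real N * \<theta>)))" for j
    proof -
      have "cis (of_int (int j - int N) * \<theta>) = cis \<theta> ^ j * cis (- (real N * \<theta>))"
        by (simp only: Complex.DeMoivre cis_mult) (simp add: algebra_simps)
      then show ?thesis
        by (simp add: g_def power_mult_distrib scaleR_conv_of_real mult_ac)
    qed
    then have "(\<Sum>j. g j \<theta>) = (\<Sum>j. fps_nth f j * (of_real t * cis \<theta>) ^ j) *
        (indicator {-pi..pi} \<theta> *\<^sub>R cis (- (real N * \<theta>)))"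
      by (simp only: suminf_mult2[OF s, symmetric])
    then show "(\<Sum>j. g j \<theta>) = indicator {-pi..pi} \<theta> *\<^sub>R (eval_fps f (of_real t * cis \<theta>) * cis (- (real N * \<theta>)))"
      by (simp add: eval_fps_def)
  qed
  also have "(\<lambda>j. \<integral>\<theta>. g j \<theta> \<partial>lborel) = (\<lambda>j. if j = N then 2 * pi * fps_nth f N * of_real t ^ N else 0)"
  proof
    fix j
    have "(\<integral>\<theta>. g j \<theta> \<partial>lborel) = (\<integral>\<theta>. (fps_nth f j * of_real t ^ j) *
        (indicator {-pi..pi} \<theta> *\<^sub>R cis (of_int (int j - int N) * \<theta>)) \<partial>lborel)"
      by (intro Bochner_Integration.integral_cong) (auto simp: g_def)
    also have "\<dots> = (fps_nth f j * of_real t ^ j) * (if int j - int N = 0 then 2 * pi else 0)"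
      by (subst integral_mult_right_zero, subst integral_cis_mult_int) simp
    finally show "(\<integral>\<theta>. g j \<theta> \<partial>lborel) = (if j = N then 2 * pi * fps_nth f N * of_real t ^ N else 0)"
      by auto
  qed
  also have "(\<Sum>j. if j = N then 2 * pi * fps_nth f N * of_real t ^ N else 0) = 2 * pi * fps_nth f N * of_real t ^ N"
    by (rule sums_unique[OF sums_If_finite_set[of "{N}", simplified], symmetric])
  finally show ?thesis .
qed

subsection \<open>The saddle point\<close>

lemma t_Delta_deriv_sums:
  fixes t :: real
  shows "(\<lambda>i. real i * fps_nth (Delta_derivs_fps D 0) i * t ^ i) sums (t * Delta_derivs D t 1)"
proof -
  have "(\<lambda>i. t * (fps_nth (Delta_derivs_fps D 1) i * t ^ i)) sums (t * Delta_derivs D t 1)"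
    by (intro sums_mult Delta_derivs_sums)
  moreover have "t * (fps_nth (Delta_derivs_fps D 1) i * t ^ i) =
      real (Suc i) * fps_nth (Delta_derivs_fps D 0) (Suc i) * t ^ Suc i" for i
    by (simp add: Delta_derivs_fps_eq)
  ultimately have "(\<lambda>i. real (Suc i) * fps_nth (Delta_derivs_fps D 0) (Suc i) * t ^ Suc i) sums (t * Delta_derivs D t 1)"
    by (simp only:)
  from sums_Suc[where f = "\<lambda>i. real i * fps_nth (Delta_derivs_fps D 0) i * t ^ i", OF this] show ?thesis
    by (simp only: of_nat_0 mult_zero_left add_0_right)
qed

lemma centred_Delta_sums:
  fixes t \<mu> :: real
  shows "(\<lambda>i. (real i - \<mu>) * fps_nth (Delta_derivs_fps D 0) i * t ^ i) sums (t * Delta_derivs D t 1 - \<mu> * Delta D t)"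
  using sums_diff[OF t_Delta_deriv_sums[of D t] sums_mult[OF Delta_derivs_sums[of D 0 t], of \<mu>]]
  by (simp add: algebra_simps)

text \<open>After division by \<open>t powr \<mu>\<close> the series has the terms
  \<open>(i - \<mu>) * a i * t powr (i - \<mu>)\<close>, each nondecreasing in \<open>t\<close> and
  strictly increasing for \<open>i = d\<close>. This makes the zero unique without differentiating
  the quotient that defines \<open>\<chi>\<close>.\<close>

lemma centred_Delta_increasing:
  fixes s t \<mu> :: real
  assumes "0 < s" "s < t" "d \<in> D" "real d \<noteq> \<mu>" "s * Delta_derivs D s 1 - \<mu> * Delta D s \<ge> 0"
  shows "t * Delta_derivs D t 1 - \<mu> * Delta D t > 0"
proof -
  define \<rho> where "\<rho> = t / s"
  have \<rho>: "\<rho> > 1" and t: "t = \<rho> * s" using assms by (auto simp: \<rho>_def)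
  let ?a = "fps_nth (Delta_derivs_fps D 0) :: nat \<Rightarrow> real"
  \<comment> \<open>Comparison of the series at \<open>t\<close> with the one at \<open>s\<close>,
    multiplied by \<open>(t / s) powr \<mu>\<close> to account for the division by
    \<open>t powr \<mu>\<close>.\<close>
  define f where "f i = (real i - \<mu>) * ?a i * t ^ i - \<rho> powr \<mu> * ((real i - \<mu>) * ?a i * s ^ i)" for i
  have f: "f sums ((t * Delta_derivs D t 1 - \<mu> * Delta D t) - \<rho> powr \<mu> * (s * Delta_derivs D s 1 - \<mu> * Delta D s))"
    unfolding f_def by (intro sums_diff sums_mult centred_Delta_sums)
  have f_eq: "f i = ?a i * s ^ i * ((real i - \<mu>) * (\<rho> powr real i - \<rho> powr \<mu>))" for i
    using \<rho> by (simp add: f_def t power_mult_distrib powr_realpow algebra_simps)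
  have "(real i - \<mu>) * (\<rho> powr real i - \<rho> powr \<mu>) > 0" if "real i \<noteq> \<mu>" for i
  proof (cases "real i < \<mu>")
    case True
    then show ?thesis using powr_less_mono[OF True \<rho>] by (simp add: mult_neg_neg)
  next
    case False
    then show ?thesis using powr_less_mono[of \<mu> "real i" \<rho>] that \<rho> by simp
  qed note pos = this
  have nonneg: "f i \<ge> 0" for i
    unfolding f_eq using assms pos[of i]
    by (cases "real i = \<mu>") (auto simp: Delta_derivs_fps_eq intro!: divide_nonneg_pos mult_nonneg_nonneg less_imp_le[OF pos])
  have "0 < f d"
    unfolding f_eq using assms pos[of d] by (simp add: Delta_derivs_fps_eq)
  then have "0 < suminf f"
    using suminf_pos2[OF sums_summable[OF f] nonneg] by simp
  moreover have "\<rho> powr \<mu> * (s * Delta_derivs D s 1 - \<mu> * Delta D s) \<ge> 0"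
    using assms by simp
  ultimately show ?thesis
    using sums_unique[OF f] by simp
qed

lemma Inf_nat_mem: "d \<in> D \<Longrightarrow> Inf D \<in> (D :: nat set)"
  by (auto simp: Inf_nat_def intro: LeastI)

text \<open>For small \<open>t\<close> the lowest term, with \<open>d = Inf D\<close>, dominates: it
  equals \<open>- c * t ^ d\<close>, and for \<open>t \<le> 1\<close> all other terms together are
  at most \<open>t ^ (d + 1) * S\<close>. The choice of \<open>t\<close> ensures
  \<open>t * S < c\<close>.\<close>

lemma centred_Delta_neg:
  fixes \<mu> :: real
  assumes "D \<noteq> {}" "real (Inf D) < \<mu>"
  obtains t where "t > 0" "t * Delta_derivs D t 1 - \<mu> * Delta D t < 0"
proof -
  let ?a = "fps_nth (Delta_derivs_fps D 0) :: nat \<Rightarrow> real"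
  define d where "d = Inf D"
  have d: "d \<in> D" "\<And>i. i \<in> D \<Longrightarrow> d \<le> i"
    using assms Inf_nat_mem by (auto simp: d_def intro: cInf_lower)
  define c where "c = (\<mu> - real d) / fact d"
  have c: "c > 0" using assms by (simp add: c_def d_def)
  define S where "S = Delta_derivs D (1::real) 1"
  have S: "(\<lambda>i. real i * ?a i) sums S" "S \<ge> 0"
    using t_Delta_deriv_sums[of D 1] Delta_derivs_nonneg[of 1 D 1] by (simp_all add: S_def)
  define t where "t = min 1 (c / (2 * (S + 1)))"
  have t: "0 < t" "t \<le> 1" "t * S < c"
  proof -
    show "0 < t" "t \<le> 1" using c S by (auto simp: t_def)
    have "t * S \<le> (c / (2 * (S + 1))) * S"
      using S by (intro mult_right_mono) (auto simp: t_def)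
    also have "\<dots> < c"
    proof -
      have "S / (2 * (S + 1)) < 1" using S(2) by (simp add: field_simps)
      from mult_strict_left_mono[OF this c] show ?thesis by simp
    qed
    finally show "t * S < c" .
  qed
  have "t * Delta_derivs D t 1 - \<mu> * Delta D t \<le> - c * t ^ d + t ^ (d + 1) * S"
  proof (rule sums_le[OF _ centred_Delta_sums])
    show "(\<lambda>i. (if i = d then - c * t ^ d else 0) + t ^ (d + 1) * (real i * ?a i)) sums (- c * t ^ d + t ^ (d + 1) * S)"
      by (intro sums_add sums_mult S sums_single)
    show "(real i - \<mu>) * ?a i * t ^ i \<le> (if i = d then - c * t ^ d else 0) + t ^ (d + 1) * (real i * ?a i)" for i
    proof (cases "i = d")
      case True
      then show ?thesis using t d by (simp add: Delta_derivs_fps_eq c_def field_simps)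
    next
      case False
      show ?thesis
      proof (cases "i \<in> D")
        case True
        then have "t ^ i \<le> t ^ (d + 1)"
          using False d(2)[OF True] t by (intro power_decreasing) auto
        moreover have "(real i - \<mu>) * ?a i * t ^ i \<le> real i * ?a i * t ^ i"
          using assms t True by (intro mult_right_mono) (auto simp: Delta_derivs_fps_eq)
        moreover have "real i * ?a i \<ge> 0"
          by (simp add: Delta_derivs_fps_eq)
        ultimately have "(real i - \<mu>) * ?a i * t ^ i \<le> real i * ?a i * t ^ (d + 1)"
          by (meson mult_left_mono order_trans)
        then show ?thesis using False by (simp add: mult_ac)
      qed (use False in \<open>simp add: Delta_derivs_fps_eq\<close>)
    qed
  qed
  also have "\<dots> = t ^ d * (t * S - c)"
    by (simp add: algebra_simps)
  also have "\<dots> < 0"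
    using t by (intro mult_pos_neg) auto
  finally show ?thesis using that t by blast
qed

text \<open>For large \<open>t\<close> the term at \<open>d\<close> dominates. Negative terms have
  \<open>i < \<mu> < d\<close>, hence \<open>i \<le> d - 1\<close>, and are at least
  \<open>- \<mu> * t ^ (d - 1) * a i\<close>; their sum is controlled by
  \<open>S = \<Delta>(1)\<close>.\<close>

lemma centred_Delta_pos:
  fixes \<mu> :: real
  assumes "d \<in> D" "\<mu> < real d" "\<mu> > 0"
  obtains t where "t > 0" "t * Delta_derivs D t 1 - \<mu> * Delta D t > 0"
proof -
  let ?a = "fps_nth (Delta_derivs_fps D 0) :: nat \<Rightarrow> real"
  define c where "c = (real d - \<mu>) / fact d"
  have c: "c > 0" using assms by (simp add: c_def)
  define S where "S = Delta D (1::real)"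
  have S: "?a sums S" "S \<ge> 0"
    using Delta_derivs_sums[of D 0 "1::real"] Delta_derivs_nonneg[of 1 D 0] by (simp_all add: S_def)
  define t where "t = 1 + \<mu> * S / c"
  have t: "1 \<le> t" "\<mu> * S < c * t"
    using c S assms by (auto simp: t_def field_simps)
  have d: "d > 0" using assms by (cases d) auto
  have "0 < t ^ (d - 1) * (c * t - \<mu> * S)"
    using t by (intro mult_pos_pos) auto
  also have "\<dots> = c * t ^ d - \<mu> * t ^ (d - 1) * S"
    using d by (cases d) (auto simp: algebra_simps)
  also have "\<dots> \<le> t * Delta_derivs D t 1 - \<mu> * Delta D t"
  proof (rule sums_le[OF _ _ centred_Delta_sums])
    show "(\<lambda>i. (if i = d then c * t ^ d else 0) - \<mu> * t ^ (d - 1) * ?a i) sums (c * t ^ d - \<mu> * t ^ (d - 1) * S)"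
      by (intro sums_diff sums_mult S sums_single)
    show "(if i = d then c * t ^ d else 0) - \<mu> * t ^ (d - 1) * ?a i \<le> (real i - \<mu>) * ?a i * t ^ i" for i
    proof (cases "i \<in> D")
      case True
      have a: "?a i \<ge> 0" by (simp add: Delta_derivs_fps_eq)
      have nn: "\<mu> * t ^ (d - 1) * ?a i \<ge> 0" using a t assms by simp
      show ?thesis
      proof (cases "real i < \<mu>")
        case True
        then have "i \<le> d - 1" "i \<noteq> d" using assms by linarith+
        then have "t ^ i \<le> t ^ (d - 1)" using t by (intro power_increasing) auto
        then have "\<mu> * ?a i * t ^ i \<le> \<mu> * ?a i * t ^ (d - 1)"
          using a assms by (intro mult_left_mono) auto
        moreover have "real i * ?a i * t ^ i \<ge> 0" using a t by simp
        ultimately show ?thesis using \<open>i \<noteq> d\<close> by (simp add: algebra_simps)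
      next
        case False
        then have *: "(real i - \<mu>) * ?a i * t ^ i \<ge> 0" using a t by simp
        show ?thesis
        proof (cases "i = d")
          case True
          then have "(real i - \<mu>) * ?a i * t ^ i = c * t ^ d"
            using \<open>i \<in> D\<close> by (simp add: Delta_derivs_fps_eq c_def)
          then show ?thesis using nn True by (simp only: refl if_True)
        next
          case False
          then have "(if i = d then c * t ^ d else 0) - \<mu> * t ^ (d - 1) * ?a i \<le> 0"
            using nn by simp
          then show ?thesis using * by (rule order_trans)
        qed
      qed
    qed (use assms in \<open>auto simp: Delta_derivs_fps_eq\<close>)
  qed
  finally show ?thesis using that[of t] t by simp
qed

text \<open>Membership in the open interval between the minimum and the maximum of \<open>D\<close>,
  in a form that covers infinite \<open>D\<close> as well.\<close>

definition degree_range :: "nat set \<Rightarrow> real \<Rightarrow> bool" where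
  "degree_range D \<mu> \<longleftrightarrow> real (Inf D) < \<mu> \<and> (\<exists>d\<in>D. \<mu> < real d)"

text \<open>Existence comes from the intermediate value theorem between a point where the centred
  series is negative and one where it is positive; uniqueness from
  \<open>centred_Delta_increasing\<close>. The argument is \<open>\<mu> / 2\<close> because
  \<open>chi\<close> expects the edge density, half the mean degree.\<close>

lemma chi:
  assumes "degree_range D \<mu>"
  shows chi_pos: "chi D (\<mu> / 2) > 0"
    and chi_eq: "chi D (\<mu> / 2) * Delta_derivs D (chi D (\<mu> / 2)) 1 = \<mu> * Delta D (chi D (\<mu> / 2))"
proof -
  obtain d where d: "d \<in> D" "\<mu> < real d" and m: "real (Inf D) < \<mu>"
    using assms by (auto simp: degree_range_def)
  then have D: "D \<noteq> {}" and \<mu>: "\<mu> > 0" by (auto intro: le_less_trans[OF of_nat_0_le_iff])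
  define h where "h t = t * Delta_derivs D t 1 - \<mu> * Delta D t" for t :: real
  have incr: "h t > 0" if "0 < s" "s < t" "h s \<ge> 0" for s t
    using centred_Delta_increasing[of s t "Inf D" D \<mu>] that Inf_nat_mem[OF d(1)] m by (auto simp: h_def)
  obtain t1 where t1: "t1 > 0" "h t1 < 0"
    using centred_Delta_neg[OF D m] by (auto simp: h_def)
  obtain t2 where t2: "t2 > 0" "h t2 > 0"
    using centred_Delta_pos[OF d \<mu>] by (auto simp: h_def)
  have "t1 \<le> t2"
    using incr[of t2 t1] t1 t2 by fastforce
  moreover have "continuous_on {t1..t2} h"
    unfolding h_def by (intro continuous_intros)
  ultimately obtain t where t: "t1 \<le> t" "t \<le> t2" "h t = 0"
    using IVT'[of h t1 0 t2] t1 t2 by auto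
  have iff: "t > 0 \<and> t * Delta_derivs D t 1 / Delta D t = 2 * (\<mu> / 2) \<longleftrightarrow> t > 0 \<and> h t = 0" for t
    using Delta_pos[OF D, of t] by (auto simp: h_def field_simps)
  have "\<exists>!t. t > 0 \<and> h t = 0"
  proof (rule ex1I[of _ t])
    show "t > 0 \<and> h t = 0" using t t1 by simp
    show "s = t" if "s > 0 \<and> h s = 0" for s
      using that incr[of s t] incr[of t s] t t1 by (cases s t rule: linorder_cases) auto
  qed
  then have "chi D (\<mu> / 2) > 0 \<and> h (chi D (\<mu> / 2)) = 0"
    unfolding chi_def iff by (rule theI')
  then show "chi D (\<mu> / 2) > 0"
    and "chi D (\<mu> / 2) * Delta_derivs D (chi D (\<mu> / 2)) 1 = \<mu> * Delta D (chi D (\<mu> / 2))"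
    by (simp_all add: h_def)
qed

text \<open>Monotonicity confines the saddle points to a fixed compact interval as soon as the mean
  degrees lie between two admissible values.\<close>

lemma chi_mono:
  assumes "degree_range D \<mu>" "degree_range D \<nu>" "\<mu> < \<nu>"
  shows "chi D (\<mu> / 2) \<le> chi D (\<nu> / 2)"
proof (rule ccontr)
  let ?s = "chi D (\<nu> / 2)" and ?t = "chi D (\<mu> / 2)"
  assume "\<not> ?t \<le> ?s"
  then have st: "?s < ?t" by simp
  obtain d where d: "d \<in> D" using assms(1) by (auto simp: degree_range_def)
  have "Delta D ?s > 0"
    using Delta_pos[of D ?s] d chi_pos[OF assms(2)] by auto
  then have "?s * Delta_derivs D ?s 1 - \<mu> * Delta D ?s \<ge> 0"
    using chi_eq[OF assms(2)] assms(3) by simp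
  then have "?t * Delta_derivs D ?t 1 - \<mu> * Delta D ?t > 0"
    using centred_Delta_increasing[OF chi_pos[OF assms(2)] st Inf_nat_mem[OF d], of \<mu>] assms(1)
    by (auto simp: degree_range_def)
  then show False
    using chi_eq[OF assms(1)] by simp
qed

lemma degree_range_open:
  assumes "degree_range D \<mu>"
  obtains l u where "l < \<mu>" "\<mu> < u" "degree_range D l" "degree_range D u"
proof -
  obtain d where d: "d \<in> D" "\<mu> < real d" "real (Inf D) < \<mu>"
    using assms by (auto simp: degree_range_def)
  let ?l = "(real (Inf D) + \<mu>) / 2" and ?u = "(\<mu> + real d) / 2"
  have *: "real (Inf D) < ?l" "?l < real d" "real (Inf D) < ?u" "?u < real d" "?l < \<mu>" "\<mu> < ?u"
    using d by auto
  then have "degree_range D ?l" "degree_range D ?u"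
    unfolding degree_range_def using d(1) by blast+
  with * show ?thesis
    using that by blast
qed

subsection \<open>Bounds on circles\<close>

lemma norm_cis_add_cis: "norm (cis a + cis b) = 2 * \<bar>cos ((a - b) / 2)\<bar>"
proof -
  have "cis a + cis b = cis ((a + b) / 2) * (cis ((a - b) / 2) + cis (- ((a - b) / 2)))"
    unfolding distrib_left cis_mult by (simp add: field_simps)
  also have "cis ((a - b) / 2) + cis (- ((a - b) / 2)) = of_real (2 * cos ((a - b) / 2))"
    by (simp add: complex_eq_iff)
  finally show ?thesis
    by (simp only: norm_mult norm_cis norm_of_real mult_1_left abs_mult abs_numeral)
qed

lemma Delta_remove2:
  fixes x :: "'a::{banach, real_normed_field}"
  assumes "d \<in> D" "e \<in> D" "d \<noteq> e"
  shows "Delta D x = x ^ d / fact d + x ^ e / fact e + Delta (D - {d, e}) x"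
proof -
  have "(\<lambda>i. (if i = d then x ^ i / fact i else 0) + (if i = e then x ^ i / fact i else 0) +
      fps_nth (Delta_derivs_fps (D - {d, e}) 0) i * x ^ i) sums (x ^ d / fact d + x ^ e / fact e + Delta (D - {d, e}) x)"
    by (intro sums_add sums_single Delta_derivs_sums)
  also have "(\<lambda>i. (if i = d then x ^ i / fact i else 0) + (if i = e then x ^ i / fact i else 0) +
      fps_nth (Delta_derivs_fps (D - {d, e}) 0) i * x ^ i) = (\<lambda>i. fps_nth (Delta_derivs_fps D 0) i * x ^ i)"
    using assms by (auto simp: Delta_derivs_fps_eq fun_eq_iff)
  finally show ?thesis
    using Delta_derivs_sums sums_unique2 by blast
qed

text \<open>Weight \<open>\<eta>\<close> is taken from each of the terms at \<open>d\<close> and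
  \<open>e\<close>. These two portions have phases differing by \<open>(d - e) * \<theta>\<close>,
  so together they lose \<open>2 * \<eta> * (1 - \<bar>cos\<bar>)\<close>; the triangle inequality
  handles everything else.\<close>

lemma norm_Delta_circle_le:
  fixes t \<theta> :: real
  assumes "d \<in> D" "e \<in> D" "d \<noteq> e" "t \<ge> 0" "\<eta> \<ge> 0" "\<eta> \<le> t ^ d / fact d" "\<eta> \<le> t ^ e / fact e"
  shows "norm (Delta D (of_real t * cis \<theta>)) \<le> Delta D t - 2 * \<eta> * (1 - \<bar>cos ((real d - real e) * \<theta> / 2)\<bar>)"
proof -
  let ?p = "t ^ d / fact d" and ?q = "t ^ e / fact e"
  have "Delta D (of_real t * cis \<theta>) = of_real (?p - \<eta>) * cis (real d * \<theta>) + of_real (?q - \<eta>) * cis (real e * \<theta>)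
      + of_real \<eta> * (cis (real d * \<theta>) + cis (real e * \<theta>)) + Delta (D - {d, e}) (of_real t * cis \<theta>)"
    unfolding Delta_remove2[OF assms(1-3)] power_mult_distrib Complex.DeMoivre by (simp add: algebra_simps)
  also have "norm \<dots> \<le> (?p - \<eta>) + (?q - \<eta>) + \<eta> * (2 * \<bar>cos ((real d * \<theta> - real e * \<theta>) / 2)\<bar>) + Delta (D - {d, e}) t"
  proof (intro norm_triangle_mono)
    show "norm (Delta (D - {d, e}) (of_real t * cis \<theta>)) \<le> Delta (D - {d, e}) t"
      using norm_Delta_derivs_le[of "D - {d, e}" "of_real t * cis \<theta>" 0] assms(4) by (simp add: norm_mult)
    show "norm (of_real \<eta> * (cis (real d * \<theta>) + cis (real e * \<theta>))) \<le> \<eta> * (2 * \<bar>cos ((real d * \<theta> - real e * \<theta>) / 2)\<bar>)"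
      using assms(5) by (simp add: norm_mult norm_cis_add_cis)
    show "norm (complex_of_real (?p - \<eta>) * cis (real d * \<theta>)) \<le> ?p - \<eta>"
      using assms(6) unfolding norm_mult norm_cis norm_of_real by simp
    show "norm (complex_of_real (?q - \<eta>) * cis (real e * \<theta>)) \<le> ?q - \<eta>"
      using assms(7) unfolding norm_mult norm_cis norm_of_real by simp
  qed
  also have "\<dots> = Delta D t - 2 * \<eta> * (1 - \<bar>cos ((real d - real e) * \<theta> / 2)\<bar>)"
    unfolding Delta_remove2[OF assms(1-3)] by (simp add: algebra_simps)
  finally show ?thesis .
qed

text \<open>On this range \<open>\<bar>sin x\<bar> \<ge> \<bar>x\<bar> / 2\<close>, and the square
  of the sine factors as \<open>(1 - \<bar>cos x\<bar>) * (1 + \<bar>cos x\<bar>)\<close> with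
  second factor at most 2.\<close>

lemma one_minus_abs_cos_ge:
  fixes x :: real
  assumes "\<bar>x\<bar> \<le> 1"
  shows "1 - \<bar>cos x\<bar> \<ge> x\<^sup>2 / 8"
proof -
  have "norm (iexp x - (\<Sum>k\<le>1. (\<i> * x) ^ k / fact k)) \<le> \<bar>x\<bar> ^ 2 / 2"
    using iexp_approx1[of x 1] by (simp add: numeral_2_eq_2)
  moreover have "\<bar>Im (iexp x - (\<Sum>k\<le>1. (\<i> * x) ^ k / fact k))\<bar> \<le> norm (iexp x - (\<Sum>k\<le>1. (\<i> * x) ^ k / fact k))"
    by (rule abs_Im_le_cmod)
  moreover have "Im (iexp x - (\<Sum>k\<le>1. (\<i> * x) ^ k / fact k)) = sin x - x"
    by (simp add: Im_exp)
  ultimately have "\<bar>sin x - x\<bar> \<le> \<bar>x\<bar> * \<bar>x\<bar> / 2"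
    by (simp add: power2_eq_square)
  moreover have "\<bar>x\<bar> * \<bar>x\<bar> \<le> \<bar>x\<bar>"
    using assms mult_left_mono[of "\<bar>x\<bar>" 1 "\<bar>x\<bar>"] by simp
  ultimately have "\<bar>sin x - x\<bar> \<le> \<bar>x\<bar> / 2"
    by linarith
  then have "\<bar>x / 2\<bar> \<le> \<bar>sin x\<bar>"
    by linarith
  then have "x\<^sup>2 / 4 \<le> (sin x)\<^sup>2"
    using power2_le_iff_abs_le abs_le_square_iff[of "x / 2" "sin x"] by (simp add: power_divide)
  also have "\<dots> = 1 - \<bar>cos x\<bar>\<^sup>2"
    by (simp add: sin_squared_eq)
  also have "\<dots> = (1 - \<bar>cos x\<bar>) * (1 + \<bar>cos x\<bar>)"
    by (simp add: power2_eq_square algebra_simps)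
  also have "\<dots> \<le> (1 - \<bar>cos x\<bar>) * 2"
    by (intro mult_left_mono) auto
  finally show ?thesis by simp
qed

text \<open>
  The integers \<open>k\<close> with \<open>k * \<theta> / 2 \<in> \<pi> \<int>\<close> form a subgroup; if it contained all differences
  \<open>d - Inf D\<close>, it would contain their greatest common divisor 1.
\<close>

lemma aperiodic:
  fixes \<theta> :: real
  assumes "Gcd ((\<lambda>d. d - Inf D) ` D) = (1::nat)" "\<theta> \<noteq> 0" "\<bar>\<theta>\<bar> \<le> pi"
  obtains d where "d \<in> D" "d \<noteq> Inf D" "\<bar>cos ((real d - real (Inf D)) * \<theta> / 2)\<bar> < 1"
proof -
  define S where "S = {k::nat. sin (real k * \<theta> / 2) = 0}"
  have sin1: "sin (\<theta> / 2) \<noteq> 0"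
    using assms(2,3) sin_gt_zero[of "\<theta> / 2"] sin_gt_zero[of "- \<theta> / 2"] pi_gt_zero by (cases "\<theta> > 0") auto
  have "\<exists>d\<in>D. d - Inf D \<notin> S"
  proof (rule ccontr)
    assume "\<not> ?thesis"
    then have DS: "d - Inf D \<in> S" if "d \<in> D" for d using that by blast
    have "\<exists>d\<in>D. d - Inf D \<noteq> 0"
    proof (rule ccontr)
      assume "\<not> (\<exists>d\<in>D. d - Inf D \<noteq> 0)"
      then have "(\<lambda>d. d - Inf D) ` D \<subseteq> {0}" by auto
      then have "Gcd ((\<lambda>d. d - Inf D) ` D) = 0" by (simp only: Gcd_0_iff)
      then show False using assms(1) by simp
    qed
    then have "\<exists>k. k \<in> S \<and> k > 0" using DS by blast
    \<comment> \<open>Division with remainder shows that the least positive element of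
      \<open>S\<close> divides every element. It therefore divides the greatest common divisor and
      equals 1, contradicting \<open>sin (\<theta> / 2) \<noteq> 0\<close>.\<close>
    moreover define g where "g = (LEAST k. k \<in> S \<and> k > 0)"
    ultimately have g: "g \<in> S" "g > 0"
      using LeastI_ex[of "\<lambda>k. k \<in> S \<and> k > 0"] by simp_all
    have least: "g \<le> k" if "k \<in> S" "k > 0" for k
      unfolding g_def using that by (intro Least_le) simp
    have mult: "sin (real (q * g) * \<theta> / 2) = 0" for q
    proof (induction q)
      case (Suc q)
      have "real (Suc q * g) * \<theta> / 2 = real g * \<theta> / 2 + real (q * g) * \<theta> / 2"
        by (simp add: algebra_simps add_divide_distrib)
      then show ?case using Suc g(1) by (simp only: sin_add S_def mem_Collect_eq)
    qed simp
    have "g dvd k" if "k \<in> S" for k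
    proof -
      have "real k = real (k mod g) + real (k div g * g)"
        by (subst of_nat_add[symmetric]) simp
      from arg_cong[OF this, of "\<lambda>x. x * \<theta> / 2"]
      have eq: "real k * \<theta> / 2 = real (k mod g) * \<theta> / 2 + real (k div g * g) * \<theta> / 2"
        by (simp only: distrib_right add_divide_distrib)
      have "\<bar>cos (real (k div g * g) * \<theta> / 2)\<bar> = 1"
        using mult[of "k div g"] sin_zero_abs_cos_one by blast
      then have "sin (real (k mod g) * \<theta> / 2) = 0"
        using that mult[of "k div g"] unfolding S_def mem_Collect_eq eq sin_add by auto
      then have "k mod g = 0"
        using least[of "k mod g"] mod_less_divisor[OF g(2), of k] by (cases "k mod g = 0") (auto simp: S_def)
      then show ?thesis by auto
    qed
    then have "g dvd Gcd ((\<lambda>d. d - Inf D) ` D)"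
      using DS by (intro Gcd_greatest) auto
    then have "g = 1" using assms(1) by simp
    then show False using g(1) sin1 by (simp add: S_def)
  qed
  then obtain d where d: "d \<in> D" "d - Inf D \<notin> S" by blast
  then have neq: "d \<noteq> Inf D" by (auto simp: S_def)
  have "real (d - Inf D) = real d - real (Inf D)"
    using cInf_lower[OF d(1)] by (simp add: of_nat_diff)
  then have "sin ((real d - real (Inf D)) * \<theta> / 2) \<noteq> 0"
    using d(2) by (simp add: S_def)
  then have "0 < (sin ((real d - real (Inf D)) * \<theta> / 2))\<^sup>2"
    by simp
  then have "(cos ((real d - real (Inf D)) * \<theta> / 2))\<^sup>2 < 1"
    unfolding sin_squared_eq by linarith
  then have "\<bar>cos ((real d - real (Inf D)) * \<theta> / 2)\<bar> < 1"
    unfolding abs_square_less_1 .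
  then show ?thesis using that d(1) neq by blast
qed

lemma Delta_circle_less:
  fixes t \<theta> :: real
  assumes "Gcd ((\<lambda>d. d - Inf D) ` D) = 1" "\<theta> \<noteq> 0" "\<bar>\<theta>\<bar> \<le> pi" "t > 0"
  shows "norm (Delta D (of_real t * cis \<theta>)) < Delta D t"
proof -
  obtain d where d: "d \<in> D" "d \<noteq> Inf D" "\<bar>cos ((real d - real (Inf D)) * \<theta> / 2)\<bar> < 1"
    using aperiodic[OF assms(1-3)] .
  define \<eta> where "\<eta> = min (t ^ d / fact d) (t ^ Inf D / fact (Inf D))"
  have \<eta>: "\<eta> > 0" using assms(4) by (simp add: \<eta>_def)
  have "norm (Delta D (of_real t * cis \<theta>)) \<le> Delta D t - 2 * \<eta> * (1 - \<bar>cos ((real d - real (Inf D)) * \<theta> / 2)\<bar>)"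
    by (rule norm_Delta_circle_le[OF d(1) Inf_nat_mem[OF d(1)] d(2)]) (use \<eta> assms(4) in \<open>auto simp: \<eta>_def\<close>)
  also have "\<dots> < Delta D t"
    using \<eta> d(3) by simp
  finally show ?thesis .
qed

text \<open>Near \<open>\<theta> = 0\<close> two terms of the series give an explicit quadratic
  loss. On the rest of the circle strict inequality and compactness, in \<open>t\<close> and
  \<open>\<theta>\<close> jointly, give a quotient bounded away from 1. Both losses take the form
  \<open>1 - c * \<theta>^2\<close>, which is at most \<open>exp (- c * \<theta>^2)\<close>.\<close>

lemma Delta_circle_bound:
  assumes D: "\<exists>d\<in>D. \<exists>e\<in>D. d \<noteq> e" and gcd: "Gcd ((\<lambda>d. d - Inf D) ` D) = 1" and ab: "0 < a" "a \<le> b"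
  obtains c where "c > 0" "\<And>t \<theta>. a \<le> t \<Longrightarrow> t \<le> b \<Longrightarrow> \<bar>\<theta>\<bar> \<le> pi \<Longrightarrow>
    norm (Delta D (of_real t * cis \<theta>)) \<le> Delta D t * exp (- c * \<theta>\<^sup>2)"
proof -
  obtain d e where de: "d \<in> D" "e \<in> D" "d \<noteq> e" using D by blast
  define k where "k = \<bar>real d - real e\<bar>"
  have k: "k > 0" using de by (simp add: k_def)
  define \<eta> where "\<eta> = min (a ^ d / fact d) (a ^ e / fact e)"
  have \<eta>: "\<eta> > 0" using ab by (simp add: \<eta>_def)
  \<comment> \<open>This makes \<open>\<bar>(d - e) * \<theta> / 2\<bar> \<le> 1\<close>, the range
    of \<open>one_minus_abs_cos_ge\<close>.\<close>
  define \<delta> where "\<delta> = min pi (2 / k)"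
  have \<delta>: "\<delta> > 0" and \<delta>_pi: "\<delta> \<le> pi" using k by (simp_all add: \<delta>_def)
  \<comment> \<open>The loss is \<open>2 * \<eta> * k^2 * \<theta>^2 / 32\<close>; dividing by
    \<open>exp b\<close>, an upper bound for \<open>\<Delta>(t)\<close>, makes it relative to
    \<open>\<Delta>(t)\<close>.\<close>
  define c1 where "c1 = \<eta> * k\<^sup>2 / (16 * exp b)"
  have c1: "c1 > 0" using \<eta> k by (simp add: c1_def)
  have pos: "Delta D t > 0" if "a \<le> t" for t :: real
    using Delta_pos[of D t] de that ab by auto
  have near: "norm (Delta D (of_real t * cis \<theta>)) \<le> Delta D t * (1 - c1 * \<theta>\<^sup>2)"
    if t: "a \<le> t" "t \<le> b" and "\<bar>\<theta>\<bar> \<le> \<delta>" for t \<theta>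
  proof -
    have "k * \<bar>\<theta>\<bar> \<le> 2"
      using that(3) k by (simp add: \<delta>_def field_simps)
    then have "\<bar>(real d - real e) * \<theta> / 2\<bar> \<le> 1"
      by (simp add: abs_mult k_def)
    from one_minus_abs_cos_ge[OF this]
    have cos: "1 - \<bar>cos ((real d - real e) * \<theta> / 2)\<bar> \<ge> k\<^sup>2 * \<theta>\<^sup>2 / 32"
      by (simp add: k_def power_mult_distrib power_divide)
    have "a ^ d \<le> t ^ d" "a ^ e \<le> t ^ e" using t ab by (auto intro: power_mono)
    then have "a ^ d / fact d \<le> t ^ d / fact d" "a ^ e / fact e \<le> t ^ e / fact e"
      by (auto intro: divide_right_mono)
    then have "\<eta> \<le> t ^ d / fact d" "\<eta> \<le> t ^ e / fact e"
      unfolding \<eta>_def by linarith+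
    then have "norm (Delta D (of_real t * cis \<theta>)) \<le> Delta D t - 2 * \<eta> * (1 - \<bar>cos ((real d - real e) * \<theta> / 2)\<bar>)"
      using de t ab \<eta> by (intro norm_Delta_circle_le) auto
    also have "\<dots> \<le> Delta D t - 2 * \<eta> * (k\<^sup>2 * \<theta>\<^sup>2 / 32)"
      using mult_left_mono[OF cos, of "2 * \<eta>"] \<eta> by simp
    also have "2 * \<eta> * (k\<^sup>2 * \<theta>\<^sup>2 / 32) = exp b * (c1 * \<theta>\<^sup>2)"
      by (simp add: c1_def)
    also have "Delta D t - exp b * (c1 * \<theta>\<^sup>2) \<le> Delta D t - Delta D t * (c1 * \<theta>\<^sup>2)"
    proof -
      have "Delta D t \<le> exp b"
        by (rule order_trans[OF Delta_le_exp]) (use t ab in auto)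
      then show ?thesis
        using c1 by (intro diff_left_mono mult_right_mono) auto
    qed
    finally show ?thesis by (simp add: algebra_simps)
  qed
  define K where "K = {a..b} \<times> ({-pi..-\<delta>} \<union> {\<delta>..pi})"
  define h where "h p = norm (Delta D (of_real (fst p) * cis (snd p))) / Delta D (fst p)" for p :: "real \<times> real"
  have "compact K" unfolding K_def by (intro compact_Times compact_Un) auto
  moreover have "K \<noteq> {}" using ab by (auto simp: K_def \<delta>_def)
  moreover have "continuous_on K h"
  proof -
    have "\<forall>p\<in>K. Delta D (fst p) \<noteq> 0"
    proof
      fix p assume "p \<in> K"
      then have "a \<le> fst p" by (auto simp: K_def)
      from pos[OF this] show "Delta D (fst p) \<noteq> 0" by simp
    qed
    then show ?thesis
      unfolding h_def by (intro continuous_on_divide continuous_intros)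
  qed
  ultimately obtain p where p: "p \<in> K" "\<And>q. q \<in> K \<Longrightarrow> h q \<le> h p"
    by (metis continuous_attains_sup)
  have "h p < 1"
  proof -
    have *: "a \<le> fst p" "snd p \<noteq> 0" "\<bar>snd p\<bar> \<le> pi"
      using p(1) \<delta> \<delta>_pi by (auto simp: K_def abs_le_iff)
    then have "norm (Delta D (of_real (fst p) * cis (snd p))) < Delta D (fst p)"
      using ab by (intro Delta_circle_less[OF gcd]) auto
    then show ?thesis
      using pos[OF *(1)] by (simp add: h_def)
  qed
  \<comment> \<open>Since \<open>\<theta>^2 \<le> pi^2\<close>, the maximum \<open>h p\<close> is at
    most \<open>1 - c2 * \<theta>^2\<close> on the whole circle.\<close>
  define c2 where "c2 = (1 - h p) / pi\<^sup>2"
  have c2: "c2 > 0" using \<open>h p < 1\<close> by (simp add: c2_def)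
  have far: "norm (Delta D (of_real t * cis \<theta>)) \<le> Delta D t * (1 - c2 * \<theta>\<^sup>2)"
    if t: "a \<le> t" "t \<le> b" and "\<bar>\<theta>\<bar> \<le> pi" "\<delta> \<le> \<bar>\<theta>\<bar>" for t \<theta>
  proof -
    have "(t, \<theta>) \<in> K" using that by (auto simp: K_def)
    then have "norm (Delta D (of_real t * cis \<theta>)) \<le> Delta D t * h p"
      using p(2)[of "(t, \<theta>)"] pos[OF t(1)] by (simp add: h_def divide_le_eq mult.commute)
    also have "h p \<le> 1 - c2 * \<theta>\<^sup>2"
    proof -
      have "\<theta>\<^sup>2 \<le> pi\<^sup>2" using that(3) by (simp add: abs_le_square_iff[symmetric])
      then have "c2 * \<theta>\<^sup>2 \<le> c2 * pi\<^sup>2" using c2 by simp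
      then show ?thesis by (simp add: c2_def)
    qed
    finally show ?thesis using pos[OF t(1)] by simp
  qed
  show ?thesis
  proof (rule that[of "min c1 c2"])
    show "min c1 c2 > 0" using c1 c2 by simp
    fix t \<theta> :: real assume t: "a \<le> t" "t \<le> b" "\<bar>\<theta>\<bar> \<le> pi"
    have "min c1 c2 * \<theta>\<^sup>2 \<le> c1 * \<theta>\<^sup>2" "min c1 c2 * \<theta>\<^sup>2 \<le> c2 * \<theta>\<^sup>2"
      by (auto intro: mult_right_mono)
    moreover have "1 + - min c1 c2 * \<theta>\<^sup>2 \<le> exp (- min c1 c2 * \<theta>\<^sup>2)" by (rule exp_ge_add_one_self)
    ultimately have "1 - c1 * \<theta>\<^sup>2 \<le> exp (- min c1 c2 * \<theta>\<^sup>2)" "1 - c2 * \<theta>\<^sup>2 \<le> exp (- min c1 c2 * \<theta>\<^sup>2)"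
      by auto
    then have "Delta D t * (1 - c1 * \<theta>\<^sup>2) \<le> Delta D t * exp (- min c1 c2 * \<theta>\<^sup>2)"
      "Delta D t * (1 - c2 * \<theta>\<^sup>2) \<le> Delta D t * exp (- min c1 c2 * \<theta>\<^sup>2)"
      using pos[OF t(1)] by (auto intro: mult_left_mono)
    then show "norm (Delta D (of_real t * cis \<theta>)) \<le> Delta D t * exp (- min c1 c2 * \<theta>\<^sup>2)"
      using near[of t \<theta>] far[of t \<theta>] t by (cases "\<bar>\<theta>\<bar> \<le> \<delta>") auto
  qed
qed

lemma norm_cis_taylor: "norm (cis x - (1 + \<i> * x - x\<^sup>2 / 2)) \<le> \<bar>x\<bar> ^ 3 / 6"
proof -
  have "(\<Sum>k\<le>2. (\<i> * complex_of_real x) ^ k / fact k) = 1 + \<i> * x - x\<^sup>2 / 2"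
    by (simp add: eval_nat_numeral complex_eq_iff)
  then show ?thesis
    using iexp_approx1[of x 2] by (simp add: cis_conv_exp numeral_3_eq_3 numeral_2_eq_2)
qed

lemma power2_le_exp: "u \<ge> 0 \<Longrightarrow> u\<^sup>2 \<le> 4 * exp (u::real)"
  using power_mono[of "u / 2" "exp (u / 2)" 2] exp_ge_add_one_self[of "u / 2"]
  by (simp add: power_divide exp_of_nat_mult[symmetric] field_simps)

lemma power3_le_exp: "u \<ge> 0 \<Longrightarrow> u ^ 3 \<le> 27 * exp (u::real)"
  using power_mono[of "u / 3" "exp (u / 3)" 3] exp_ge_add_one_self[of "u / 3"]
  by (simp add: power_divide exp_of_nat_mult[symmetric] field_simps)

text \<open>For the upper half,
  \<open>(1 - y + y^2 / 2) * (1 + y + y^2 / 2) = 1 + y^4 / 4 \<ge> 1\<close>, and the second factor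
  is at most \<open>exp y\<close>.\<close>

lemma exp_minus_taylor:
  fixes y :: real
  assumes "y \<ge> 0"
  shows "\<bar>exp (- y) - (1 - y)\<bar> \<le> y\<^sup>2 / 2"
proof -
  have "1 \<le> (1 - y + y\<^sup>2 / 2) * (1 + y + y\<^sup>2 / 2)"
  proof -
    have "(1 - y + y\<^sup>2 / 2) * (1 + y + y\<^sup>2 / 2) = 1 + (y\<^sup>2)\<^sup>2 / 4"
      by (simp add: power2_eq_square field_simps)
    then show ?thesis by simp
  qed
  also have "\<dots> \<le> (1 - y + y\<^sup>2 / 2) * exp y"
  proof (rule mult_left_mono)
    show "1 + y + y\<^sup>2 / 2 \<le> exp y" using exp_lower_Taylor_quadratic[OF assms] .
    have "0 \<le> (1 - y)\<^sup>2" by simp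
    then show "0 \<le> 1 - y + y\<^sup>2 / 2" using assms by (simp add: power2_eq_square algebra_simps)
  qed
  finally have "exp (- y) \<le> 1 - y + y\<^sup>2 / 2"
    by (simp add: exp_minus field_simps)
  moreover have "1 - y \<le> exp (- y)"
    using exp_ge_add_one_self[of "- y"] by simp
  ultimately show ?thesis by simp
qed

text \<open>The numbers \<open>p i = a i * t ^ i / \<Delta>(t)\<close> form a probability
  distribution, whose mean is \<open>\<mu>\<close> by the saddle point equation. The normalised
  value of \<open>\<Delta>\<close> on the circle is the characteristic function of the centred
  distribution and \<open>v\<close> is its variance. Bounding the third absolute moment by an
  exponential moment makes the error uniform in \<open>t\<close>.\<close>

lemma Delta_circle_taylor:
  assumes "D \<noteq> {}" and ab: "0 < a" "a \<le> b"
  obtains C where "C \<ge> 0" "\<And>t \<mu>. a \<le> t \<Longrightarrow> t \<le> b \<Longrightarrow> t * Delta_derivs D t 1 = \<mu> * Delta D t \<Longrightarrow>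
    \<exists>v. 0 \<le> v \<and> v \<le> C \<and> (\<forall>\<theta>. norm (Delta D (of_real t * cis \<theta>) / of_real (Delta D t) * cis (- (\<mu> * \<theta>))
      - of_real (1 - v * \<theta>\<^sup>2 / 2)) \<le> C * \<bar>\<theta>\<bar> ^ 3)"
proof -
  obtain d where d: "d \<in> D" using assms by blast
  \<comment> \<open>An upper bound for the exponential moment
    \<open>\<Delta>(e * t) / \<Delta>(t)\<close>, uniform over \<open>t\<close> in
    \<open>[a, b]\<close>.\<close>
  define K where "K = exp (exp 1 * b) / (a ^ d / fact d)"
  have K: "K \<ge> 0" using ab by (simp add: K_def)
  show ?thesis
  proof (rule that[of "27 * exp K * K"])
    show "0 \<le> 27 * exp K * K" using K by simp
    fix t \<mu> assume t: "a \<le> t" "t \<le> b" and \<mu>: "t * Delta_derivs D t 1 = \<mu> * Delta D t"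
    have tpos: "t > 0" using t ab by simp
    let ?a = "fps_nth (Delta_derivs_fps D 0) :: nat \<Rightarrow> real"
    have \<Delta>: "Delta D t > 0" using Delta_pos[OF assms(1) tpos] .
    define p where "p i = ?a i * t ^ i / Delta D t" for i
    have p0: "p i \<ge> 0" for i using \<Delta> tpos by (simp add: p_def Delta_derivs_fps_eq)
    have p1: "p sums 1"
      using sums_divide[OF Delta_derivs_sums[of D 0 t], of "Delta D t"] \<Delta> by (simp add: p_def[abs_def])
    have pmean: "(\<lambda>i. (real i - \<mu>) * p i) sums 0"
      using sums_divide[OF centred_Delta_sums[of \<mu> D t], of "Delta D t"] \<mu> by (simp add: p_def mult_ac)
    define q where "q = Delta D (exp 1 * t) / Delta D t"
    have pexp: "(\<lambda>i. exp (real i) * p i) sums q"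
    proof -
      have "exp (real i) * p i = ?a i * (exp 1 * t) ^ i / Delta D t" for i
        by (simp add: p_def power_mult_distrib exp_of_nat_mult[symmetric])
      then show ?thesis
        using sums_divide[OF Delta_derivs_sums[of D 0 "exp 1 * t"], of "Delta D t"] by (simp add: q_def)
    qed
    have q: "q \<le> K"
      unfolding q_def K_def
    proof (rule frac_le)
      have "Delta D (exp 1 * t) \<le> exp (exp 1 * t)" using tpos by (intro Delta_le_exp) simp
      also have "\<dots> \<le> exp (exp 1 * b)" using t by simp
      finally show "Delta D (exp 1 * t) \<le> exp (exp 1 * b)" .
      have "a ^ d / fact d \<le> t ^ d / fact d" using t ab by (intro divide_right_mono power_mono) auto
      also have "\<dots> \<le> Delta D t" using d tpos by (intro Delta_ge_term) auto
      finally show "a ^ d / fact d \<le> Delta D t" .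
    qed (use ab in auto)
    have \<mu>0: "0 \<le> \<mu>"
    proof -
      have "0 \<le> \<mu> * Delta D t"
        unfolding \<mu>[symmetric] using tpos by (intro mult_nonneg_nonneg Delta_derivs_nonneg) auto
      then show ?thesis using \<Delta> by (simp add: zero_le_mult_iff)
    qed
    have \<mu>K: "\<mu> \<le> K"
    proof -
      have "(\<lambda>i. (real i - \<mu>) * p i + \<mu> * p i) sums (0 + \<mu> * 1)"
        by (intro sums_add pmean sums_mult p1)
      then have "(\<lambda>i. real i * p i) sums \<mu>" by (simp add: algebra_simps)
      moreover have "real i * p i \<le> exp (real i) * p i" for i
        using exp_ge_add_one_self[of "real i"] by (intro mult_right_mono p0) linarith
      ultimately have "\<mu> \<le> q" by (intro sums_le[OF _ _ pexp, of "\<lambda>i. real i * p i"])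
      then show ?thesis using q by simp
    qed
    define u where "u i = real i - \<mu>" for i
    \<comment> \<open>Because \<open>0 \<le> \<mu> \<le> K\<close>, the deviation
      \<open>\<bar>i - \<mu>\<bar>\<close> is at most \<open>K + i\<close>, so moments about the
      mean reduce to the exponential moment.\<close>
    have eu: "exp \<bar>u i\<bar> \<le> exp K * exp (real i)" for i
      unfolding exp_add[symmetric] using \<mu>0 \<mu>K by (simp add: u_def)
    have pu2: "p i * (u i)\<^sup>2 \<le> 4 * exp K * (exp (real i) * p i)" for i
    proof -
      have "(u i)\<^sup>2 \<le> 4 * (exp K * exp (real i))"
        using power2_le_exp[of "\<bar>u i\<bar>"] eu[of i] by simp
      from mult_left_mono[OF this p0[of i]] show ?thesis by (simp add: mult_ac)
    qed
    have pu3: "p i * \<bar>u i\<bar> ^ 3 \<le> 27 * exp K * (exp (real i) * p i)" for i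
    proof -
      have "\<bar>u i\<bar> ^ 3 \<le> 27 * (exp K * exp (real i))"
        using power3_le_exp[of "\<bar>u i\<bar>"] eu[of i] by simp
      from mult_left_mono[OF this p0[of i]] show ?thesis by (simp add: mult_ac)
    qed
    have bound: "(\<lambda>i. c * (exp (real i) * p i)) sums (c * q)" for c
      by (intro sums_mult pexp)
    have sm2: "summable (\<lambda>i. p i * (u i)\<^sup>2)"
      by (rule summable_comparison_test'[OF sums_summable[OF bound[of "4 * exp K"]], of 0])
        (use pu2 p0 in auto)
    define v where "v = (\<Sum>i. p i * (u i)\<^sup>2)"
    have v: "(\<lambda>i. p i * (u i)\<^sup>2) sums v" using sm2 by (simp add: v_def summable_sums)
    have "0 \<le> v" unfolding v_def using sm2 p0 by (intro suminf_nonneg) auto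
    moreover have "v \<le> 27 * exp K * K"
    proof -
      have "v \<le> 4 * exp K * q" using sums_le[OF pu2 v bound] .
      also have "\<dots> \<le> 4 * exp K * K" using q by simp
      also have "\<dots> \<le> 27 * exp K * K" using K by (intro mult_right_mono) auto
      finally show ?thesis .
    qed
    moreover have "norm (Delta D (of_real t * cis \<theta>) / of_real (Delta D t) * cis (- (\<mu> * \<theta>))
      - of_real (1 - v * \<theta>\<^sup>2 / 2)) \<le> 27 * exp K * K * \<bar>\<theta>\<bar> ^ 3" (is "norm ?L \<le> _") for \<theta>
    proof -
      define f where "f i = of_real (p i) * (cis (u i * \<theta>) - (1 + \<i> * of_real (u i * \<theta>) - of_real ((u i * \<theta>)\<^sup>2 / 2)))" for i
      have s1: "(\<lambda>i. of_real (p i) * cis (u i * \<theta>)) sums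
          (Delta D (of_real t * cis \<theta>) / of_real (Delta D t) * cis (- (\<mu> * \<theta>)))"
      proof -
        have "fps_nth (Delta_derivs_fps D 0) i * (of_real t * cis \<theta>) ^ i / of_real (Delta D t) * cis (- (\<mu> * \<theta>))
            = of_real (p i) * cis (u i * \<theta>)" for i
        proof -
          have "cis (u i * \<theta>) = cis \<theta> ^ i * cis (- (\<mu> * \<theta>))"
            by (simp only: Complex.DeMoivre cis_mult u_def) (simp add: algebra_simps)
          moreover have "complex_of_real (?a i) = fps_nth (Delta_derivs_fps D 0) i"
            by (simp add: Delta_derivs_fps_eq)
          ultimately show ?thesis by (simp add: p_def power_mult_distrib)
        qed
        then show ?thesis
          using sums_mult2[OF sums_divide[OF Delta_derivs_sums[of D 0 "of_real t * cis \<theta>"], of "of_real (Delta D t)"],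
            of "cis (- (\<mu> * \<theta>))"] by simp
      qed
      have s2: "(\<lambda>i. complex_of_real (p i - p i * (u i)\<^sup>2 * (\<theta>\<^sup>2 / 2))) sums of_real (1 - v * (\<theta>\<^sup>2 / 2))"
        by (subst sums_of_real_iff) (intro sums_diff p1 sums_mult2 v)
      \<comment> \<open>Centring at the mean removes the linear term of the expansion.\<close>
      have s3: "(\<lambda>i. \<i> * of_real \<theta> * of_real (u i * p i)) sums (\<i> * of_real \<theta> * of_real 0)"
        using pmean unfolding u_def by (intro sums_mult) (simp only: sums_of_real_iff)
      have f: "f sums ?L"
      proof -
        have "(\<lambda>i. of_real (p i) * cis (u i * \<theta>) - of_real (p i - p i * (u i)\<^sup>2 * (\<theta>\<^sup>2 / 2)) - \<i> * of_real \<theta> * of_real (u i * p i)) sums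
          (Delta D (of_real t * cis \<theta>) / of_real (Delta D t) * cis (- (\<mu> * \<theta>)) - of_real (1 - v * (\<theta>\<^sup>2 / 2)) - \<i> * of_real \<theta> * of_real 0)"
          by (intro sums_diff s1 s2 s3)
        then show ?thesis
          by (simp add: f_def[abs_def] algebra_simps power_mult_distrib)
      qed
      have nf: "norm (f i) \<le> (27 * exp K * \<bar>\<theta>\<bar> ^ 3) * (exp (real i) * p i)" for i
      proof -
        have "norm (f i) = p i * norm (cis (u i * \<theta>) - (1 + \<i> * of_real (u i * \<theta>) - of_real ((u i * \<theta>)\<^sup>2 / 2)))"
          using p0 by (simp add: f_def norm_mult)
        also have "\<dots> \<le> p i * (\<bar>u i * \<theta>\<bar> ^ 3 / 6)"
          using norm_cis_taylor[of "u i * \<theta>"] by (intro mult_left_mono p0) simp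
        also have "\<dots> \<le> (p i * \<bar>u i\<bar> ^ 3) * \<bar>\<theta>\<bar> ^ 3"
          using p0[of i] by (simp add: abs_mult power_mult_distrib)
        also have "\<dots> \<le> (27 * exp K * (exp (real i) * p i)) * \<bar>\<theta>\<bar> ^ 3"
          by (intro mult_right_mono pu3) simp
        finally show ?thesis by (simp add: mult_ac)
      qed
      have "norm ?L \<le> (27 * exp K * \<bar>\<theta>\<bar> ^ 3) * q"
        using norm_suminf_le[OF nf sums_summable[OF bound]] sums_unique[OF f] sums_unique[OF bound[of "27 * exp K * \<bar>\<theta>\<bar> ^ 3"]]
        by simp
      also have "\<dots> \<le> (27 * exp K * \<bar>\<theta>\<bar> ^ 3) * K"
        using q by (intro mult_left_mono) auto
      finally show ?thesis by (simp add: mult_ac)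
    qed
    ultimately show "\<exists>v. 0 \<le> v \<and> v \<le> 27 * exp K * K \<and> (\<forall>\<theta>. norm (Delta D (of_real t * cis \<theta>) / of_real (Delta D t) * cis (- (\<mu> * \<theta>))
      - of_real (1 - v * \<theta>\<^sup>2 / 2)) \<le> 27 * exp K * K * \<bar>\<theta>\<bar> ^ 3)"
      by blast
  qed
qed

subsection \<open>A lower bound of local limit type\<close>

lemma dominated_convergence_eventually:
  fixes s :: "nat \<Rightarrow> 'a \<Rightarrow> complex"
  assumes "f \<in> borel_measurable M" "integrable M w"
    "\<forall>\<^sub>F n in sequentially. s n \<in> borel_measurable M"
    "\<forall>\<^sub>F n in sequentially. \<forall>x. norm (s n x) \<le> w x"
    "\<And>x. (\<lambda>n. s n x) \<longlonglongrightarrow> f x"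
  shows "(\<lambda>n. integral\<^sup>L M (s n)) \<longlonglongrightarrow> integral\<^sup>L M f"
proof -
  obtain N where N: "\<And>n. n \<ge> N \<Longrightarrow> s n \<in> borel_measurable M \<and> (\<forall>x. norm (s n x) \<le> w x)"
    using eventually_conj[OF assms(3,4)] by (auto simp: eventually_sequentially)
  have "(\<lambda>n. integral\<^sup>L M (s (n + N))) \<longlonglongrightarrow> integral\<^sup>L M f"
  proof (rule integral_dominated_convergence[where w = w])
    show "AE x in M. (\<lambda>n. s (n + N) x) \<longlonglongrightarrow> f x"
      by (intro AE_I2 LIMSEQ_ignore_initial_segment assms(5))
  qed (use assms(1,2) N in auto)
  then show ?thesis by (rule LIMSEQ_offset)
qed

lemma integrable_gaussian: "c > 0 \<Longrightarrow> integrable lborel (\<lambda>s::real. K * exp (- c * s\<^sup>2))"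
proof -
  assume c: "c > 0"
  have "integrable lborel (\<lambda>s. normal_density 0 (sqrt (1 / (2 * c))) s)"
    using c by (intro integrable_normal_density) auto
  moreover have "normal_density 0 (sqrt (1 / (2 * c))) s = (1 / sqrt (pi / c)) * exp (- c * s\<^sup>2)" for s
    using c by (simp add: normal_density_def field_simps)
  ultimately have "integrable lborel (\<lambda>s. (1 / sqrt (pi / c)) * exp (- c * s\<^sup>2))"
    by (simp only:)
  then have *: "integrable lborel (\<lambda>s. (K * sqrt (pi / c)) * ((1 / sqrt (pi / c)) * exp (- c * s\<^sup>2)))"
    by (rule integrable_mult_right)
  have eq: "(K * sqrt (pi / c)) * ((1 / sqrt (pi / c)) * e) = K * e" for e
    using c by simp
  show ?thesis using * by (simp only: eq)
qed

text \<open>The variances \<open>v n\<close> may vary, so there is no fixed limit function. Instead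
  the difference from a Gaussian depending on \<open>n\<close> tends to 0, and the Gaussian integral
  is bounded below by its part over \<open>[-1, 1]\<close>.\<close>

lemma local_limit_lower_bound:
  fixes \<phi> :: "nat \<Rightarrow> real \<Rightarrow> complex" and c C :: real
  assumes "c > 0" "C \<ge> 0"
    and meas: "\<forall>\<^sub>F n in sequentially. \<phi> n \<in> borel_measurable borel"
    and bound: "\<forall>\<^sub>F n in sequentially. \<forall>\<theta>. \<bar>\<theta>\<bar> \<le> pi \<longrightarrow> norm (\<phi> n \<theta>) \<le> exp (- c * \<theta>\<^sup>2)"
    and taylor: "\<forall>\<^sub>F n in sequentially. 0 \<le> v n \<and> v n \<le> C \<and>
      (\<forall>\<theta>. norm (\<phi> n \<theta> - of_real (1 - v n * \<theta>\<^sup>2 / 2)) \<le> C * \<bar>\<theta>\<bar> ^ 3)"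
  obtains c0 where "c0 > 0" "\<forall>\<^sub>F n in sequentially. c0 \<le>
    norm (\<integral>s. indicator {- (pi * sqrt n)..pi * sqrt n} s *\<^sub>R \<phi> n (s / sqrt n) ^ n \<partial>lborel)"
proof -
  define I where "I n s = indicator {- (pi * sqrt n)..pi * sqrt n} s *\<^sub>R \<phi> n (s / sqrt n) ^ n" for n and s :: real
  \<comment> \<open>Small \<open>v n\<close> would make the Gaussian too flat to be dominated. It is
    capped by the bound that already holds for the integrand.\<close>
  define g where "g n s = min (exp (- v n * s\<^sup>2 / 2)) (exp (- c * s\<^sup>2))" for n and s :: real
  define G where "G n s = indicator {- (pi * sqrt n)..pi * sqrt n} s * g n s" for n and s :: real
  have I_le: "\<forall>\<^sub>F n in sequentially. \<forall>s. norm (I n s) \<le> exp (- c * s\<^sup>2)"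
    using bound eventually_gt_at_top[of 0]
  proof eventually_elim
    fix n :: nat assume b: "\<forall>\<theta>. \<bar>\<theta>\<bar> \<le> pi \<longrightarrow> norm (\<phi> n \<theta>) \<le> exp (- c * \<theta>\<^sup>2)" and n: "n > 0"
    show "\<forall>s. norm (I n s) \<le> exp (- c * s\<^sup>2)"
    proof
      fix s :: real
      show "norm (I n s) \<le> exp (- c * s\<^sup>2)"
      proof (cases "s \<in> {- (pi * sqrt n)..pi * sqrt n}")
        case True
        then have "\<bar>s / sqrt n\<bar> \<le> pi" using n by (auto simp: field_simps abs_le_iff)
        then have "norm (\<phi> n (s / sqrt n)) ^ n \<le> exp (- c * (s / sqrt n)\<^sup>2) ^ n"
          using b by (intro power_mono) auto
        also have "\<dots> = exp (- c * s\<^sup>2)"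
          using n by (simp add: exp_of_nat_mult[symmetric] power_divide)
        finally show ?thesis using True by (simp add: I_def norm_power)
      qed (simp add: I_def)
    qed
  qed
  have "(\<lambda>n. integral\<^sup>L lborel (\<lambda>s. I n s - of_real (G n s))) \<longlonglongrightarrow> integral\<^sup>L lborel (\<lambda>s::real. 0)"
  proof (rule dominated_convergence_eventually[where s = "\<lambda>n s. I n s - of_real (G n s)" and w = "\<lambda>s. 2 * exp (- c * s\<^sup>2)"])
    show "integrable lborel (\<lambda>s::real. 2 * exp (- c * s\<^sup>2))"
      using assms(1) by (rule integrable_gaussian)
    show "\<forall>\<^sub>F n in sequentially. (\<lambda>s. I n s - of_real (G n s)) \<in> borel_measurable lborel"
      using meas by eventually_elim (simp add: I_def G_def g_def)
    show "\<forall>\<^sub>F n in sequentially. \<forall>s. norm (I n s - of_real (G n s)) \<le> 2 * exp (- c * s\<^sup>2)"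
      using I_le
    proof (eventually_elim, intro allI)
      fix n and s :: real assume "\<forall>s. norm (I n s) \<le> exp (- c * s\<^sup>2)"
      moreover have "norm (complex_of_real (G n s)) \<le> exp (- c * s\<^sup>2)"
        by (auto simp: G_def g_def indicator_def)
      ultimately show "norm (I n s - of_real (G n s)) \<le> 2 * exp (- c * s\<^sup>2)"
        using norm_triangle_ineq4[of "I n s" "of_real (G n s)"] by (smt (verit))
    qed
    fix s :: real
    \<comment> \<open>The Taylor errors \<open>C * \<bar>\<theta>\<bar>^3\<close> and
      \<open>C^2 * \<theta>^4 / 8\<close> at \<open>\<theta> = s / sqrt n\<close>, multiplied by
      \<open>n\<close> for the \<open>n\<close>-th power; the factor 2 pays for the cap.\<close>
    let ?B = "\<lambda>n. 2 * (C * \<bar>s\<bar> ^ 3 * (real n / sqrt n ^ 3) + C\<^sup>2 * s ^ 4 / 8 * (1 / real n))"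
    show "(\<lambda>n. I n s - of_real (G n s)) \<longlonglongrightarrow> 0"
    proof (rule Lim_null_comparison)
      have l: "(\<lambda>n. real n / sqrt n ^ 3) \<longlonglongrightarrow> 0" "(\<lambda>n. 1 / real n) \<longlonglongrightarrow> 0"
        by real_asymp+
      have "?B \<longlonglongrightarrow> 2 * (C * \<bar>s\<bar> ^ 3 * 0 + C\<^sup>2 * s ^ 4 / 8 * 0)"
        by (intro tendsto_mult tendsto_add tendsto_const l)
      then show "?B \<longlonglongrightarrow> 0" by simp
      have "\<forall>\<^sub>F n in sequentially. \<bar>s\<bar> \<le> pi * sqrt (real n)"
        by real_asymp
      then show "\<forall>\<^sub>F n in sequentially. norm (I n s - of_real (G n s)) \<le> ?B n"
        using taylor I_le eventually_gt_at_top[of 0]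
      proof eventually_elim
        fix n :: nat
        assume s: "\<bar>s\<bar> \<le> pi * sqrt n" and n: "n > 0" and le: "\<forall>s. norm (I n s) \<le> exp (- c * s\<^sup>2)"
          and v: "0 \<le> v n \<and> v n \<le> C \<and> (\<forall>\<theta>. norm (\<phi> n \<theta> - of_real (1 - v n * \<theta>\<^sup>2 / 2)) \<le> C * \<bar>\<theta>\<bar> ^ 3)"
        define \<theta> where "\<theta> = s / sqrt n"
        define y where "y = v n * \<theta>\<^sup>2 / 2"
        have \<theta>: "\<bar>\<theta>\<bar> \<le> pi" using s n by (simp add: \<theta>_def abs_divide divide_le_eq)
        have y: "y \<ge> 0" using v by (simp add: y_def)
        have I: "I n s = \<phi> n \<theta> ^ n" and G: "G n s = g n s"
          using s by (auto simp: I_def G_def \<theta>_def indicator_def abs_le_iff)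
        have "norm (\<phi> n \<theta>) ^ n \<le> 1"
        proof (rule order_trans)
          show "norm (\<phi> n \<theta>) ^ n \<le> exp (- c * s\<^sup>2)"
            using le[rule_format, of s] unfolding I norm_power .
        qed (use assms(1) in simp)
        \<comment> \<open>Both bases must lie in the unit disc for the difference of
          \<open>n\<close>-th powers to be at most \<open>n\<close> times the difference of the
          bases.\<close>
        then have \<phi>1: "norm (\<phi> n \<theta>) \<le> 1"
          using n by (simp add: power_le_one_iff)
        have "norm (\<phi> n \<theta> ^ n - complex_of_real (exp (- y)) ^ n) \<le> n * norm (\<phi> n \<theta> - of_real (exp (- y)))"
          using \<phi>1 y by (intro norm_power_diff) auto
        also have "norm (\<phi> n \<theta> - of_real (exp (- y))) \<le> C * \<bar>\<theta>\<bar> ^ 3 + y\<^sup>2 / 2"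
        proof -
          have "norm (\<phi> n \<theta> - of_real (1 - y)) \<le> C * \<bar>\<theta>\<bar> ^ 3" using v by (simp add: y_def)
          moreover have "norm (complex_of_real (1 - y) - of_real (exp (- y))) \<le> y\<^sup>2 / 2"
            using exp_minus_taylor[OF y] unfolding of_real_diff[symmetric] norm_of_real by (simp add: abs_minus_commute)
          ultimately show ?thesis by (rule norm_diff_triangle_le)
        qed
        also have "y\<^sup>2 / 2 \<le> C\<^sup>2 * \<theta> ^ 4 / 8"
        proof -
          have "y \<le> C * \<theta>\<^sup>2 / 2" using v by (simp add: y_def mult_right_mono)
          then have "y\<^sup>2 \<le> (C * \<theta>\<^sup>2 / 2)\<^sup>2" using y by (intro power_mono)
          then show ?thesis by (simp add: power_divide power_mult_distrib flip: power_mult)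
        qed
        also have "real n * (C * \<bar>\<theta>\<bar> ^ 3 + C\<^sup>2 * \<theta> ^ 4 / 8) = ?B n / 2"
        proof -
          have "\<bar>\<theta>\<bar> ^ 3 = \<bar>s\<bar> ^ 3 / sqrt n ^ 3" using n by (simp add: \<theta>_def power_divide abs_divide)
          moreover have "\<theta> ^ 4 = s ^ 4 / (real n)\<^sup>2"
          proof -
            have "sqrt (real n) ^ (2 * 2) = (real n)\<^sup>2"
              by (subst power_mult) simp
            then show ?thesis by (simp add: \<theta>_def power_divide)
          qed
          ultimately show ?thesis using n by (simp add: field_simps power2_eq_square)
        qed
        finally have diff: "norm (I n s - complex_of_real (exp (- v n * s\<^sup>2 / 2))) \<le> ?B n / 2"
          using n unfolding I by (simp add: y_def \<theta>_def power_divide exp_of_nat_mult[symmetric] flip: of_real_power)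
        \<comment> \<open>The norm of \<open>I n s\<close> is below the cap, so cutting the Gaussian
          down to the cap moves it by at most its distance from \<open>I n s\<close>.\<close>
        have "norm (complex_of_real (exp (- v n * s\<^sup>2 / 2)) - of_real (G n s)) \<le>
            norm (I n s - complex_of_real (exp (- v n * s\<^sup>2 / 2)))"
        proof -
          have "norm (complex_of_real (exp (- v n * s\<^sup>2 / 2)) - of_real (G n s)) =
              exp (- v n * s\<^sup>2 / 2) - g n s"
            unfolding G of_real_diff[symmetric] norm_of_real by (simp add: g_def)
          also have "\<dots> \<le> max 0 (exp (- v n * s\<^sup>2 / 2) - norm (I n s))"
            using le[rule_format, of s] by (simp add: g_def)
          also have "\<dots> \<le> norm (I n s - complex_of_real (exp (- v n * s\<^sup>2 / 2)))"
            using norm_triangle_ineq2[of "complex_of_real (exp (- v n * s\<^sup>2 / 2))" "I n s"]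
            by (simp add: norm_minus_commute)
          finally show ?thesis .
        qed
        with diff show "norm (I n s - of_real (G n s)) \<le> ?B n"
          using norm_triangle_ineq[of "I n s - complex_of_real (exp (- v n * s\<^sup>2 / 2))"
            "complex_of_real (exp (- v n * s\<^sup>2 / 2)) - of_real (G n s)"] by simp
      qed
    qed
  qed auto
  then have lim: "(\<lambda>n. \<integral>s. (I n s - of_real (G n s)) \<partial>lborel) \<longlonglongrightarrow> 0" by simp
  \<comment> \<open>A lower bound for \<open>G n\<close> on \<open>[-1, 1]\<close>, where the two
    exponents are at most \<open>C / 2\<close> and \<open>c\<close>. Its integral is then at least
    \<open>2 * c0\<close>, and an error below \<open>c0\<close> leaves \<open>c0\<close>.\<close>
  define c0 where "c0 = exp (- max (C / 2) c)"
  have c0: "c0 > 0" by (simp add: c0_def)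
  show ?thesis
  proof (rule that[OF c0])
    have "\<forall>\<^sub>F n in sequentially. norm (\<integral>s. (I n s - of_real (G n s)) \<partial>lborel) < c0"
      using tendstoD[OF lim c0] by simp
    then show "\<forall>\<^sub>F n in sequentially. c0 \<le>
      norm (\<integral>s. indicator {- (pi * sqrt n)..pi * sqrt n} s *\<^sub>R \<phi> n (s / sqrt n) ^ n \<partial>lborel)"
      using I_le meas taylor eventually_gt_at_top[of 0]
    proof eventually_elim
      fix n :: nat
      assume less: "norm (\<integral>s. (I n s - of_real (G n s)) \<partial>lborel) < c0"
        and le: "\<forall>s. norm (I n s) \<le> exp (- c * s\<^sup>2)" and m: "\<phi> n \<in> borel_measurable borel"
        and v: "0 \<le> v n \<and> v n \<le> C \<and> (\<forall>\<theta>. norm (\<phi> n \<theta> - of_real (1 - v n * \<theta>\<^sup>2 / 2)) \<le> C * \<bar>\<theta>\<bar> ^ 3)"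
        and n: "n > 0"
      have intE: "integrable lborel (\<lambda>s::real. exp (- c * s\<^sup>2))"
        using integrable_gaussian[OF assms(1), of 1] by simp
      have intI: "integrable lborel (I n)"
        by (rule Bochner_Integration.integrable_bound[OF intE]) (use le m in \<open>auto simp: I_def[abs_def]\<close>)
      have intG: "integrable lborel (G n)"
        by (rule Bochner_Integration.integrable_bound[OF intE]) (auto simp: G_def[abs_def] g_def indicator_def)
      have "2 * c0 = (\<integral>s. c0 * indicator {-1..1::real} s \<partial>lborel)"
        by simp
      also have "\<dots> \<le> (\<integral>s. G n s \<partial>lborel)"
      proof (rule integral_mono)
        show "integrable lborel (\<lambda>s. c0 * indicator {-1..1::real} s)" by simp
        fix s :: real
        have "c0 \<le> G n s" if s: "s \<in> {-1..1}"
        proof -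
          have s2: "s\<^sup>2 \<le> 1" using s by (simp add: abs_square_le_1 abs_le_iff)
          have "1 \<le> sqrt n" using n by simp
          then have "1 * 1 \<le> pi * sqrt n" using pi_gt3 by (intro mult_mono) auto
          then have "G n s = g n s" using s by (simp add: G_def)
          moreover have "v n * s\<^sup>2 / 2 \<le> max (C / 2) c"
            using mult_mono[of "v n" C "s\<^sup>2" 1] v s2 assms(2) by simp
          moreover have "c * s\<^sup>2 \<le> max (C / 2) c"
            using mult_left_mono[OF s2, of c] assms(1) by linarith
          ultimately show ?thesis by (simp add: g_def c0_def)
        qed
        moreover have "0 \<le> G n s" by (simp add: G_def g_def)
        ultimately show "c0 * indicator {-1..1} s \<le> G n s"
          by (cases "s \<in> {-1..1}") auto
      qed (rule intG)
      finally have "2 * c0 \<le> norm (complex_of_real (\<integral>s. G n s \<partial>lborel))" by simp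
      moreover have "(\<integral>s. (I n s - of_real (G n s)) \<partial>lborel) = (\<integral>s. I n s \<partial>lborel) - of_real (\<integral>s. G n s \<partial>lborel)"
        using intI intG by simp
      ultimately have "c0 \<le> norm (\<integral>s. I n s \<partial>lborel)"
        using less norm_triangle_ineq2[of "complex_of_real (\<integral>s. G n s \<partial>lborel)" "\<integral>s. I n s \<partial>lborel"]
        by (simp add: norm_minus_commute)
      then show "c0 \<le> norm (\<integral>s. indicator {- (pi * sqrt n)..pi * sqrt n} s *\<^sub>R \<phi> n (s / sqrt n) ^ n \<partial>lborel)"
        by (simp add: I_def)
    qed
  qed
qed

subsection \<open>The correction factors\<close>

text \<open>
  The exact ratio of factorials belonging to a subgraph with \<open>k\<close> vertices and \<open>l\<close> edges is
  \<open>vertex_factor n k * edge_factor m l\<close> times the weight \<open>n^k / (k! l! (4 m)^l)\<close> occurring in \<open>F\<close>.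
\<close>

definition vertex_factor :: "nat \<Rightarrow> nat \<Rightarrow> real" where
  "vertex_factor n k = real (n choose k) * fact k / real n ^ k"

definition edge_factor :: "nat \<Rightarrow> nat \<Rightarrow> real" where
  "edge_factor m l = real (m choose l) * fact l * fact (2 * (m - l)) / fact (2 * m) * 2 ^ l * (2 * real m) ^ l"

lemma vertex_factor_prod:
  assumes "n > 0"
  shows "vertex_factor n k = (\<Prod>i<k. (real n - real i) / real n)"
proof -
  have "real (n choose k) * fact k = (\<Prod>i<k. real n - real i)"
    by (simp add: binomial_gbinomial gbinomial_prod_rev atLeast0LessThan)
  then show ?thesis
    by (simp add: vertex_factor_def prod_dividef)
qed

lemma vertex_factor_nonneg: "vertex_factor n k \<ge> 0"
  by (simp add: vertex_factor_def)

lemma vertex_factor_le_1: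
  assumes "n > 0"
  shows "vertex_factor n k \<le> 1"
proof (cases "k \<le> n")
  case True
  then show ?thesis
    unfolding vertex_factor_prod[OF assms] by (intro prod_le_1) (auto simp: divide_simps)
qed (simp add: vertex_factor_def binomial_eq_0 not_le)

lemma tendsto_vertex_factor: "(\<lambda>n. vertex_factor n k) \<longlonglongrightarrow> 1"
proof -
  have "(\<lambda>n. \<Prod>i<k. (real n - real i) / real n) \<longlonglongrightarrow> (\<Prod>i<k. 1)"
    by (intro tendsto_prod) real_asymp
  then have "(\<lambda>n. \<Prod>i<k. (real n - real i) / real n) \<longlonglongrightarrow> 1"
    by simp
  then show ?thesis
  proof (rule Lim_transform_eventually)
    show "\<forall>\<^sub>F n in sequentially. (\<Prod>i<k. (real n - real i) / real n) = vertex_factor n k"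
      using eventually_gt_at_top[of 0] by eventually_elim (simp add: vertex_factor_prod)
  qed
qed

text \<open>With \<open>r = m - l - 1\<close>, one more edge multiplies the factor by \<open>(r + 1)
  * 4 * m / ((2 * r + 2) * (2 * r + 1)) = 2 * m / (2 * r + 1)\<close>.\<close>

lemma edge_factor_prod:
  assumes "l \<le> m"
  shows "edge_factor m l = (\<Prod>i<l. 2 * real m / (2 * real m - 2 * real i - 1))"
  using assms
proof (induction l)
  case 0
  then show ?case by (simp add: edge_factor_def)
next
  case (Suc l)
  define r where "r = m - Suc l"
  have r: "m - l = Suc r" "m = l + Suc r" using Suc.prems by (auto simp: r_def)
  define X where "X = real (m choose l) * fact l"
  have "Suc l * (m choose Suc l) = (m - l) * (m choose l)"
    by (simp only: binomial_absorption binomial_absorb_comp)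
  then have "real (Suc l * (m choose Suc l)) = real (Suc r * (m choose l))"
    by (simp only: r(1))
  then have "real (Suc l) * real (m choose Suc l) = (real r + 1) * real (m choose l)"
    by (simp only: of_nat_mult) (simp add: add.commute)
  then have "real (m choose Suc l) * fact (Suc l) = X * (real r + 1)"
    by (simp add: X_def mult_ac)
  then have e1: "edge_factor m (Suc l) = X * (real r + 1) * fact (2 * r) / fact (2 * m) * 2 ^ l * (2 * real m) ^ l * (2 * (2 * real m))"
    by (simp add: edge_factor_def r_def)
  have e2: "edge_factor m l = X * ((2 * real r + 2) * (2 * real r + 1) * fact (2 * r)) / fact (2 * m) * 2 ^ l * (2 * real m) ^ l"
    by (simp add: edge_factor_def X_def r(1) algebra_simps)
  have e3: "2 * real m - 2 * real l - 1 = 2 * real r + 1"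
    using r(2) by simp
  have "2 * real r + 1 \<noteq> 0"
    by (simp add: add_nonneg_eq_0_iff)
  then have "edge_factor m (Suc l) = edge_factor m l * (2 * real m / (2 * real m - 2 * real l - 1))"
    unfolding e1 e2 e3 by (simp add: divide_simps)
  then show ?case
    using Suc by simp
qed

lemma edge_factor_nonneg: "edge_factor m l \<ge> 0"
  by (simp add: edge_factor_def)

text \<open>The quotient \<open>l ^ l / fact l\<close> is a single term of the series of
  \<open>exp l\<close>, and \<open>exp 1 \<le> 3\<close>.\<close>

lemma power_le_fact: "real l ^ l \<le> 3 ^ l * fact l"
proof -
  have "real l ^ l / fact l \<le> exp (real l)"
  proof -
    have "(\<Sum>i\<in>{l}. inverse (fact i) * real l ^ i) \<le> (\<Sum>i. inverse (fact i) * real l ^ i)"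
      by (rule sum_le_suminf[OF summable_exp]) auto
    then show ?thesis
      by (simp add: exp_def divide_inverse scaleR_conv_of_real mult.commute)
  qed
  also have "\<dots> = exp 1 ^ l" by (simp add: exp_of_nat_mult[symmetric])
  also have "\<dots> \<le> 3 ^ l" by (intro power_mono exp_le) auto
  finally show ?thesis by (simp add: field_simps)
qed

text \<open>Single factors of the product are unbounded when \<open>l\<close> is close to
  \<open>m\<close>, so the product is estimated as a whole. From
  \<open>2 * m - 2 * i - 1 \<ge> m - i\<close> and \<open>m / (m - i) \<le> l / (l - i)\<close> it
  is at most \<open>(2 * l) ^ l / fact l\<close>, which no longer involves \<open>m\<close>.\<close>

lemma edge_factor_le: "edge_factor m l \<le> 6 ^ l"
proof (cases "l \<le> m")
  case True
  have "edge_factor m l = (\<Prod>i<l. 2 * real m / (2 * real m - 2 * real i - 1))"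
    using True by (rule edge_factor_prod)
  also have "\<dots> \<le> (\<Prod>i<l. 2 * real l / (real l - real i))"
  proof (intro prod_mono conjI)
    fix i assume "i \<in> {..<l}"
    then have i: "i < l" "real i + 1 \<le> real l" "real l \<le> real m" using True by auto
    then show "0 \<le> 2 * real m / (2 * real m - 2 * real i - 1)" by simp
    have "2 * real m / (2 * real m - 2 * real i - 1) \<le> 2 * real m / (real m - real i)"
      using i by (intro divide_left_mono mult_pos_pos) auto
    also have "\<dots> \<le> 2 * real l / (real l - real i)"
    proof -
      have "real i * real l \<le> real i * real m" using i by (intro mult_left_mono) auto
      then have "2 * real m * (real l - real i) \<le> 2 * real l * (real m - real i)"
        by (simp add: algebra_simps)
      then show ?thesis
        using i by (simp add: pos_divide_le_eq pos_le_divide_eq)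
    qed
    finally show "2 * real m / (2 * real m - 2 * real i - 1) \<le> 2 * real l / (real l - real i)" .
  qed
  also have "\<dots> = (2 * real l) ^ l / fact l"
  proof -
    have "real (l choose l) * fact l = (\<Prod>i<l. real l - real i)"
      by (simp only: binomial_gbinomial gbinomial_prod_rev atLeast0LessThan) simp
    then show ?thesis by (simp add: prod_dividef)
  qed
  also have "\<dots> \<le> 6 ^ l"
  proof -
    have "(2 * real l) ^ l \<le> 2 ^ l * (3 ^ l * fact l)"
      unfolding power_mult_distrib by (intro mult_left_mono power_le_fact) simp
    moreover have "(6::real) ^ l = 2 ^ l * 3 ^ l"
      by (simp flip: power_mult_distrib)
    ultimately show ?thesis
      by (simp add: divide_le_eq mult.assoc)
  qed
  finally show ?thesis .
qed (simp add: edge_factor_def binomial_eq_0 not_le)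

lemma tendsto_edge_factor:
  assumes "filterlim m at_top sequentially"
  shows "(\<lambda>n. edge_factor (m n) l) \<longlonglongrightarrow> 1"
proof -
  have "(\<lambda>m. \<Prod>i<l. 2 * real m / (2 * real m - 2 * real i - 1)) \<longlonglongrightarrow> (\<Prod>i<l. 1)"
    by (intro tendsto_prod) real_asymp
  then have "(\<lambda>m. \<Prod>i<l. 2 * real m / (2 * real m - 2 * real i - 1)) \<longlonglongrightarrow> 1"
    by simp
  then have "(\<lambda>m. edge_factor m l) \<longlonglongrightarrow> 1"
  proof (rule Lim_transform_eventually)
    show "\<forall>\<^sub>F m in sequentially. (\<Prod>i<l. 2 * real m / (2 * real m - 2 * real i - 1)) = edge_factor m l"
      using eventually_ge_at_top[of l] by eventually_elim (simp add: edge_factor_prod)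
  qed
  then show ?thesis using assms by (rule filterlim_compose)
qed

text \<open>Only finitely many pairs \<open>k, l \<le> L\<close> require convergence. For all others
  the crude bound \<open>6 ^ (k + l)\<close> equals \<open>12 ^ (k + l) / 2 ^ (k + l)\<close>, and
  the spare power of 2 beats \<open>\<eta>\<close>.\<close>

lemma factor_deviation:
  assumes "filterlim m at_top sequentially" "\<eta> > 0"
  shows "\<forall>\<^sub>F n in sequentially. \<forall>k l. \<bar>vertex_factor n k * edge_factor (m n) l - 1\<bar> \<le> \<eta> * 12 ^ (k + l)"
proof -
  obtain L :: nat where L: "1 / 2 ^ L < \<eta>"
    using real_arch_pow_inv[OF assms(2), of "1/2"] by (auto simp: power_divide)
  have lim: "(\<lambda>n. \<bar>vertex_factor n k * edge_factor (m n) l - 1\<bar>) \<longlonglongrightarrow> 0" for k l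
    using tendsto_mult[OF tendsto_vertex_factor[of k] tendsto_edge_factor[OF assms(1), of l]]
    by (auto intro!: tendsto_rabs_zero LIM_zero)
  have "\<forall>\<^sub>F n in sequentially. \<forall>p\<in>{..L} \<times> {..L}. \<bar>vertex_factor n (fst p) * edge_factor (m n) (snd p) - 1\<bar> < \<eta>"
    by (intro eventually_ball_finite ballI order_tendstoD(2)[OF lim] assms(2)) auto
  then show ?thesis
    using eventually_gt_at_top[of 0]
  proof eventually_elim
    fix n :: nat assume *: "\<forall>p\<in>{..L} \<times> {..L}. \<bar>vertex_factor n (fst p) * edge_factor (m n) (snd p) - 1\<bar> < \<eta>" and n: "n > 0"
    show "\<forall>k l. \<bar>vertex_factor n k * edge_factor (m n) l - 1\<bar> \<le> \<eta> * 12 ^ (k + l)"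
    proof (intro allI)
      fix k l
      show "\<bar>vertex_factor n k * edge_factor (m n) l - 1\<bar> \<le> \<eta> * 12 ^ (k + l)"
      proof (cases "k \<le> L \<and> l \<le> L")
        case True
        then have "\<bar>vertex_factor n k * edge_factor (m n) l - 1\<bar> \<le> \<eta>" using bspec[OF *, of "(k, l)"] by simp
        also have "\<dots> \<le> \<eta> * 12 ^ (k + l)" using assms(2) by simp
        finally show ?thesis .
      next
        case False
        have "0 \<le> vertex_factor n k * edge_factor (m n) l"
          by (intro mult_nonneg_nonneg vertex_factor_nonneg edge_factor_nonneg)
        moreover have "vertex_factor n k * edge_factor (m n) l \<le> 1 * 6 ^ l"
          by (intro mult_mono vertex_factor_le_1 n edge_factor_le edge_factor_nonneg) auto
        moreover have "(6::real) ^ l \<le> 6 ^ (k + l)" "(1::real) \<le> 6 ^ (k + l)" by (auto intro: power_increasing)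
        ultimately have "\<bar>vertex_factor n k * edge_factor (m n) l - 1\<bar> \<le> 6 ^ (k + l)" by linarith
        also have "\<dots> = 1 / 2 ^ (k + l) * 12 ^ (k + l)" by (simp add: power_divide[symmetric] flip: power_mult_distrib)
        also have "\<dots> \<le> 1 / 2 ^ L * 12 ^ (k + l)"
          using False by (intro mult_right_mono divide_left_mono power_increasing) auto
        also have "\<dots> \<le> \<eta> * 12 ^ (k + l)" using L by (intro mult_right_mono) auto
        finally show ?thesis .
      qed
    qed
  qed
qed

subsection \<open>Integral representation\<close>

text \<open>The integrand contributed by subgraphs with \<open>k\<close> vertices and
  \<open>l\<close> edges, normalised by \<open>\<Delta>(t) ^ n\<close>. The power
  \<open>n - k\<close> of \<open>\<Delta>(y)\<close> replaces a division by
  \<open>\<Delta>(y) ^ k\<close>, so zeros of \<open>\<Delta>\<close> on the circle do no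
  harm.\<close>

definition circle_term :: "(nat, nat) pre_digraph set \<Rightarrow> nat set \<Rightarrow> nat \<Rightarrow> nat \<Rightarrow> real \<Rightarrow> real \<Rightarrow> nat \<times> nat \<Rightarrow> complex" where
  "circle_term Fam D n m t \<theta> = (\<lambda>(k, l). let y = of_real t * cis \<theta> in
     of_real (vertex_factor n k * edge_factor m l) *
     (family_poly Fam k l (Delta_derivs D y) * ((y\<^sup>2 / (2 * of_nat m)) ^ l / (2 ^ l * fact l)) * (of_nat n ^ k / fact k)) *
     (Delta D y ^ (n - k) / of_real (Delta D t) ^ n) * cis (- (real (2 * m) * \<theta>)))"

definition circle_sum :: "(nat, nat) pre_digraph set \<Rightarrow> nat set \<Rightarrow> nat \<Rightarrow> nat \<Rightarrow> real \<Rightarrow> real \<Rightarrow> complex" where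
  "circle_sum Fam D n m t \<theta> = (\<Sum>p\<in>{..n} \<times> {..m}. circle_term Fam D n m t \<theta> p)"

lemma continuous_on_family_poly [continuous_intros]:
  fixes \<delta> :: "'b::topological_space \<Rightarrow> nat \<Rightarrow> 'a::real_normed_field"
  assumes "\<And>s. continuous_on S (\<lambda>x. \<delta> x s)"
  shows "continuous_on S (\<lambda>x. family_poly Fam k l (\<delta> x))"
  unfolding family_poly_eq by (intro continuous_on_sum continuous_on_prod assms)

lemma continuous_on_circle_term [continuous_intros]:
  assumes "m > 0" "Delta D t \<noteq> 0"
  shows "continuous_on S (\<lambda>\<theta>. circle_term Fam D n m t \<theta> p)"
  unfolding circle_term_def Let_def case_prod_unfold
  by (intro continuous_intros) (use assms in auto)

lemma continuous_on_circle_sum [continuous_intros]: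
  assumes "m > 0" "Delta D t \<noteq> 0"
  shows "continuous_on S (circle_sum Fam D n m t)"
  unfolding circle_sum_def[abs_def] by (intro continuous_intros assms)

lemma card_distinguished_integral:
  assumes m: "m > 0" and n: "n > 0" and t: "t > 0" and \<Delta>: "Delta D t > 0"
  shows "of_nat (card (distinguished Fam n m D)) * complex_of_real (2 * pi * t ^ (2 * m)) =
    fact (2 * m) * of_real (Delta D t) ^ n *
    (\<integral>\<theta>. indicator {-pi..pi} \<theta> *\<^sub>R circle_sum Fam D n m t \<theta> \<partial>lborel)"
proof -
  define Q where "Q k l = family_poly Fam k l (Delta_derivs_fps D) * (Delta_fps D :: complex fps) ^ (n - k)" for k l
  have Q: "fps_conv_radius (Q k l) = \<infinity>"
    "eval_fps (Q k l) y = family_poly Fam k l (Delta_derivs D y) * Delta D y ^ (n - k)" for k l y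
  proof -
    note P = eval_family_poly[of Fam k l D y]
    have D: "fps_conv_radius (Delta_fps D ^ (n - k) :: complex fps) = \<infinity>"
      by (rule fps_conv_radius_power_infinity) simp
    show "fps_conv_radius (Q k l) = \<infinity>"
      unfolding Q_def using P D by (intro fps_conv_radius_mult_infinity) auto
    show "eval_fps (Q k l) y = family_poly Fam k l (Delta_derivs D y) * Delta D y ^ (n - k)"
      unfolding Q_def using P D by (subst eval_fps_mult) (auto simp: eval_fps_power eval_Delta_fps)
  qed
  have term_eq: "of_nat (n choose k) * of_nat (m choose l) * fact (2 * (m - l)) * fps_nth (Q k l) (2 * (m - l)) *
      complex_of_real (2 * pi * t ^ (2 * m)) = fact (2 * m) * of_real (Delta D t) ^ n *
      (\<integral>\<theta>. indicator {-pi..pi} \<theta> *\<^sub>R circle_term Fam D n m t \<theta> (k, l) \<partial>lborel)"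
    if kl: "k \<le> n" "l \<le> m" for k l
  proof -
    let ?c = "of_nat (n choose k) * of_nat (m choose l) * fact (2 * (m - l)) :: complex"
    have "(of_real t :: complex) ^ (2 * m) = of_real t ^ (2 * (m - l)) * of_real t ^ (2 * l)"
    proof -
      have "2 * m = 2 * (m - l) + 2 * l" using kl by simp
      then show ?thesis by (metis power_add)
    qed
    then have "?c * fps_nth (Q k l) (2 * (m - l)) * complex_of_real (2 * pi * t ^ (2 * m)) =
        (?c * of_real t ^ (2 * l)) * (2 * pi * fps_nth (Q k l) (2 * (m - l)) * of_real t ^ (2 * (m - l)))"
      by simp
    also have "\<dots> = (?c * of_real t ^ (2 * l)) * (\<integral>\<theta>. indicator {-pi..pi} \<theta> *\<^sub>R
        (eval_fps (Q k l) (of_real t * cis \<theta>) * cis (- (real (2 * (m - l)) * \<theta>))) \<partial>lborel)"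
      using fps_nth_circle_integral[OF Q(1)[of k l], of t "2 * (m - l)"] t by simp
    also have "\<dots> = (\<integral>\<theta>. (?c * of_real t ^ (2 * l)) * (indicator {-pi..pi} \<theta> *\<^sub>R
        (eval_fps (Q k l) (of_real t * cis \<theta>) * cis (- (real (2 * (m - l)) * \<theta>)))) \<partial>lborel)"
      by (rule integral_mult_right_zero[symmetric])
    also have "\<dots> = (\<integral>\<theta>. (fact (2 * m) * of_real (Delta D t) ^ n) *
        (indicator {-pi..pi} \<theta> *\<^sub>R circle_term Fam D n m t \<theta> (k, l)) \<partial>lborel)"
    proof (rule Bochner_Integration.integral_cong[OF refl])
      fix \<theta> :: real
      let ?y = "of_real t * cis \<theta>"
      define X where "X = cis (real (2 * l) * \<theta>)"
      define Y where "Y = cis (- (real (2 * m) * \<theta>))"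
      have e1: "(?y\<^sup>2 / (2 * of_nat m)) ^ l = of_real t ^ (2 * l) * X / (2 * of_nat m) ^ l"
        unfolding X_def Complex.DeMoivre[symmetric] by (simp only: power_divide power_mult_distrib power_mult)
      \<comment> \<open>The coefficient is taken at \<open>2 * (m - l)\<close>. The phase
        \<open>X\<close> restores the phase of \<open>y ^ (2 * l)\<close> in the argument
        \<open>y^2 / (2 * m)\<close>, so that all terms share the phase \<open>Y\<close>.\<close>
      have e2: "cis (- (real (2 * (m - l)) * \<theta>)) = X * Y"
        unfolding X_def Y_def cis_mult using kl by (simp add: of_nat_diff algebra_simps)
      have e3: "complex_of_real (vertex_factor n k * edge_factor m l) =
        ?c * (fact k / of_nat n ^ k) * (2 ^ l * fact l * (2 * of_nat m) ^ l) / fact (2 * m)"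
        by (simp add: vertex_factor_def edge_factor_def)
      have "?c * of_real t ^ (2 * l) * (eval_fps (Q k l) ?y * cis (- (real (2 * (m - l)) * \<theta>))) =
        (fact (2 * m) * of_real (Delta D t) ^ n) * circle_term Fam D n m t \<theta> (k, l)"
        unfolding circle_term_def Let_def prod.case Q(2) e1 e2 e3 Y_def[symmetric]
        using m n \<Delta> by (simp add: divide_simps)
      then show "(?c * of_real t ^ (2 * l)) * (indicator {-pi..pi} \<theta> *\<^sub>R
          (eval_fps (Q k l) (of_real t * cis \<theta>) * cis (- (real (2 * (m - l)) * \<theta>)))) =
        (fact (2 * m) * of_real (Delta D t) ^ n) * (indicator {-pi..pi} \<theta> *\<^sub>R circle_term Fam D n m t \<theta> (k, l))"
        by (metis mult_scaleR_right)
    qed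
    finally show ?thesis by (simp only: integral_mult_right_zero)
  qed
  have int: "integrable lborel (\<lambda>\<theta>. indicator {-pi..pi} \<theta> *\<^sub>R circle_term Fam D n m t \<theta> p)" for p
    by (rule borel_integrable_atLeastAtMost'[unfolded set_integrable_def])
      (use m \<Delta> in \<open>auto intro!: continuous_intros\<close>)
  have "of_nat (card (distinguished Fam n m D)) * complex_of_real (2 * pi * t ^ (2 * m)) =
      (\<Sum>(k, l)\<in>{..n} \<times> {..m}. of_nat (n choose k) * of_nat (m choose l) * fact (2 * (m - l)) *
        fps_nth (Q k l) (2 * (m - l)) * complex_of_real (2 * pi * t ^ (2 * m)))"
    unfolding card_distinguished Q_def sum_distrib_right sum.cartesian_product by (simp only: case_prod_unfold)
  also have "\<dots> = (\<Sum>(k, l)\<in>{..n} \<times> {..m}. fact (2 * m) * of_real (Delta D t) ^ n *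
      (\<integral>\<theta>. indicator {-pi..pi} \<theta> *\<^sub>R circle_term Fam D n m t \<theta> (k, l) \<partial>lborel))"
    by (intro sum.cong refl) (auto simp only: term_eq prod.case mem_Sigma_iff atMost_iff)
  also have "\<dots> = fact (2 * m) * of_real (Delta D t) ^ n *
      (\<Sum>p\<in>{..n} \<times> {..m}. \<integral>\<theta>. indicator {-pi..pi} \<theta> *\<^sub>R circle_term Fam D n m t \<theta> p \<partial>lborel)"
    by (simp add: sum_distrib_left case_prod_unfold)
  also have "(\<Sum>p\<in>{..n} \<times> {..m}. \<integral>\<theta>. indicator {-pi..pi} \<theta> *\<^sub>R circle_term Fam D n m t \<theta> p \<partial>lborel) =
      (\<integral>\<theta>. (\<Sum>p\<in>{..n} \<times> {..m}. indicator {-pi..pi} \<theta> *\<^sub>R circle_term Fam D n m t \<theta> p) \<partial>lborel)"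
    by (rule Bochner_Integration.integral_sum[symmetric]) (rule int)
  finally show ?thesis
    by (simp add: circle_sum_def scaleR_sum_right)
qed

lemma MG_integral:
  assumes t: "t > 0" and \<Delta>: "Delta D t > 0"
  shows "of_nat (MG n m D) * complex_of_real (2 * pi * t ^ (2 * m)) =
    fact (2 * m) * of_real (Delta D t) ^ n *
    (\<integral>\<theta>. indicator {-pi..pi} \<theta> *\<^sub>R ((Delta D (of_real t * cis \<theta>) / of_real (Delta D t)) ^ n
       * cis (- (real (2 * m) * \<theta>))) \<partial>lborel)"
proof -
  have conv: "fps_conv_radius (Delta_fps D ^ n :: complex fps) = \<infinity>"
    by (rule fps_conv_radius_power_infinity) simp
  have "of_nat (MG n m D) * complex_of_real (2 * pi * t ^ (2 * m)) = fact (2 * m) *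
      (\<integral>\<theta>. indicator {-pi..pi} \<theta> *\<^sub>R (eval_fps (Delta_fps D ^ n) (of_real t * cis \<theta>) * cis (- (real (2 * m) * \<theta>))) \<partial>lborel)"
    using fps_nth_circle_integral[OF conv, of t "2 * m"] t by (simp add: MG_eq[where 'a = complex])
  also have "(\<lambda>\<theta>. indicator {-pi..pi} \<theta> *\<^sub>R (eval_fps (Delta_fps D ^ n) (of_real t * cis \<theta>) * cis (- (real (2 * m) * \<theta>)))) =
      (\<lambda>\<theta>. of_real (Delta D t) ^ n * (indicator {-pi..pi} \<theta> *\<^sub>R ((Delta D (of_real t * cis \<theta>) / of_real (Delta D t)) ^ n
       * cis (- (real (2 * m) * \<theta>)))))"
    using \<Delta> by (auto simp: fun_eq_iff eval_fps_power eval_Delta_fps power_divide)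
  finally show ?thesis by (simp only: integral_mult_right_zero mult.assoc)
qed

abbreviation real_term :: "(nat, nat) pre_digraph set \<Rightarrow> nat set \<Rightarrow> nat \<Rightarrow> nat \<Rightarrow> real \<Rightarrow> nat \<times> nat \<Rightarrow> real" where
  "real_term Fam D n m t \<equiv> family_term Fam (real n / Delta D t) (t\<^sup>2 / (2 * real m)) (Delta_derivs D t)"

lemma real_term_nonneg:
  assumes "t > 0" "Delta D t > 0"
  shows "real_term Fam D n m t p \<ge> 0"
  unfolding family_term_def case_prod_unfold
  by (intro mult_nonneg_nonneg family_poly_nonneg Delta_derivs_nonneg divide_nonneg_nonneg zero_le_power)
     (use assms in auto)

text \<open>The estimate for the whole circle, including zeros of \<open>\<Delta>\<close>:
  nonnegative coefficients allow \<open>y\<close> to be replaced by its modulus in the polynomial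
  part, while the decay of \<open>\<Delta>(y)\<close> is kept.\<close>

lemma norm_circle_term_le:
  assumes t: "t > 0" and \<Delta>: "Delta D t > 0" and k: "k \<le> n"
  shows "norm (circle_term Fam D n m t \<theta> (k, l)) \<le> vertex_factor n k * edge_factor m l *
    real_term Fam D n m t (k, l) * (norm (Delta D (of_real t * cis \<theta>)) / Delta D t) ^ (n - k)"
proof -
  let ?y = "of_real t * cis \<theta>"
  have ny: "norm ?y = t" using t by (simp add: norm_mult)
  have P: "norm (family_poly Fam k l (Delta_derivs D ?y)) \<le> family_poly Fam k l (Delta_derivs D t)"
    using norm_Delta_derivs_le[of D ?y] unfolding ny by (rule norm_family_poly_le)
  have "norm (circle_term Fam D n m t \<theta> (k, l)) = vertex_factor n k * edge_factor m l *
     (norm (family_poly Fam k l (Delta_derivs D ?y)) * ((t\<^sup>2 / (2 * real m)) ^ l / (2 ^ l * fact l)) * (real n ^ k / fact k)) *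
     (norm (Delta D ?y) ^ (n - k) / Delta D t ^ n)"
    using vertex_factor_nonneg[of n k] edge_factor_nonneg[of m l] t \<Delta>
    by (simp add: circle_term_def Let_def norm_mult norm_divide norm_power ny)
  also have "\<dots> \<le> vertex_factor n k * edge_factor m l *
     (family_poly Fam k l (Delta_derivs D t) * ((t\<^sup>2 / (2 * real m)) ^ l / (2 ^ l * fact l)) * (real n ^ k / fact k)) *
     (norm (Delta D ?y) ^ (n - k) / Delta D t ^ n)"
    using vertex_factor_nonneg[of n k] edge_factor_nonneg[of m l] t \<Delta> P
    by (intro mult_right_mono mult_left_mono) auto
  also have "Delta D t ^ n = Delta D t ^ (n - k) * Delta D t ^ k"
    using k by (simp flip: power_add)
  finally show ?thesis
    using \<Delta> by (simp add: family_term_def power_divide mult_ac)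
qed

text \<open>Extracting the full power \<open>\<Delta>(y) ^ n\<close>, which is the integrand of
  \<open>MG\<close>, leaves \<open>k\<close> divisions by \<open>\<Delta>(y)\<close>. These are
  exactly the ones in the first argument of \<open>F\<close> in the hypothesis, at
  \<open>x = cis \<theta>\<close>.\<close>

lemma circle_term_eq_scaled:
  assumes "Delta D (of_real t * cis \<theta>) \<noteq> 0" "k \<le> n" "t = chi D (real m / real n)" "Delta D t > 0"
  shows "circle_term Fam D n m t \<theta> (k, l) = of_real (vertex_factor n k * edge_factor m l) *
    scaled_term Fam D n m (1, 1, cis \<theta>) (k, l) *
    ((Delta D (of_real t * cis \<theta>) / of_real (Delta D t)) ^ n * cis (- (real (2 * m) * \<theta>)))"
proof -
  let ?y = "of_real t * cis \<theta>"
  have "Delta D ?y ^ n = Delta D ?y ^ (n - k) * Delta D ?y ^ k"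
    using assms(2) by (simp flip: power_add)
  moreover have eq: "cis \<theta> * complex_of_real (chi D (real m / real n)) = ?y"
    using assms(3) by simp
  ultimately show ?thesis
    using assms(1,4) unfolding circle_term_def scaled_term_def family_term_def Let_def prod.case eq
    by (simp add: power_divide mult_ac)
qed

lemma norm_scaled_term_le:
  assumes "Delta D (of_real t * cis \<theta>) \<noteq> 0" "t = chi D (real m / real n)" "t > 0" "Delta D t > 0"
  shows "norm (scaled_term Fam D n m (1, 1, cis \<theta>) (k, l)) \<le>
    real_term Fam D n m t (k, l) * (Delta D t / norm (Delta D (of_real t * cis \<theta>))) ^ k"
proof -
  let ?y = "of_real t * cis \<theta>"
  have ny: "norm ?y = t" using assms(3) by (simp add: norm_mult)
  have P: "norm (family_poly Fam k l (Delta_derivs D ?y)) \<le> family_poly Fam k l (Delta_derivs D t)"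
    using norm_Delta_derivs_le[of D ?y] unfolding ny by (rule norm_family_poly_le)
  have eq: "cis \<theta> * complex_of_real (chi D (real m / real n)) = ?y"
    using assms(2) by simp
  have "norm (scaled_term Fam D n m (1, 1, cis \<theta>) (k, l)) =
      norm (family_poly Fam k l (Delta_derivs D ?y)) * ((t\<^sup>2 / (2 * real m)) ^ l / (2 ^ l * fact l)) *
      ((real n / norm (Delta D ?y)) ^ k / fact k)"
    unfolding scaled_term_def family_term_def Let_def prod.case eq
    using assms(3) by (simp add: norm_mult norm_divide norm_power ny)
  also have "\<dots> \<le> family_poly Fam k l (Delta_derivs D t) * ((t\<^sup>2 / (2 * real m)) ^ l / (2 ^ l * fact l)) *
      ((real n / norm (Delta D ?y)) ^ k / fact k)"
    using P by (intro mult_right_mono) auto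
  finally show ?thesis
    using assms(1,4) by (simp add: family_term_def power_divide mult_ac)
qed

lemma scaled_term_at_1:
  assumes "t = chi D (real m / real n)"
  shows "scaled_term Fam D n m (of_real z, of_real w, 1) (k, l) =
    of_real (real_term Fam D n m t (k, l) * z ^ k * w ^ l)"
proof -
  have "Delta_derivs D (complex_of_real t) = (\<lambda>s. of_real (Delta_derivs D t s))"
    by (auto simp: Delta_derivs_of_real)
  then have "family_poly Fam k l (Delta_derivs D (complex_of_real t)) = of_real (family_poly Fam k l (Delta_derivs D t))"
    by (simp add: family_poly_of_real)
  then show ?thesis
    unfolding scaled_term_def family_term_def Let_def prod.case assms[symmetric] mult_1_left
    by (simp add: Delta_derivs_of_real power_divide power_mult_distrib)
qed

subsection \<open>Consequences of the convergence hypothesis\<close>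

text \<open>At \<open>z = z0\<close> and \<open>w = w0\<close> only the terms with
  \<open>i = j = 0\<close> survive, so the expansion becomes an ordinary power series in
  \<open>x - x0\<close>, continuous inside its disc of convergence.\<close>

lemma analytic3_on_isCont_third:
  assumes "analytic3_on f S" "(z0, w0, x0) \<in> S"
  shows "isCont (\<lambda>x. f (z0, w0, x)) x0"
proof -
  obtain r a where r: "r > 0" and sums: "\<And>z w x. dist z z0 < r \<Longrightarrow> dist w w0 < r \<Longrightarrow> dist x x0 < r \<Longrightarrow>
      ((\<lambda>(i, j, k). a (i, j, k) * (z - z0) ^ i * (w - w0) ^ j * (x - x0) ^ k) has_sum f (z, w, x)) UNIV"
    using assms unfolding analytic3_on_def by blast
  define h where "h = (\<lambda>k::nat. (0::nat, 0::nat, k))"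
  have pow: "(\<lambda>k. a (h k) * (x - x0) ^ k) sums f (z0, w0, x)" if "dist x x0 < r" for x
  proof -
    let ?g = "\<lambda>(i, j, k). a (i, j, k) * (z0 - z0) ^ i * (w0 - w0) ^ j * (x - x0) ^ k"
    have "(?g has_sum f (z0, w0, x)) UNIV"
      using sums[of z0 w0 x] that r by simp
    also have "(?g has_sum f (z0, w0, x)) UNIV \<longleftrightarrow> (?g has_sum f (z0, w0, x)) (range h)"
      by (rule has_sum_cong_neutral) (auto simp: h_def image_iff power_0_left)
    also have "\<dots> \<longleftrightarrow> (?g \<circ> h has_sum f (z0, w0, x)) UNIV"
      by (rule has_sum_reindex) (auto simp: h_def inj_on_def)
    finally show ?thesis
      by (intro has_sum_imp_sums) (simp add: h_def o_def)
  qed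
  define P where "P u = (\<Sum>k. a (h k) * u ^ k)" for u
  have "summable (\<lambda>k. a (h k) * of_real (r / 2) ^ k)"
    using sums_summable[OF pow[of "x0 + of_real (r / 2)"]] r by (simp add: dist_norm)
  then have "isCont P 0"
    unfolding P_def[abs_def] by (rule isCont_powser) (use r in simp)
  then have "isCont (\<lambda>x. P (x - x0)) x0"
    by (intro isCont_o2[of x0 "\<lambda>x. x - x0" P]) (auto intro!: continuous_intros)
  moreover have "\<forall>\<^sub>F x in nhds x0. P (x - x0) = f (z0, w0, x)"
    using eventually_nhds_ball[OF r, of x0] 
  proof eventually_elim
    case (elim x)
    then show ?case
      using sums_unique[OF pow[of x]] by (simp add: P_def dist_commute)
  qed
  ultimately show ?thesis
    using isCont_cong[of "\<lambda>x. P (x - x0)" "\<lambda>x. f (z0, w0, x)" x0] by blast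
qed

lemma F_at_chi_eq:
  "F_at_chi Fam D n m = (\<Sum>\<^sub>\<infinity>p. real_term Fam D n m (chi D (real m / real n)) p)"
  by (simp add: F_at_chi_def Let_def family_gf_def)

text \<open>Convergence at the point \<open>(R, R, 1)\<close> bounds the ratio there, eventually by
  the norm of its limit plus 1. The terms are nonnegative at this point, so every finite partial sum
  obeys the same bound.\<close>

lemma real_term_sums_bounded:
  assumes rc: "ratio_converges Fam D m c" and dc: "degree_range D c" and R: "R > 0"
    and good: "\<forall>\<^sub>F n in sequentially. chi D (real (m n) / real n) > 0"
  obtains C where "C \<ge> 0" "\<forall>\<^sub>F n in sequentially. 0 \<le> F_at_chi Fam D n (m n) \<and>
    F_ratio Fam D n (m n) (1, 1, 1) = (if F_at_chi Fam D n (m n) = 0 then 0 else 1) \<and>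
    (\<forall>X. finite X \<longrightarrow> (\<Sum>p\<in>X. real_term Fam D n (m n) (chi D (real (m n) / real n)) p * R ^ (fst p + snd p))
       \<le> C * F_at_chi Fam D n (m n))"
proof -
  obtain f where f: "\<And>K. compact K \<Longrightarrow> K \<subseteq> ratio_domain D c \<Longrightarrow>
      (\<forall>\<^sub>F n in sequentially. \<forall>p\<in>K. scaled_term Fam D n (m n) p summable_on UNIV) \<and>
      uniform_limit K (\<lambda>n. F_ratio Fam D n (m n)) f sequentially"
    using rc unfolding ratio_converges_def by blast
  have D: "D \<noteq> {}" using dc by (auto simp: degree_range_def)
  have dom: "(z, w, 1) \<in> ratio_domain D c" for z w
    using Delta_pos[OF D chi_pos[OF dc]] by (simp add: ratio_domain_def Delta_derivs_of_real)
  let ?p = "(complex_of_real R, complex_of_real R, 1::complex)"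
  note fp = f[of "{?p}", simplified, OF dom]
  note f1 = f[of "{(1, 1, 1)}", simplified, OF dom]
  have "(\<lambda>n. F_ratio Fam D n (m n) ?p) \<longlonglongrightarrow> f ?p"
    by (rule conjunct2[OF fp])
  from order_tendstoD(2)[OF tendsto_norm[OF this], of "norm (f ?p) + 1"]
  have "\<forall>\<^sub>F n in sequentially. norm (F_ratio Fam D n (m n) ?p) < norm (f ?p) + 1"
    by simp
  then have "\<forall>\<^sub>F n in sequentially. 0 \<le> F_at_chi Fam D n (m n) \<and>
    F_ratio Fam D n (m n) (1, 1, 1) = (if F_at_chi Fam D n (m n) = 0 then 0 else 1) \<and>
    (\<forall>X. finite X \<longrightarrow> (\<Sum>p\<in>X. real_term Fam D n (m n) (chi D (real (m n) / real n)) p * R ^ (fst p + snd p))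
       \<le> (norm (f ?p) + 1) * F_at_chi Fam D n (m n))"
    using conjunct1[OF fp] conjunct1[OF f1] good
  proof eventually_elim
    fix n
    assume less: "norm (F_ratio Fam D n (m n) ?p) < norm (f ?p) + 1"
      and sp: "scaled_term Fam D n (m n) ?p summable_on UNIV"
      and s1: "scaled_term Fam D n (m n) (1, 1, 1) summable_on UNIV"
      and tpos: "chi D (real (m n) / real n) > 0"
    define t where "t = chi D (real (m n) / real n)"
    define T where "T = real_term Fam D n (m n) t"
    define F where "F = F_at_chi Fam D n (m n)"
    define T' where "T' p = T p * R ^ (fst p + snd p)" for p
    have \<Delta>: "Delta D t > 0" and t: "t > 0" using tpos Delta_pos[OF D] by (auto simp: t_def)
    have T0: "T p \<ge> 0" for p unfolding T_def using t \<Delta> by (rule real_term_nonneg)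
    have F: "F = (\<Sum>\<^sub>\<infinity>p. T p)" by (simp add: F_def F_at_chi_eq T_def t_def)
    have F0: "F \<ge> 0" unfolding F by (intro infsum_nonneg T0)
    have e1: "scaled_term Fam D n (m n) (1, 1, 1) = (\<lambda>p. complex_of_real (T p))"
      using scaled_term_at_1[OF t_def, of Fam 1 1] by (auto simp: fun_eq_iff T_def)
    have ep: "scaled_term Fam D n (m n) ?p = (\<lambda>p. complex_of_real (T' p))"
      using scaled_term_at_1[OF t_def, of Fam R R] by (auto simp: fun_eq_iff T_def T'_def power_add mult.assoc)
    have T'0: "T' p \<ge> 0" for p using T0 R by (simp add: T'_def)
    \<comment> \<open>Summability is part of the convergence hypothesis. It excludes the default
      value 0 of \<open>infsum\<close>, with which \<open>F\<close> would say nothing about its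
      terms.\<close>
    have T_sum: "T summable_on UNIV" and T'_sum: "T' summable_on UNIV"
      using s1 sp T0 T'0 unfolding e1 ep summable_on_iff_abs_summable_on_complex by simp_all
    have inf1: "(\<Sum>\<^sub>\<infinity>p. complex_of_real (T p)) = of_real (\<Sum>\<^sub>\<infinity>p. T p)"
      by (intro infsumI has_sum_of_real has_sum_infsum T_sum)
    have infp: "(\<Sum>\<^sub>\<infinity>p. complex_of_real (T' p)) = of_real (\<Sum>\<^sub>\<infinity>p. T' p)"
      by (intro infsumI has_sum_of_real has_sum_infsum T'_sum)
    \<comment> \<open>The value 0 in the degenerate case comes from division by zero.\<close>
    have ratio1: "F_ratio Fam D n (m n) (1, 1, 1) = (if F = 0 then 0 else 1)"
      unfolding F_ratio_def e1 F_def[symmetric] by (simp add: inf1 F)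
    have bound: "(\<Sum>\<^sub>\<infinity>p. T' p) \<le> (norm (f ?p) + 1) * F"
    proof (cases "F = 0")
      case True
      \<comment> \<open>A summable family of nonnegative terms with sum 0 vanishes identically, so
        its weighted sum vanishes too.\<close>
      have "T p = 0" for p
        using finite_sum_le_infsum[OF T_sum, of "{p}"] T0 True F by (simp add: order_antisym)
      then show ?thesis by (simp add: T'_def True)
    next
      case False
      have "norm (F_ratio Fam D n (m n) ?p) = (\<Sum>\<^sub>\<infinity>p. T' p) / F"
        unfolding F_ratio_def ep F_def[symmetric] using infsum_nonneg[of UNIV T'] T'0 F0
        by (simp add: infp norm_divide)
      then show ?thesis
        using less False F0 by (simp add: divide_less_eq)
    qed
    show "0 \<le> F_at_chi Fam D n (m n) \<and>
      F_ratio Fam D n (m n) (1, 1, 1) = (if F_at_chi Fam D n (m n) = 0 then 0 else 1) \<and>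
      (\<forall>X. finite X \<longrightarrow> (\<Sum>p\<in>X. real_term Fam D n (m n) (chi D (real (m n) / real n)) p * R ^ (fst p + snd p))
       \<le> (norm (f ?p) + 1) * F_at_chi Fam D n (m n))"
    proof (intro conjI allI impI)
      fix X :: "(nat \<times> nat) set" assume X: "finite X"
      have "sum T' X \<le> (\<Sum>\<^sub>\<infinity>p. T' p)"
        using T'_sum X T'0 by (intro finite_sum_le_infsum) auto
      with bound show "(\<Sum>p\<in>X. real_term Fam D n (m n) (chi D (real (m n) / real n)) p * R ^ (fst p + snd p))
         \<le> (norm (f ?p) + 1) * F_at_chi Fam D n (m n)"
        by (simp add: T'_def[abs_def] T_def t_def F_def)
    qed (use F0 ratio1 in \<open>simp_all add: F_def\<close>)
  qed
  then show ?thesis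
    by (intro that[of "norm (f ?p) + 1"]) auto
qed

text \<open>On a small closed disc around \<open>x = 1\<close> that avoids the zeros of
  \<open>\<Delta>(x * \<chi>)\<close> the ratios converge uniformly to a function continuous at 1.
  Hence a moving point \<open>x n\<close> tending to 1 can replace 1.\<close>

lemma F_ratio_equicontinuous:
  assumes rc: "ratio_converges Fam D m c" and dc: "degree_range D c" and x: "x \<longlonglongrightarrow> 1"
  shows "(\<lambda>n. F_ratio Fam D n (m n) (1, 1, x n) - F_ratio Fam D n (m n) (1, 1, 1)) \<longlonglongrightarrow> 0"
    and "\<forall>\<^sub>F n in sequentially. scaled_term Fam D n (m n) (1, 1, x n) summable_on UNIV"
proof -
  obtain f where an: "analytic3_on f (ratio_domain D c)" and f: "\<And>K. compact K \<Longrightarrow> K \<subseteq> ratio_domain D c \<Longrightarrow>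
      (\<forall>\<^sub>F n in sequentially. \<forall>p\<in>K. scaled_term Fam D n (m n) p summable_on UNIV) \<and>
      uniform_limit K (\<lambda>n. F_ratio Fam D n (m n)) f sequentially"
    using rc unfolding ratio_converges_def by blast
  have D: "D \<noteq> {}" using dc by (auto simp: degree_range_def)
  let ?\<chi> = "complex_of_real (chi D (c / 2))"
  have "continuous (at 1) (\<lambda>x. Delta D (x * ?\<chi>))"
    by (rule continuous_on_interior[of UNIV]) (auto intro!: continuous_intros)
  moreover have "Delta D (1 * ?\<chi>) \<noteq> 0"
    using Delta_pos[OF D chi_pos[OF dc]] by (simp add: Delta_derivs_of_real)
  ultimately obtain e where e: "e > 0" "\<And>x. dist 1 x < e \<Longrightarrow> Delta D (x * ?\<chi>) \<noteq> 0"
    using continuous_at_avoid by blast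
  define K where "K = (\<lambda>x. (1::complex, 1::complex, x)) ` cball (1::complex) (e / 2)"
  have "compact K"
    unfolding K_def by (intro compact_continuous_image compact_cball continuous_intros)
  moreover have "K \<subseteq> ratio_domain D c"
    using e by (auto simp: K_def ratio_domain_def)
  ultimately have sK: "\<forall>\<^sub>F n in sequentially. \<forall>p\<in>K. scaled_term Fam D n (m n) p summable_on UNIV"
    and uK: "uniform_limit K (\<lambda>n. F_ratio Fam D n (m n)) f sequentially"
    using f by blast+
  have xK: "\<forall>\<^sub>F n in sequentially. (1, 1, x n) \<in> K"
    using tendstoD[OF x, of "e / 2"] e(1)
    by (auto simp: K_def dist_commute elim!: eventually_mono)
  show "\<forall>\<^sub>F n in sequentially. scaled_term Fam D n (m n) (1, 1, x n) summable_on UNIV"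
    using sK xK by eventually_elim blast
  have "(1, 1, 1) \<in> ratio_domain D c"
    using e(2)[of 1] e(1) by (simp add: ratio_domain_def)
  then have "isCont (\<lambda>x. f (1, 1, x)) 1"
    by (rule analytic3_on_isCont_third[OF an])
  then have fx: "(\<lambda>n. f (1, 1, x n)) \<longlonglongrightarrow> f (1, 1, 1)"
    using x by (rule isCont_tendsto_compose)
  have "(\<lambda>n. F_ratio Fam D n (m n) (1, 1, x n) - f (1, 1, x n)) \<longlonglongrightarrow> 0"
  proof (rule tendstoI)
    fix \<epsilon> :: real assume "\<epsilon> > 0"
    from uniform_limitD[OF uK this] xK
    show "\<forall>\<^sub>F n in sequentially. dist (F_ratio Fam D n (m n) (1, 1, x n) - f (1, 1, x n)) 0 < \<epsilon>"
      by eventually_elim (auto simp: dist_norm)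
  qed
  from tendsto_add[OF this fx] have lim: "(\<lambda>n. F_ratio Fam D n (m n) (1, 1, x n)) \<longlonglongrightarrow> f (1, 1, 1)"
    by simp
  have "(\<lambda>n. F_ratio Fam D n (m n) (1, 1, 1)) \<longlonglongrightarrow> f (1, 1, 1)"
    using e(1) by (intro tendsto_uniform_limitI[OF uK]) (auto simp: K_def)
  from tendsto_diff[OF lim this]
  show "(\<lambda>n. F_ratio Fam D n (m n) (1, 1, x n) - F_ratio Fam D n (m n) (1, 1, 1)) \<longlonglongrightarrow> 0"
    by simp
qed

lemma norm_has_sum_le:
  fixes h :: "'i \<Rightarrow> 'b::real_normed_vector"
  assumes "(h has_sum x) A" "\<And>X. finite X \<Longrightarrow> X \<subseteq> A \<Longrightarrow> (\<Sum>i\<in>X. norm (h i)) \<le> B"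
  shows "norm x \<le> B"
proof (rule tendsto_upperbound)
  show "((\<lambda>X. norm (sum h X)) \<longlongrightarrow> norm x) (finite_subsets_at_top A)"
    using assms(1) unfolding has_sum_def by (rule tendsto_norm)
  show "\<forall>\<^sub>F X in finite_subsets_at_top A. norm (sum h X) \<le> B"
    by (rule eventually_finite_subsets_at_top_weakI) (use assms(2) norm_sum order_trans in blast)
qed simp

subsection \<open>The asymptotics\<close>

lemma integral_rescale:
  fixes h :: "real \<Rightarrow> complex"
  assumes "n > (0::nat)"
  shows "(\<integral>\<theta>. indicator {-pi..pi} \<theta> *\<^sub>R h \<theta> \<partial>lborel) = of_real (1 / sqrt n) *
    (\<integral>s. indicator {- (pi * sqrt n)..pi * sqrt n} s *\<^sub>R h (s / sqrt n) \<partial>lborel)"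
proof -
  have n: "sqrt (real n) > 0" using assms by simp
  have ind: "indicator {-pi..pi} (s / sqrt n) = (indicator {- (pi * sqrt n)..pi * sqrt n} s :: real)" for s
    using n by (simp add: indicator_def pos_le_divide_eq pos_divide_le_eq)
  have "(\<integral>\<theta>. indicator {-pi..pi} \<theta> *\<^sub>R h \<theta> \<partial>lborel) =
      \<bar>1 / sqrt n\<bar> *\<^sub>R (\<integral>s. indicator {-pi..pi} (0 + 1 / sqrt n * s) *\<^sub>R h (0 + 1 / sqrt n * s) \<partial>lborel)"
    by (rule lborel_integral_real_affine) (use n in simp)
  then show ?thesis
    using n by (simp add: ind scaleR_conv_of_real)
qed

text \<open>After cancelling common prefactors, the number of pairs divided by \<open>MG\<close> is
  \<open>J n / I n\<close>. For nonzero \<open>F n\<close> its quotient by \<open>F n\<close>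
  differs from 1 by the integral of \<open>E n\<close> divided by \<open>I n\<close>, and
  \<open>I n\<close> stays away from 0.\<close>

lemma distinguished_asymptotics:
  assumes D: "\<exists>a\<in>D. \<exists>b\<in>D. a \<noteq> b" and gcd: "Gcd ((\<lambda>d. d - Inf D) ` D) = 1"
    and m_top: "filterlim m at_top sequentially"
    and lim_c: "(\<lambda>n. 2 * real (m n) / real n) \<longlonglongrightarrow> c"
    and dc: "degree_range D c" and rc: "ratio_converges Fam D m c"
  shows "(\<lambda>n. real (card (distinguished Fam n (m n) D))) \<sim>[sequentially]
    (\<lambda>n. real (MG n (m n) D) * F_at_chi Fam D n (m n))"
proof -
  have Dne: "D \<noteq> {}" using D by blast
  define t where "t n = chi D (real (m n) / real n)" for n
  define r where "r n = 2 * real (m n) / real n" for n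
  define F where "F n = F_at_chi Fam D n (m n)" for n
  define T where "T n = real_term Fam D n (m n) (t n)" for n
  define R1 where "R1 n = F_ratio Fam D n (m n) (1, 1, 1)" for n
  obtain l u where lu: "l < c" "c < u" "degree_range D l" "degree_range D u"
    using degree_range_open[OF dc] .
  define a where "a = chi D (l / 2)"
  define b where "b = chi D (u / 2)"
  have a: "a > 0" unfolding a_def by (rule chi_pos[OF lu(3)])
  have ab: "a \<le> b" unfolding a_def b_def using lu by (intro chi_mono) auto
  \<comment> \<open>The properties that hold for all large \<open>n\<close>: positive sizes, saddle
    point inside \<open>[a, b]\<close>, and the saddle point equation.\<close>
  define good where "good n \<longleftrightarrow> n > 0 \<and> m n > 0 \<and> a \<le> t n \<and> t n \<le> b \<and>
    t n * Delta_derivs D (t n) 1 = r n * Delta D (t n)" for n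
  have "\<forall>\<^sub>F n in sequentially. l < r n" "\<forall>\<^sub>F n in sequentially. r n < u"
    using order_tendstoD[OF lim_c] lu by (simp_all add: r_def)
  moreover have "\<forall>\<^sub>F n in sequentially. m n > 0"
    using m_top eventually_compose_filterlim[OF eventually_gt_at_top[of 0]] by blast
  ultimately have good: "\<forall>\<^sub>F n in sequentially. good n"
    using eventually_gt_at_top[of 0]
  proof eventually_elim
    case (elim n)
    have "degree_range D (r n)"
      using lu elim by (auto simp: degree_range_def intro: less_trans)
    moreover have "t n = chi D (r n / 2)" by (simp add: t_def r_def)
    ultimately show ?case
      using elim lu chi_eq[of D "r n"] chi_mono[of D l "r n"] chi_mono[of D "r n" u]
      by (simp add: good_def a_def b_def)
  qed
  have good_pos: "t n > 0" "Delta D (t n) > 0" if "good n" for n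
    using that a Delta_pos[OF Dne, of "t n"] by (auto simp: good_def)
  obtain c1 where c1: "c1 > 0" "\<And>t \<theta>. a \<le> t \<Longrightarrow> t \<le> b \<Longrightarrow> \<bar>\<theta>\<bar> \<le> pi \<Longrightarrow>
    norm (Delta D (of_real t * cis \<theta>)) \<le> Delta D t * exp (- c1 * \<theta>\<^sup>2)"
    using Delta_circle_bound[OF D gcd a ab] by blast
  obtain C where C: "C \<ge> 0" "\<And>t \<mu>. a \<le> t \<Longrightarrow> t \<le> b \<Longrightarrow> t * Delta_derivs D t 1 = \<mu> * Delta D t \<Longrightarrow>
    \<exists>v. 0 \<le> v \<and> v \<le> C \<and> (\<forall>\<theta>. norm (Delta D (of_real t * cis \<theta>) / of_real (Delta D t) * cis (- (\<mu> * \<theta>))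
      - of_real (1 - v * \<theta>\<^sup>2 / 2)) \<le> C * \<bar>\<theta>\<bar> ^ 3)"
    using Delta_circle_taylor[OF Dne a ab] by blast
  \<comment> \<open>The phase is distributed evenly over the \<open>n\<close> factors, so the whole
    integrand of \<open>MG\<close> is an \<open>n\<close>-th power; \<open>n * r n = 2 * m n\<close>
    restores the total phase.\<close>
  define \<phi> where "\<phi> n \<theta> = Delta D (of_real (t n) * cis \<theta>) / of_real (Delta D (t n)) * cis (- (r n * \<theta>))" for n \<theta>
  have \<phi>_cont: "continuous_on UNIV (\<phi> n)" if "good n" for n
    unfolding \<phi>_def[abs_def] using good_pos[OF that] by (intro continuous_intros) auto
  then have \<phi>_meas: "\<phi> n \<in> borel_measurable borel" if "good n" for n
    using that by (intro borel_measurable_continuous_onI)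
  have \<phi>_le: "norm (\<phi> n \<theta>) \<le> exp (- c1 * \<theta>\<^sup>2)" if "good n" "\<bar>\<theta>\<bar> \<le> pi" for n \<theta>
    using c1(2)[of "t n" \<theta>] that good_pos[OF that(1)]
    by (simp add: \<phi>_def norm_mult norm_divide divide_le_eq mult.commute good_def)
  define v where "v n = (SOME v. 0 \<le> v \<and> v \<le> C \<and> (\<forall>\<theta>. norm (\<phi> n \<theta> - of_real (1 - v * \<theta>\<^sup>2 / 2)) \<le> C * \<bar>\<theta>\<bar> ^ 3))" for n
  have v: "0 \<le> v n \<and> v n \<le> C \<and> (\<forall>\<theta>. norm (\<phi> n \<theta> - of_real (1 - v n * \<theta>\<^sup>2 / 2)) \<le> C * \<bar>\<theta>\<bar> ^ 3)" if "good n" for n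
    unfolding v_def by (rule someI_ex) (use C(2)[of "t n" "r n"] that in \<open>simp add: \<phi>_def good_def\<close>)
  define W where "W n = {- (pi * sqrt (real n))..pi * sqrt (real n)}" for n
  define I where "I n = (\<integral>s. indicator (W n) s *\<^sub>R \<phi> n (s / sqrt n) ^ n \<partial>lborel)" for n
  define J where "J n = (\<integral>s. indicator (W n) s *\<^sub>R circle_sum Fam D n (m n) (t n) (s / sqrt n) \<partial>lborel)" for n
  have "\<forall>\<^sub>F n in sequentially. \<phi> n \<in> borel_measurable borel"
    using good by eventually_elim (rule \<phi>_meas)
  moreover have "\<forall>\<^sub>F n in sequentially. \<forall>\<theta>. \<bar>\<theta>\<bar> \<le> pi \<longrightarrow> norm (\<phi> n \<theta>) \<le> exp (- c1 * \<theta>\<^sup>2)"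
    using good by eventually_elim (use \<phi>_le in blast)
  moreover have "\<forall>\<^sub>F n in sequentially. 0 \<le> v n \<and> v n \<le> C \<and>
      (\<forall>\<theta>. norm (\<phi> n \<theta> - of_real (1 - v n * \<theta>\<^sup>2 / 2)) \<le> C * \<bar>\<theta>\<bar> ^ 3)"
    using good by eventually_elim (rule v)
  ultimately obtain c0 where c0: "c0 > 0" "\<forall>\<^sub>F n in sequentially. c0 \<le> norm (I n)"
    using local_limit_lower_bound[OF c1(1) C(1), of \<phi> v] unfolding I_def W_def by blast

  have \<phi>_pow: "\<phi> n \<theta> ^ n = (Delta D (of_real (t n) * cis \<theta>) / of_real (Delta D (t n))) ^ n * cis (- (real (2 * m n) * \<theta>))"
    if "good n" for n \<theta>
  proof -
    have "real n * (- (r n * \<theta>)) = - (real (2 * m n) * \<theta>)"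
      using that by (simp add: r_def good_def)
    then show ?thesis
      unfolding \<phi>_def power_mult_distrib Complex.DeMoivre by (simp only:)
  qed
  have ratio: "MG n (m n) D > 0 \<and> of_real (real (card (distinguished Fam n (m n) D)) / real (MG n (m n) D)) = J n / I n"
    if "good n" "c0 \<le> norm (I n)" for n
  proof -
    note pos = good_pos[OF that(1)]
    have nm: "n > 0" "m n > 0" using that(1) by (auto simp: good_def)
    define \<kappa> where "\<kappa> = complex_of_real (2 * pi * t n ^ (2 * m n))"
    define \<tau> where "\<tau> = fact (2 * m n) * complex_of_real (Delta D (t n)) ^ n * of_real (1 / sqrt n)"
    have \<kappa>: "\<kappa> \<noteq> 0" and \<tau>: "\<tau> \<noteq> 0" using pos nm by (auto simp: \<kappa>_def \<tau>_def)
    have 1: "of_nat (card (distinguished Fam n (m n) D)) * \<kappa> = \<tau> * J n"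
      using card_distinguished_integral[OF nm(2,1) pos]
      unfolding \<kappa>_def \<tau>_def J_def W_def integral_rescale[OF nm(1)] by (simp only: mult.assoc)
    have 2: "of_nat (MG n (m n) D) * \<kappa> = \<tau> * I n"
      using MG_integral[OF pos, of n "m n"]
      unfolding \<kappa>_def \<tau>_def I_def W_def \<phi>_pow[OF that(1)] integral_rescale[OF nm(1)] by (simp only: mult.assoc)
    have I: "I n \<noteq> 0" using that(2) c0(1) by auto
    then have "\<tau> * I n \<noteq> 0" using \<tau> by simp
    then have MG: "MG n (m n) D \<noteq> 0" unfolding 2[symmetric] by (intro notI) simp
    have "of_nat (card (distinguished Fam n (m n) D)) * \<kappa> * (\<tau> * I n) = of_nat (MG n (m n) D) * \<kappa> * (\<tau> * J n)"
      unfolding 1 2 by (simp add: mult_ac)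
    then have "of_nat (card (distinguished Fam n (m n) D)) * I n = of_nat (MG n (m n) D) * J n"
      using \<kappa> \<tau> by simp
    then have "of_nat (card (distinguished Fam n (m n) D)) / of_nat (MG n (m n) D) = J n / I n"
      using I MG by (simp add: field_simps)
    then show ?thesis using MG by simp
  qed

  have t_pos: "\<forall>\<^sub>F n in sequentially. chi D (real (m n) / real n) > 0"
    using good by eventually_elim (use good_pos in \<open>simp add: t_def\<close>)
  \<comment> \<open>The 6 absorbs the edge factors, the exponential absorbs the \<open>k\<close>
    factors missing from the power of \<open>\<Delta>(y)\<close>.\<close>
  define R where "R = max 6 (exp (c1 * pi\<^sup>2))"
  have R: "R > 0" "R \<ge> 6" "exp (c1 * pi\<^sup>2) \<le> R" by (auto simp: R_def)
  obtain CR where CR: "CR \<ge> 0" "\<forall>\<^sub>F n in sequentially. 0 \<le> F n \<and> R1 n = (if F n = 0 then 0 else 1) \<and>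
      (\<forall>X. finite X \<longrightarrow> (\<Sum>p\<in>X. T n p * R ^ (fst p + snd p)) \<le> CR * F n)"
    using real_term_sums_bounded[OF rc dc R(1) t_pos] unfolding F_def R1_def T_def t_def .
  \<comment> \<open>The weight 24 is 12, from the deviation of the correction factors, times 2, from
    \<open>\<Delta>(t) / \<bar>\<Delta>(y)\<bar> \<le> 2\<close> near the saddle point.\<close>
  obtain C24 where C24: "C24 \<ge> 0" "\<forall>\<^sub>F n in sequentially. 0 \<le> F n \<and> R1 n = (if F n = 0 then 0 else 1) \<and>
      (\<forall>X. finite X \<longrightarrow> (\<Sum>p\<in>X. T n p * 24 ^ (fst p + snd p)) \<le> C24 * F n)"
    using real_term_sums_bounded[OF rc dc _ t_pos, of 24] unfolding F_def R1_def T_def t_def by force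

  have T0: "T n p \<ge> 0" if "good n" for n p
    unfolding T_def using good_pos[OF that] by (rule real_term_nonneg)

  have sum_bound: "norm (circle_sum Fam D n (m n) (t n) (s / sqrt n)) \<le> CR * F n * exp (- c1 * s\<^sup>2)"
    if g: "good n" and "s \<in> W n" and CRn: "\<And>X. finite X \<Longrightarrow> (\<Sum>p\<in>X. T n p * R ^ (fst p + snd p)) \<le> CR * F n" for n s
  proof -
    note pos = good_pos[OF that(1)]
    have n: "n > 0" using that(1) by (simp add: good_def)
    define \<theta> where "\<theta> = s / sqrt n"
    have \<theta>: "\<bar>\<theta>\<bar> \<le> pi" using that(2) n by (auto simp: W_def \<theta>_def abs_le_iff pos_divide_le_eq field_simps)
    have n\<theta>: "real n * \<theta>\<^sup>2 = s\<^sup>2" using n by (simp add: \<theta>_def power_divide)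
    define \<rho> where "\<rho> = norm (Delta D (of_real (t n) * cis \<theta>)) / Delta D (t n)"
    have \<rho>: "0 \<le> \<rho>" "\<rho> \<le> exp (- c1 * \<theta>\<^sup>2)"
      using c1(2)[of "t n" \<theta>] that(1) pos \<theta> by (auto simp: \<rho>_def good_def divide_le_eq mult.commute)
    have "norm (circle_term Fam D n (m n) (t n) \<theta> p) \<le> exp (- c1 * s\<^sup>2) * (T n p * R ^ (fst p + snd p))"
      if "p \<in> {..n} \<times> {..m n}" for p
    proof -
      obtain k l where p: "p = (k, l)" "k \<le> n" using \<open>p \<in> _\<close> by auto
      have "\<rho> ^ (n - k) \<le> exp (- c1 * \<theta>\<^sup>2) ^ (n - k)" using \<rho> by (intro power_mono)
      also have "\<dots> = exp (- c1 * s\<^sup>2) * exp (c1 * \<theta>\<^sup>2) ^ k"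
        unfolding exp_of_nat_mult[symmetric] exp_add[symmetric] n\<theta>[symmetric]
        using p(2) by (simp add: of_nat_diff algebra_simps)
      also have "exp (c1 * \<theta>\<^sup>2) ^ k \<le> R ^ k"
      proof (intro power_mono)
        have "\<theta>\<^sup>2 \<le> pi\<^sup>2" using \<theta> by (simp add: abs_le_square_iff[symmetric])
        then have "exp (c1 * \<theta>\<^sup>2) \<le> exp (c1 * pi\<^sup>2)" using c1(1) by simp
        also have "\<dots> \<le> R" by (rule R(3))
        finally show "exp (c1 * \<theta>\<^sup>2) \<le> R" .
      qed simp
      finally have \<rho>k: "\<rho> ^ (n - k) \<le> exp (- c1 * s\<^sup>2) * R ^ k" by simp
      have "vertex_factor n k * edge_factor (m n) l \<le> 1 * 6 ^ l"
        by (intro mult_mono vertex_factor_le_1 n edge_factor_le edge_factor_nonneg) auto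
      also have "\<dots> \<le> R ^ l" using R by (simp add: power_mono)
      finally have AB: "vertex_factor n k * edge_factor (m n) l \<le> R ^ l" .
      have "norm (circle_term Fam D n (m n) (t n) \<theta> p) \<le>
          vertex_factor n k * edge_factor (m n) l * T n (k, l) * \<rho> ^ (n - k)"
        unfolding p(1) T_def \<rho>_def by (rule norm_circle_term_le[OF pos p(2)])
      also have "\<dots> \<le> R ^ l * T n (k, l) * (exp (- c1 * s\<^sup>2) * R ^ k)"
        using R(1) \<rho>(1) T0[OF g] by (intro mult_mono AB \<rho>k mult_right_mono mult_nonneg_nonneg) auto
      finally show ?thesis by (simp add: p(1) power_add mult_ac)
    qed
    then have "norm (circle_sum Fam D n (m n) (t n) \<theta>) \<le> (\<Sum>p\<in>{..n} \<times> {..m n}. exp (- c1 * s\<^sup>2) * (T n p * R ^ (fst p + snd p)))"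
      unfolding circle_sum_def by (intro order_trans[OF norm_sum] sum_mono)
    also have "\<dots> = exp (- c1 * s\<^sup>2) * (\<Sum>p\<in>{..n} \<times> {..m n}. T n p * R ^ (fst p + snd p))"
      by (simp only: sum_distrib_left)
    also have "\<dots> \<le> exp (- c1 * s\<^sup>2) * (CR * F n)"
      by (intro mult_left_mono CRn) auto
    finally show ?thesis by (simp add: \<theta>_def mult_ac)
  qed

  \<comment> \<open>For large \<open>n\<close> the number \<open>R1 n\<close> is 1, or 0 when
    \<open>F n\<close> vanishes; this makes \<open>E n\<close> zero in the degenerate case.\<close>
  define E where "E n s = indicator (W n) s *\<^sub>R
    (circle_sum Fam D n (m n) (t n) (s / sqrt n) / of_real (F n) - R1 n * \<phi> n (s / sqrt n) ^ n)" for n and s :: real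

  have pow_bound: "norm (\<phi> n (s / sqrt n) ^ n) \<le> exp (- c1 * s\<^sup>2)" if "good n" "s \<in> W n" for n s
  proof -
    have n: "n > 0" using that(1) by (simp add: good_def)
    have "\<bar>s / sqrt n\<bar> \<le> pi" using that(2) n by (auto simp: W_def abs_le_iff pos_divide_le_eq field_simps)
    then have "norm (\<phi> n (s / sqrt n)) ^ n \<le> exp (- c1 * (s / sqrt n)\<^sup>2) ^ n"
      by (intro power_mono \<phi>_le that(1)) auto
    also have "\<dots> = exp (- c1 * s\<^sup>2)"
      using n by (simp add: exp_of_nat_mult[symmetric] power_divide)
    finally show ?thesis by (simp add: norm_power)
  qed

  have pointwise: "(\<lambda>n. E n s) \<longlonglongrightarrow> 0" for s
  proof (rule tendstoI)
    fix \<epsilon> :: real assume \<epsilon>: "\<epsilon> > 0"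
    define \<theta> where "\<theta> n = s / sqrt (real n)" for n
    have \<theta>0: "\<theta> \<longlonglongrightarrow> 0" unfolding \<theta>_def by real_asymp
    then have x1: "(\<lambda>n. cis (\<theta> n)) \<longlonglongrightarrow> 1"
      using tendsto_cis[of \<theta> 0] by simp
    define \<eta> where "\<eta> = \<epsilon> / (2 * (C24 + 1))"
    have \<eta>: "\<eta> > 0" "\<eta> * C24 < \<epsilon> / 2"
      using \<epsilon> C24(1) by (auto simp: \<eta>_def field_simps)
    have "(\<lambda>n. C * (\<theta> n)\<^sup>2 / 2 + C * \<bar>\<theta> n\<bar> ^ 3) \<longlonglongrightarrow> C * 0\<^sup>2 / 2 + C * \<bar>0\<bar> ^ 3"
      by (intro tendsto_intros \<theta>0) auto
    then have small: "\<forall>\<^sub>F n in sequentially. C * (\<theta> n)\<^sup>2 / 2 + C * \<bar>\<theta> n\<bar> ^ 3 < 1 / 2"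
      by (rule order_tendstoD(2)) simp
    note eq = F_ratio_equicontinuous[OF rc dc x1]
    have close: "\<forall>\<^sub>F n in sequentially. norm (F_ratio Fam D n (m n) (1, 1, cis (\<theta> n)) - R1 n) < \<epsilon> / 2"
      using tendstoD[OF eq(1), of "\<epsilon> / 2"] \<epsilon> by (simp add: R1_def)
    show "\<forall>\<^sub>F n in sequentially. dist (E n s) 0 < \<epsilon>"
      using good small close eq(2) C24(2) factor_deviation[OF m_top \<eta>(1)]
    proof eventually_elim
      fix n
      assume g: "good n" and sm: "C * (\<theta> n)\<^sup>2 / 2 + C * \<bar>\<theta> n\<bar> ^ 3 < 1 / 2"
        and cl: "norm (F_ratio Fam D n (m n) (1, 1, cis (\<theta> n)) - R1 n) < \<epsilon> / 2"
        and S_sum: "scaled_term Fam D n (m n) (1, 1, cis (\<theta> n)) summable_on UNIV"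
        and F24: "0 \<le> F n \<and> R1 n = (if F n = 0 then 0 else 1) \<and>
          (\<forall>X. finite X \<longrightarrow> (\<Sum>p\<in>X. T n p * 24 ^ (fst p + snd p)) \<le> C24 * F n)"
        and dev: "\<forall>k l. \<bar>vertex_factor n k * edge_factor (m n) l - 1\<bar> \<le> \<eta> * 12 ^ (k + l)"
      note pos = good_pos[OF g]
      show "dist (E n s) 0 < \<epsilon>"
      proof (cases "s \<in> W n \<and> F n \<noteq> 0")
        case False
        then show ?thesis using F24 \<epsilon> by (auto simp: E_def indicator_def)
      next
        case True
        then have s: "s \<in> W n" and F: "F n > 0" using F24 by auto
        let ?y = "of_real (t n) * cis (\<theta> n)"
        let ?S = "scaled_term Fam D n (m n) (1, 1, cis (\<theta> n))"
        \<comment> \<open>The Taylor estimate keeps \<open>\<Delta>(y)\<close> away from 0 near the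
          saddle point, so here division by it is possible.\<close>
        have half: "norm (\<phi> n (\<theta> n)) \<ge> 1 / 2"
        proof -
          have "norm (\<phi> n (\<theta> n) - of_real (1 - v n * (\<theta> n)\<^sup>2 / 2)) \<le> C * \<bar>\<theta> n\<bar> ^ 3" and vn: "v n \<le> C"
            using v[OF g] by auto
          moreover have "1 - v n * (\<theta> n)\<^sup>2 / 2 \<le> norm (complex_of_real (1 - v n * (\<theta> n)\<^sup>2 / 2))"
            unfolding norm_of_real by (rule abs_ge_self)
          moreover have "v n * (\<theta> n)\<^sup>2 \<le> C * (\<theta> n)\<^sup>2" using vn by (intro mult_right_mono) auto
          moreover have "norm (complex_of_real (1 - v n * (\<theta> n)\<^sup>2 / 2)) - norm (\<phi> n (\<theta> n)) \<le>
              norm (\<phi> n (\<theta> n) - of_real (1 - v n * (\<theta> n)\<^sup>2 / 2))"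
            using norm_triangle_ineq2[of "complex_of_real (1 - v n * (\<theta> n)\<^sup>2 / 2)" "\<phi> n (\<theta> n)"]
            by (simp only: norm_minus_commute)
          ultimately show ?thesis using sm by linarith
        qed
        have n\<phi>: "norm (\<phi> n (\<theta> n)) = norm (Delta D ?y) / Delta D (t n)"
          using pos by (simp add: \<phi>_def norm_mult norm_divide)
        then have \<Delta>y: "Delta D ?y \<noteq> 0" using half by auto
        have inv: "Delta D (t n) / norm (Delta D ?y) \<le> 2"
          using half pos \<Delta>y unfolding n\<phi> by (simp add: field_simps)
        define AB where "AB p = vertex_factor n (fst p) * edge_factor (m n) (snd p)" for p
        define G where "G = (\<Sum>p\<in>{..n} \<times> {..m n}. of_real (AB p) * ?S p)"
        have sumG: "circle_sum Fam D n (m n) (t n) (\<theta> n) = G * \<phi> n (\<theta> n) ^ n"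
          unfolding circle_sum_def G_def sum_distrib_right \<phi>_pow[OF g]
        proof (intro sum.cong refl)
          fix p assume "p \<in> {..n} \<times> {..m n}"
          then obtain k l where p: "p = (k, l)" "k \<le> n" by auto
          show "circle_term Fam D n (m n) (t n) (\<theta> n) p = of_real (AB p) * ?S p *
            ((Delta D ?y / of_real (Delta D (t n))) ^ n * cis (- (real (2 * m n) * \<theta> n)))"
            using circle_term_eq_scaled[OF \<Delta>y p(2) t_def pos(2)] by (simp add: p(1) AB_def)
        qed
        \<comment> \<open>The correction factors vanish for \<open>k > n\<close> or
          \<open>l > m\<close>, so the finite sum is a sum over all pairs and can be compared with
          the full series of \<open>F\<close>.\<close>
        have "((\<lambda>p. of_real (AB p) * ?S p) has_sum G) UNIV"
          by (rule has_sum_finite_neutralI[of "{..n} \<times> {..m n}"])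
            (auto simp: G_def AB_def vertex_factor_def edge_factor_def binomial_eq_0 not_le)
        from has_sum_add[OF this has_sum_cmult_right[OF has_sum_infsum[OF S_sum], of "-1"]]
        have "((\<lambda>p. of_real (AB p - 1) * ?S p) has_sum (G - (\<Sum>\<^sub>\<infinity>p. ?S p))) UNIV"
          by (simp add: algebra_simps)
        then have "norm (G - (\<Sum>\<^sub>\<infinity>p. ?S p)) \<le> \<eta> * (C24 * F n)"
        proof (rule norm_has_sum_le)
          fix X :: "(nat \<times> nat) set" assume X: "finite X"
          have "norm (of_real (AB p - 1) * ?S p) \<le> \<eta> * (T n p * 24 ^ (fst p + snd p))" for p
          proof -
            obtain k l where p: "p = (k, l)" by (cases p)
            have "norm (?S (k, l)) \<le> T n (k, l) * (Delta D (t n) / norm (Delta D ?y)) ^ k"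
              unfolding T_def by (rule norm_scaled_term_le[OF \<Delta>y t_def pos])
            also have "\<dots> \<le> T n (k, l) * 2 ^ k"
              using inv pos by (intro mult_left_mono power_mono T0[OF g]) auto
            also have "\<dots> \<le> T n (k, l) * 2 ^ (k + l)"
              by (intro mult_left_mono power_increasing T0[OF g]) auto
            finally have "\<bar>AB p - 1\<bar> * norm (?S p) \<le> (\<eta> * 12 ^ (k + l)) * (T n (k, l) * 2 ^ (k + l))"
              using dev \<eta>(1) unfolding p AB_def fst_conv snd_conv by (intro mult_mono) auto
            also have "\<dots> = \<eta> * (T n (k, l) * (12 * 2) ^ (k + l))"
              by (simp only: power_mult_distrib mult_ac)
            finally show ?thesis unfolding p norm_mult norm_of_real by simp
          qed
          then have "(\<Sum>p\<in>X. norm (of_real (AB p - 1) * ?S p)) \<le> (\<Sum>p\<in>X. \<eta> * (T n p * 24 ^ (fst p + snd p)))"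
            by (rule sum_mono)
          also have "\<dots> = \<eta> * (\<Sum>p\<in>X. T n p * 24 ^ (fst p + snd p))" by (simp only: sum_distrib_left)
          also have "\<dots> \<le> \<eta> * (C24 * F n)"
            using F24 X \<eta>(1) by (intro mult_left_mono) auto
          finally show "(\<Sum>p\<in>X. norm (of_real (AB p - 1) * ?S p)) \<le> \<eta> * (C24 * F n)" .
        qed
        then have "norm ((G - (\<Sum>\<^sub>\<infinity>p. ?S p)) / of_real (F n)) \<le> \<eta> * C24"
          using F by (simp add: norm_divide divide_le_eq)
        then have 1: "norm ((G - (\<Sum>\<^sub>\<infinity>p. ?S p)) / of_real (F n)) < \<epsilon> / 2" using \<eta>(2) by simp
        have 2: "norm ((\<Sum>\<^sub>\<infinity>p. ?S p) / of_real (F n) - R1 n) < \<epsilon> / 2"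
          using cl by (simp add: F_ratio_def F_def)
        have "G / of_real (F n) - R1 n = (G - (\<Sum>\<^sub>\<infinity>p. ?S p)) / of_real (F n) + ((\<Sum>\<^sub>\<infinity>p. ?S p) / of_real (F n) - R1 n)"
          by (simp add: diff_divide_distrib)
        then have "norm (G / of_real (F n) - R1 n) \<le> norm ((G - (\<Sum>\<^sub>\<infinity>p. ?S p)) / of_real (F n)) +
            norm ((\<Sum>\<^sub>\<infinity>p. ?S p) / of_real (F n) - R1 n)"
          by (simp only: norm_triangle_ineq)
        then have 3: "norm (G / of_real (F n) - R1 n) < \<epsilon>"
          using 1 2 by linarith
        have "E n s = (G / of_real (F n) - R1 n) * \<phi> n (\<theta> n) ^ n"
          using s sumG by (simp add: E_def \<theta>_def algebra_simps)
        then have "norm (E n s) = norm (G / of_real (F n) - R1 n) * norm (\<phi> n (\<theta> n) ^ n)"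
          by (simp only: norm_mult)
        also have "\<dots> \<le> norm (G / of_real (F n) - R1 n) * 1"
        proof (intro mult_left_mono)
          have "norm (\<phi> n (\<theta> n) ^ n) \<le> exp (- c1 * s\<^sup>2)" using pow_bound[OF g s] by (simp add: \<theta>_def)
          also have "\<dots> \<le> 1" using c1(1) by simp
          finally show "norm (\<phi> n (\<theta> n) ^ n) \<le> 1" .
        qed simp
        finally show ?thesis using 3 by simp
      qed
    qed
  qed

  have circ_cont: "continuous_on UNIV (circle_sum Fam D n (m n) (t n))" if "good n" for n
    using good_pos[OF that] that by (intro continuous_intros) (auto simp: good_def)
  have "(\<lambda>n. integral\<^sup>L lborel (E n)) \<longlonglongrightarrow> integral\<^sup>L lborel (\<lambda>s::real. 0)"
  proof (rule dominated_convergence_eventually[where w = "\<lambda>s. (CR + 1) * exp (- c1 * s\<^sup>2)"])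
    show "integrable lborel (\<lambda>s::real. (CR + 1) * exp (- c1 * s\<^sup>2))"
      using c1(1) by (rule integrable_gaussian)
    show "\<forall>\<^sub>F n in sequentially. E n \<in> borel_measurable lborel"
      using good
    proof eventually_elim
      case (elim n)
      have [measurable]: "circle_sum Fam D n (m n) (t n) \<in> borel_measurable borel" "\<phi> n \<in> borel_measurable borel"
        using circ_cont[OF elim] \<phi>_meas[OF elim] by (auto intro: borel_measurable_continuous_onI)
      show ?case unfolding E_def[abs_def] W_def by simp
    qed
    show "\<forall>\<^sub>F n in sequentially. \<forall>s. norm (E n s) \<le> (CR + 1) * exp (- c1 * s\<^sup>2)"
      using good CR(2)
    proof (eventually_elim, intro allI)
      fix n and s :: real
      assume g: "good n" and F: "0 \<le> F n \<and> R1 n = (if F n = 0 then 0 else 1) \<and>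
        (\<forall>X. finite X \<longrightarrow> (\<Sum>p\<in>X. T n p * R ^ (fst p + snd p)) \<le> CR * F n)"
      show "norm (E n s) \<le> (CR + 1) * exp (- c1 * s\<^sup>2)"
      proof (cases "s \<in> W n \<and> F n \<noteq> 0")
        case False
        then show ?thesis using F CR(1) by (auto simp: E_def indicator_def)
      next
        case True
        then have s: "s \<in> W n" and Fn: "F n > 0" "R1 n = 1" using F by auto
        have "norm (E n s) \<le> norm (circle_sum Fam D n (m n) (t n) (s / sqrt n) / of_real (F n)) + norm (\<phi> n (s / sqrt n) ^ n)"
          using s Fn(2) norm_triangle_ineq4 by (simp add: E_def)
        also have "norm (circle_sum Fam D n (m n) (t n) (s / sqrt n) / of_real (F n)) \<le> CR * exp (- c1 * s\<^sup>2)"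
          using sum_bound[OF g s] F Fn(1) by (simp add: norm_divide divide_le_eq mult_ac)
        also have "norm (\<phi> n (s / sqrt n) ^ n) \<le> exp (- c1 * s\<^sup>2)" by (rule pow_bound[OF g s])
        finally show ?thesis by (simp add: algebra_simps)
      qed
    qed
  qed (use pointwise in auto)
  then have E_lim: "(\<lambda>n. integral\<^sup>L lborel (E n)) \<longlonglongrightarrow> 0" by simp
  have E_eq: "integral\<^sup>L lborel (E n) = J n / of_real (F n) - R1 n * I n" if "good n" for n
  proof -
    have n0: "n > 0" using that by (simp add: good_def)
    have int: "integrable lborel (\<lambda>s. indicator (W n) s *\<^sub>R h (s / sqrt n))" if "continuous_on UNIV h" for h :: "real \<Rightarrow> complex"
      unfolding W_def
      by (rule borel_integrable_atLeastAtMost'[unfolded set_integrable_def])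
        (rule continuous_on_compose2[OF that], use n0 in \<open>auto intro!: continuous_intros\<close>)
    have i1: "integrable lborel (\<lambda>s. indicator (W n) s *\<^sub>R circle_sum Fam D n (m n) (t n) (s / sqrt n))"
      by (rule int[OF circ_cont[OF that]])
    have i2: "integrable lborel (\<lambda>s. indicator (W n) s *\<^sub>R \<phi> n (s / sqrt n) ^ n)"
      by (rule int[where h = "\<lambda>\<theta>. \<phi> n \<theta> ^ n"]) (intro continuous_intros \<phi>_cont that)
    have "E n = (\<lambda>s. indicator (W n) s *\<^sub>R circle_sum Fam D n (m n) (t n) (s / sqrt n) / of_real (F n) -
        R1 n * (indicator (W n) s *\<^sub>R \<phi> n (s / sqrt n) ^ n))"
      by (auto simp: E_def fun_eq_iff indicator_def)
    then have "integral\<^sup>L lborel (E n) =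
        (\<integral>s. indicator (W n) s *\<^sub>R circle_sum Fam D n (m n) (t n) (s / sqrt n) / of_real (F n) \<partial>lborel) -
        (\<integral>s. R1 n * (indicator (W n) s *\<^sub>R \<phi> n (s / sqrt n) ^ n) \<partial>lborel)"
      by (simp only:) (intro Bochner_Integration.integral_diff integrable_divide_zero integrable_mult_right i1 i2)
    then show ?thesis
      by (simp only: integral_divide_zero integral_mult_right_zero I_def J_def)
  qed
  \<comment> \<open>The quotient used in the definition of asymptotic equivalence, where 0 against 0
    counts as 1.\<close>
  define q where "q n = (if real (card (distinguished Fam n (m n) D)) = 0 \<and> real (MG n (m n) D) * F n = 0 then 1
    else real (card (distinguished Fam n (m n) D)) / (real (MG n (m n) D) * F n))" for n
  have "(\<lambda>n. q n - 1) \<longlonglongrightarrow> 0"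
  proof (rule Lim_null_comparison)
    show "(\<lambda>n. norm (integral\<^sup>L lborel (E n)) / c0) \<longlonglongrightarrow> 0"
      using tendsto_divide[OF tendsto_norm[OF E_lim] tendsto_const[of c0]] c0(1) by simp
    show "\<forall>\<^sub>F n in sequentially. norm (q n - 1) \<le> norm (integral\<^sup>L lborel (E n)) / c0"
      using good c0(2) CR(2)
    proof eventually_elim
      fix n
      assume g: "good n" and In: "c0 \<le> norm (I n)" and Fn: "0 \<le> F n \<and> R1 n = (if F n = 0 then 0 else 1) \<and>
        (\<forall>X. finite X \<longrightarrow> (\<Sum>p\<in>X. T n p * R ^ (fst p + snd p)) \<le> CR * F n)"
      note MG = ratio[OF g In]
      show "norm (q n - 1) \<le> norm (integral\<^sup>L lborel (E n)) / c0"
      proof (cases "F n = 0")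
        case True
        \<comment> \<open>The uniform bound carries the factor \<open>F n\<close>, so here it forces
          the integrand, and thus the number of pairs, to be 0.\<close>
        have "circle_sum Fam D n (m n) (t n) (s / sqrt n) = 0" if "s \<in> W n" for s
          using sum_bound[OF g that] Fn True by simp
        then have "(\<lambda>s. indicator (W n) s *\<^sub>R circle_sum Fam D n (m n) (t n) (s / sqrt n)) = (\<lambda>s. 0)"
          by (auto simp: fun_eq_iff indicator_def)
        then have "J n = 0" by (simp add: J_def)
        with MG have "card (distinguished Fam n (m n) D) = 0"
          by (auto simp del: card_eq_0_iff)
        then show ?thesis using True c0(1) by (simp add: q_def)
      next
        case False
        have I0: "I n \<noteq> 0" using In c0(1) by auto
        have "q n = real (card (distinguished Fam n (m n) D)) / real (MG n (m n) D) / F n"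
          using MG False by (simp add: q_def)
        then have "complex_of_real (q n - 1) = (J n / I n) / of_real (F n) - 1"
          using MG by (simp only: of_real_diff of_real_divide[of _ "F n"] of_real_1)
        also have "\<dots> = integral\<^sup>L lborel (E n) / I n"
          using E_eq[OF g] Fn False I0 by (simp add: diff_divide_distrib mult.commute)
        finally have "norm (q n - 1) = norm (integral\<^sup>L lborel (E n)) / norm (I n)"
          by (metis norm_divide norm_of_real real_norm_def)
        also have "\<dots> \<le> norm (integral\<^sup>L lborel (E n)) / c0"
          using In c0(1) by (intro divide_left_mono mult_pos_pos) auto
        finally show ?thesis .
      qed
    qed
  qed
  then have "q \<longlonglongrightarrow> 1" by (rule LIM_zero_cancel)
  then show ?thesis
    unfolding asymp_equiv_def q_def[abs_def] F_def by simp
qed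

theorem theorem4:
  fixes D :: "nat set" and m :: "nat \<Rightarrow> nat" and c :: real
    and Fam :: "(nat, nat) pre_digraph set"
  assumes "\<exists>a\<in>D. \<exists>b\<in>D. a \<noteq> b"
    and "Gcd ((\<lambda>d. d - Inf D) ` D) = 1"
    and "filterlim m at_top sequentially"
    and "(\<lambda>n. 2 * real (m n) / real n) \<longlonglongrightarrow> c"
    and "real (Inf D) < c"
    and "finite D \<longrightarrow> c < real (Max D)"
    and "\<forall>H\<in>Fam. fin_digraph H"
  shows "(\<forall>n M. real (card (distinguished Fam n M D)) =
            fact n * 2 ^ M * fact M *
            fps_nth (fps_nth
              (\<Sum>j. fps_const (fps_const (fact (2 * j)))
                    * coeff_x (2 * j)
                        (family_fps Fam (Delta_derivs_fps D) * exp_z_fps (Delta_fps D))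
                    * (fps_const (fps_const (1 / (2 ^ j * fact j))) * fps_X ^ j)) M) n)
       \<and> (ratio_converges Fam D m c \<longrightarrow>
            (\<lambda>n. real (card (distinguished Fam n (m n) D)))
              \<sim>[sequentially]
            (\<lambda>n. real (MG n (m n) D) * F_at_chi Fam D n (m n)))"
proof (intro conjI allI impI)
  show "real (card (distinguished Fam n M D)) =
            fact n * 2 ^ M * fact M *
            fps_nth (fps_nth
              (\<Sum>j. fps_const (fps_const (fact (2 * j)))
                    * coeff_x (2 * j)
                        (family_fps Fam (Delta_derivs_fps D) * exp_z_fps (Delta_fps D))
                    * (fps_const (fps_const (1 / (2 ^ j * fact j))) * fps_X ^ j)) M) n" for n M
    by (rule card_distinguished_gf)
next
  assume rc: "ratio_converges Fam D m c"
  \<comment> \<open>An infinite \<open>D\<close> is unbounded, which plays the part of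
    \<open>max D\<close> being infinite.\<close>
  have "\<exists>d\<in>D. c < real d"
  proof (cases "finite D")
    case True
    then show ?thesis using assms(1,6) Max_in[of D] by blast
  next
    case False
    then obtain d where "d \<in> D" "d > nat \<lceil>c\<rceil>"
      by (meson infinite_nat_iff_unbounded)
    then show ?thesis
      by (intro bexI[of _ d]) linarith+
  qed
  then have "degree_range D c"
    using assms(5) by (simp add: degree_range_def)
  from distinguished_asymptotics[OF assms(1-4) this rc]
  show "(\<lambda>n. real (card (distinguished Fam n (m n) D))) \<sim>[sequentially]
    (\<lambda>n. real (MG n (m n) D) * F_at_chi Fam D n (m n))" .
qed

end
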